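(* For a del Pezzo surface $X$ of degree $4$, the $16$ metric trees on its tropicalization $\mathrm{trop}(X^0)$, obtained from the $(-1)$-curves on $X$, are identical up to relabeling.
   Context: $K$ is a field of characteristic $0$ with a non-archimedean valuation. $X$ is a smooth del Pezzo surface of degree $4$ over $K$, i.e. the blow-up of $\mathbb{P}^2$ at five points in general position. Its $16$ $(-1)$-curves are the five exceptional curves $E_i$, the ten strict transforms $F_{ij}$ of lines through two of the points, and the strict transform $G$ of the conic through all five points. $X^0$ is $X$ minus these $16$ curves, and $\mathrm{trop}(X^0)$ is its tropicalization in its intrinsic torus. Each $(-1)$-curve $C\cong\mathbb{P}^1$ meets exactly five other $(-1)$-curves, giving five distinct marked points on $C$. The metric tree of $C$ (the boundary tree of $\mathrm{trop}(X^0)$ at infinity corresponding to $C$) is the metric tree with five leaves, labelled by these five $(-1)$-curves, whose bounded edge lengths are determined by the valuations of the cross-ratios of the five marked points, i.e. the corresponding point of $\mathrm{trop}(M_{0,5})$. Identical up to relabeling means isomorphic as metric trees after a bijection between leaf labels. *)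

theory Defs
  imports "HOL-Analysis.Analysis"
begin

section \<open>Valuations\<close>

definition nonarch_valuation :: "('k::field \<Rightarrow> ereal) \<Rightarrow> bool" where
  "nonarch_valuation val \<longleftrightarrow>
     (\<forall>x. val x = \<infinity> \<longleftrightarrow> x = 0) \<and> (\<forall>x. val x \<noteq> -\<infinity>) \<and>
     (\<forall>x y. val (x * y) = val x + val y) \<and>
     (\<forall>x y. val (x + y) \<ge> min (val x) (val y))"

section \<open>Multiprojective varieties\<close>

text \<open>
  A point of the product of projective spaces \<open>\<Prod>i\<in>'m. P('k^'n)\<close> is represented by a tuple
  \<open>z :: 'k^'n^'m\<close> of nonzero vectors of homogeneous coordinates; tuples related by
  \<open>mproj_eq\<close> represent the same point. Accordingly, a subset of the product is given by the
  set of all representatives of its points. Only \<open>'k\<close>-rational points are considered. This loses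
  nothing here: over an infinite field a polynomial is determined by its polynomial function,
  and the varieties below are rational, so their rational points are Zariski dense.
\<close>

definition proj_eq :: "'k::field^'n \<Rightarrow> 'k^'n \<Rightarrow> bool" where
  "proj_eq x y \<longleftrightarrow> (\<exists>c. c \<noteq> 0 \<and> x = c *s y)"

definition mproj :: "('k::field^'n^'m) set" where
  "mproj = {z. \<forall>i. z $ i \<noteq> 0}"

definition mproj_eq :: "'k::field^'n^'m \<Rightarrow> 'k^'n^'m \<Rightarrow> bool" where
  "mproj_eq z w \<longleftrightarrow> (\<forall>i. proj_eq (z $ i) (w $ i))"

inductive_set polyfun :: "('k::field^'n^'m \<Rightarrow> 'k) set" where
  const: "(\<lambda>z. c) \<in> polyfun"
| coord: "(\<lambda>z. z $ i $ a) \<in> polyfun"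
| add: "f \<in> polyfun \<Longrightarrow> g \<in> polyfun \<Longrightarrow> (\<lambda>z. f z + g z) \<in> polyfun"
| mult: "f \<in> polyfun \<Longrightarrow> g \<in> polyfun \<Longrightarrow> (\<lambda>z. f z * g z) \<in> polyfun"

text \<open>Multihomogeneous polynomials of multidegree \<open>d\<close>.\<close>

definition mform :: "('m::finite \<Rightarrow> nat) \<Rightarrow> ('k::field^'n^'m \<Rightarrow> 'k) set" where
  "mform d = {f \<in> polyfun. \<forall>c z. f (\<chi> i. c i *s (z $ i)) = (\<Prod>i\<in>UNIV. c i ^ d i) * f z}"

definition zariski_closure :: "('k::field^'n^'m) set \<Rightarrow> ('k^'n^'m) set" where
  "zariski_closure S = {z \<in> mproj. \<forall>d. \<forall>f\<in>mform d. (\<forall>w\<in>S. f w = 0) \<longrightarrow> f z = 0}"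

text \<open>
  A regular map is given, near each point, by tuples of forms of equal multidegree (for each
  factor of the target) that do not vanish simultaneously.
\<close>

definition regular_map ::
  "('k::field^'n^'m) set \<Rightarrow> ('k^'a^'b) set \<Rightarrow> ('k^'n^'m \<Rightarrow> 'k^'a^'b) \<Rightarrow> bool" where
  "regular_map A B f \<longleftrightarrow> f ` A \<subseteq> B \<and>
     (\<forall>z\<in>A. \<exists>F. (\<forall>j. \<exists>d. \<forall>b. (\<lambda>w. F w $ j $ b) \<in> mform d) \<and> F z \<in> mproj \<and>
        (\<forall>w\<in>A. F w \<in> mproj \<longrightarrow> mproj_eq (f w) (F w)))"

definition isomorphism ::
  "('k::field^'n^'m) set \<Rightarrow> ('k^'a^'b) set \<Rightarrow> ('k^'n^'m \<Rightarrow> 'k^'a^'b) \<Rightarrow> bool" where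
  "isomorphism A B f \<longleftrightarrow> regular_map A B f \<and>
     (\<exists>g. regular_map B A g \<and> (\<forall>z\<in>A. mproj_eq (g (f z)) z) \<and> (\<forall>w\<in>B. mproj_eq (f (g w)) w))"

abbreviation P1 :: "('k::field^2^1) set" where
  "P1 \<equiv> mproj"

section \<open>Del Pezzo surfaces of degree 4 and their (-1)-curves\<close>

text \<open>
  \<open>on_line l x\<close>: the point \<open>x\<close> lies on the line \<open>l\<close>, both given by homogeneous coordinates
  in the projective plane and in its dual.
\<close>

definition on_line :: "'k::field^3 \<Rightarrow> 'k^3 \<Rightarrow> bool" where
  "on_line l x \<longleftrightarrow> (\<Sum>a\<in>UNIV. l $ a * x $ a) = 0"

text \<open>For five points, general position means that no three of them are collinear.\<close>

definition general_position :: "(5 \<Rightarrow> 'k::field^3) \<Rightarrow> bool" where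
  "general_position p \<longleftrightarrow> (\<forall>i. p i \<noteq> 0) \<and>
     (\<forall>i j k. i \<noteq> j \<and> i \<noteq> k \<and> j \<noteq> k \<longrightarrow>
        \<not> (\<exists>l. l \<noteq> 0 \<and> on_line l (p i) \<and> on_line l (p j) \<and> on_line l (p k)))"

text \<open>
  The blow-up of the plane in one point \<open>p\<close> is the incidence variety of pairs \<open>(x, l)\<close> with \<open>l\<close>
  a line through \<open>x\<close> and \<open>p\<close>. The blow-up in five distinct points is the fibre product
  of these over the plane. The factor \<open>None\<close> holds the image \<open>x\<close> of a point under
  the blow-down map, and the factor \<open>Some i\<close> the line through \<open>x\<close> and \<open>p i\<close>.
\<close>

definition del_pezzo :: "(5 \<Rightarrow> 'k::field^3) \<Rightarrow> ('k^3^(5 option)) set" where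
  "del_pezzo p = {z \<in> mproj. \<forall>i. on_line (z $ Some i) (z $ None) \<and> on_line (z $ Some i) (p i)}"

definition exceptional_curve :: "(5 \<Rightarrow> 'k::field^3) \<Rightarrow> 5 \<Rightarrow> ('k^3^(5 option)) set" where
  "exceptional_curve p i = {z \<in> del_pezzo p. proj_eq (z $ None) (p i)}"

definition strict_transform ::
  "(5 \<Rightarrow> 'k::field^3) \<Rightarrow> ('k^3) set \<Rightarrow> ('k^3^(5 option)) set" where
  "strict_transform p C =
     zariski_closure {z \<in> del_pezzo p. z $ None \<in> C \<and> (\<forall>i. \<not> proj_eq (z $ None) (p i))}"

definition line_through :: "'k::field^3 \<Rightarrow> 'k^3 \<Rightarrow> ('k^3) set" where
  "line_through x y = vec.span {x, y} - {0}"

text \<open>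
  In general position there is exactly one conic through the five points, that is, the symmetric
  matrix \<open>Q\<close> below is unique up to scaling.
\<close>

definition conic_through :: "(5 \<Rightarrow> 'k::field^3) \<Rightarrow> ('k^3) set" where
  "conic_through p = {x. x \<noteq> 0 \<and> (\<exists>Q::'k^3^3. Q \<noteq> 0 \<and> transpose Q = Q \<and>
     (\<forall>y \<in> insert x (range p). (\<Sum>a\<in>UNIV. \<Sum>b\<in>UNIV. Q $ a $ b * y $ a * y $ b) = 0))}"

definition minus_one_curves :: "(5 \<Rightarrow> 'k::field^3) \<Rightarrow> ('k^3^(5 option)) set set" where
  "minus_one_curves p =
     {exceptional_curve p i | i. True} \<union>
     {strict_transform p (line_through (p i) (p j)) | i j. i \<noteq> j} \<union>
     {strict_transform p (conic_through p)}"

definition meeting_curves ::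
  "(5 \<Rightarrow> 'k::field^3) \<Rightarrow> ('k^3^(5 option)) set \<Rightarrow> ('k^3^(5 option)) set set" where
  "meeting_curves p C = {D \<in> minus_one_curves p. D \<noteq> C \<and> C \<inter> D \<noteq> {}}"

section \<open>Metric trees\<close>

text \<open>
  The vertices are the inner vertices only: the leaf labelled \<open>a\<close> is the end of an unbounded ray
  attached at the vertex \<open>attach T a\<close>, and \<open>edges T\<close> are the bounded edges.
\<close>

record ('v, 'l) metric_tree =
  verts :: "'v set"
  edges :: "'v set set"
  len :: "'v set \<Rightarrow> real"
  leaves :: "'l set"
  attach :: "'l \<Rightarrow> 'v"

definition simple_path :: "'v set set \<Rightarrow> 'v \<Rightarrow> 'v list \<Rightarrow> 'v \<Rightarrow> bool" where
  "simple_path E u us v \<longleftrightarrow> us \<noteq> [] \<and> hd us = u \<and> last us = v \<and> distinct us \<and>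
     successively (\<lambda>x y. {x, y} \<in> E) us"

definition is_metric_tree :: "('v, 'l) metric_tree \<Rightarrow> bool" where
  "is_metric_tree T \<longleftrightarrow>
     finite (verts T) \<and> verts T \<noteq> {} \<and> finite (leaves T) \<and>
     edges T \<subseteq> {{u, v} | u v. u \<in> verts T \<and> v \<in> verts T \<and> u \<noteq> v} \<and>
     (\<forall>u\<in>verts T. \<forall>v\<in>verts T. \<exists>!us. simple_path (edges T) u us v) \<and>
     (\<forall>e\<in>edges T. len T e > 0) \<and>
     attach T ` leaves T \<subseteq> verts T \<and>
     (\<forall>v\<in>verts T. card {e \<in> edges T. v \<in> e} + card {a \<in> leaves T. attach T a = v} \<ge> 3)"

definition tree_dist :: "('v, 'l) metric_tree \<Rightarrow> 'v \<Rightarrow> 'v \<Rightarrow> real" where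
  "tree_dist T u v =
     (let us = (THE us. simple_path (edges T) u us v)
      in \<Sum>k<length us - 1. len T {us ! k, us ! Suc k})"

abbreviation leaf_dist :: "('v, 'l) metric_tree \<Rightarrow> 'l \<Rightarrow> 'l \<Rightarrow> real" where
  "leaf_dist T a b \<equiv> tree_dist T (attach T a) (attach T b)"

definition identical_up_to_relabeling ::
  "('v, 'l) metric_tree \<Rightarrow> ('w, 'm) metric_tree \<Rightarrow> bool" where
  "identical_up_to_relabeling T T' \<longleftrightarrow> (\<exists>\<sigma> \<phi>.
     bij_betw \<sigma> (leaves T) (leaves T') \<and> bij_betw \<phi> (verts T) (verts T') \<and>
     edges T' = (\<lambda>e. \<phi> ` e) ` edges T \<and>
     (\<forall>e\<in>edges T. len T' (\<phi> ` e) = len T e) \<and>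
     (\<forall>a\<in>leaves T. attach T' (\<sigma> a) = \<phi> (attach T a)))"

section \<open>The metric tree of a (-1)-curve\<close>

definition bracket :: "'k::field^2^1 \<Rightarrow> 'k^2^1 \<Rightarrow> 'k" where
  "bracket x y = x $ 1 $ 1 * y $ 1 $ 2 - x $ 1 $ 2 * y $ 1 $ 1"

definition cross_ratio :: "'k::field^2^1 \<Rightarrow> 'k^2^1 \<Rightarrow> 'k^2^1 \<Rightarrow> 'k^2^1 \<Rightarrow> 'k" where
  "cross_ratio x y z w = (bracket x z * bracket y w) / (bracket x w * bracket y z)"

text \<open>
  The five marked points are transported to the projective line by an isomorphism \<open>\<psi>\<close> onto
  the curve, the mark \<open>x D\<close> being the point with \<open>\<psi> (x D) \<in> C \<inter> D\<close>.
  A tree corresponds to the point of the tropicalization of \<open>M\<^sub>0\<^sub>,\<^sub>5\<close> with tropical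
  Pluecker coordinates \<open>- leaf_dist / 2\<close> up to lineality, and these agree up to
  lineality with the valuations of the brackets of the marks. Equivalently, as stated here,
  they assign the same value to each cross-ratio. Leaf rays would cancel from the right-hand
  side, so it involves bounded edges only: for instance, if \<open>a, c\<close> and \<open>b, d\<close> are
  separated in \<open>T\<close>, it is the length of the path separating them.
\<close>

definition metric_tree_of_curve ::
  "('k::field \<Rightarrow> ereal) \<Rightarrow> (5 \<Rightarrow> 'k^3) \<Rightarrow> ('k^3^(5 option)) set \<Rightarrow>
     ('v, ('k^3^(5 option)) set) metric_tree \<Rightarrow> bool" where
  "metric_tree_of_curve val p C T \<longleftrightarrow>
     is_metric_tree T \<and> leaves T = meeting_curves p C \<and> card (leaves T) = 5 \<and>
     (\<exists>\<psi> x. isomorphism P1 C \<psi> \<and> (\<forall>D\<in>leaves T. x D \<in> P1 \<and> \<psi> (x D) \<in> D) \<and>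
       (\<forall>a\<in>leaves T. \<forall>b\<in>leaves T. \<forall>c\<in>leaves T. \<forall>d\<in>leaves T. distinct [a, b, c, d] \<longrightarrow>
          val (cross_ratio (x a) (x b) (x c) (x d)) =
          ereal ((leaf_dist T a d + leaf_dist T b c - leaf_dist T a c - leaf_dist T b d) / 2)))"

end

theory Submission
  imports Defs "HOL-Computational_Algebra.Polynomial"
begin

text \<open>
  The sixteen curves carry projectively equivalent configurations of five marked points. The five
  blown-up points \<open>p i\<close> lie on a smooth conic; parametrize it by the projective line, and let \<open>q i\<close> be the
  parameter of \<open>p i\<close>. Each \<open>(-1)\<close>-curve has a parametrization by the same line whose marked points are
  exactly at \<open>q 1, ..., q 5\<close>. For the strict transform of the conic this is clear: it meets the exceptional
  curve over \<open>p a\<close> at \<open>q a\<close>. The exceptional curve over \<open>p i\<close> is the pencil of lines through \<open>p i\<close>, and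
  projection of the conic from \<open>p i\<close> identifies it with the conic; the line to \<open>p a\<close> gets the parameter
  \<open>q a\<close>, and the tangent, which is the mark of the conic, gets \<open>q i\<close>. On the line through \<open>p i\<close> and \<open>p j\<close>,
  projecting the conic from a third point \<open>p k\<close> gives the parameters \<open>q i\<close> and \<open>q j\<close> to \<open>p i\<close> and \<open>p j\<close>,
  and \<open>q l\<close> to the intersection with the line through \<open>p k\<close> and \<open>p l\<close>. The involution of the line
  exchanging \<open>q i\<close> with \<open>q j\<close> and \<open>q l\<close> with \<open>q m\<close> turns this into a parametrization in which \<open>p j\<close> has the
  parameter \<open>q i\<close>, \<open>p i\<close> has \<open>q j\<close>, and the intersection with the line through any two of the other three
  points has that of the third, independently of the choice of \<open>k\<close>.
  These are the lemmas \<open>conic_marked\<close>, \<open>exc_marked\<close> and \<open>lin_marked\<close>. They rest on explicit equations for the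
  strict transforms, obtained from \<open>zariski_closure_param\<close>.

  The tree of a curve is defined by the cross-ratios of the marks with respect to any isomorphism with the
  line. As automorphisms of the line are Moebius transformations, the cross-ratios do not depend on the
  isomorphism (\<open>isomorphism_cross_ratio\<close>), so they are those of the points \<open>q a\<close> for every curve.

  On the side of trees, a metric tree with five leaves has at most three inner vertices and is embedded
  in the real line; its leaf distances are maxima of the combinations of four leaf distances that
  correspond to cross-ratios, so these determine the tree (\<open>caterpillars_isomorphic\<close>). A tree with given
  cross-ratio data exists because the Pluecker relations imply the four-point condition
  (\<open>four_point_caterpillar\<close>).
\<close>

section \<open>Polynomial functions\<close>

text \<open>
  Polynomial functions are handled through one-variable polynomials obtained by substituting
  polynomials for the coordinates. The second property is the congruence \<open>F (X + c Y) \<equiv> F X\<close>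
  modulo \<open>c\<close>; it replaces expanding a form in powers of one of its arguments.
\<close>

lemma polyfun_subst:
  assumes "f \<in> polyfun"
  shows "\<exists>F :: ('m::finite \<Rightarrow> 'n::finite \<Rightarrow> 'k::field poly) \<Rightarrow> 'k poly.
    (\<forall>X t. poly (F X) t = f (\<chi> i a. poly (X i a) t)) \<and>
    (\<forall>X Y c. c dvd F (\<lambda>i a. X i a + c * Y i a) - F X)"
  using assms
proof induction
  case (const c)
  then show ?case by (intro exI[of _ "\<lambda>X. [:c:]"]) auto
next
  case (coord i a)
  then show ?case by (intro exI[of _ "\<lambda>X. X i a"]) auto
next
  case (add f g)
  then obtain F G where F: "\<forall>X t. poly (F X) t = f (\<chi> i a. poly (X i a) t)"
    "\<forall>X Y c. c dvd F (\<lambda>i a. X i a + c * Y i a) - F X"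
    and G: "\<forall>X t. poly (G X) t = g (\<chi> i a. poly (X i a) t)"
    "\<forall>X Y c. c dvd G (\<lambda>i a. X i a + c * Y i a) - G X" by blast
  have "c dvd (F (\<lambda>i a. X i a + c * Y i a) + G (\<lambda>i a. X i a + c * Y i a)) - (F X + G X)" for X Y c
    using dvd_add[OF F(2)[rule_format, of c X Y] G(2)[rule_format, of c X Y]]
    by (simp add: algebra_simps)
  then show ?case using F(1) G(1) by (intro exI[of _ "\<lambda>X. F X + G X"]) auto
next
  case (mult f g)
  then obtain F G where F: "\<forall>X t. poly (F X) t = f (\<chi> i a. poly (X i a) t)"
    "\<forall>X Y c. c dvd F (\<lambda>i a. X i a + c * Y i a) - F X"
    and G: "\<forall>X t. poly (G X) t = g (\<chi> i a. poly (X i a) t)"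
    "\<forall>X Y c. c dvd G (\<lambda>i a. X i a + c * Y i a) - G X" by blast
  have "c dvd F (\<lambda>i a. X i a + c * Y i a) * G (\<lambda>i a. X i a + c * Y i a) - F X * G X" for X Y c
  proof -
    have "F (\<lambda>i a. X i a + c * Y i a) * G (\<lambda>i a. X i a + c * Y i a) - F X * G X
      = (F (\<lambda>i a. X i a + c * Y i a) - F X) * G (\<lambda>i a. X i a + c * Y i a)
        + F X * (G (\<lambda>i a. X i a + c * Y i a) - G X)"
      by (simp add: algebra_simps)
    then show ?thesis
      using F(2)[rule_format, of c X Y] G(2)[rule_format, of c X Y] by simp
  qed
  then show ?case using F(1) G(1) by (intro exI[of _ "\<lambda>X. F X * G X"]) auto
qed

text \<open>
  On the line joining \<open>w\<close> to \<open>w0\<close> both functions become polynomials in one variable whose product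
  vanishes at infinitely many points. This is how a property of generic points is extended to
  all points below.
\<close>

lemma polyfun_no_zero_divisors:
  fixes f b :: "'k::field_char_0^'n::finite^'m::finite \<Rightarrow> 'k"
  assumes f: "f \<in> polyfun" and b: "b \<in> polyfun" and fb: "\<And>w. b w \<noteq> 0 \<Longrightarrow> f w = 0" and w0: "b w0 \<noteq> 0"
  shows "f w = 0"
proof -
  define X where "X i a = [:w $ i $ a, w0 $ i $ a - w $ i $ a:]" for i :: 'm and a :: 'n
  obtain F where F: "\<forall>X t. poly (F X) t = f (\<chi> i a. poly (X i a) t)"
    using polyfun_subst[OF f] by blast
  obtain B where B: "\<forall>X t. poly (B X) t = b (\<chi> i a. poly (X i a) t)"
    using polyfun_subst[OF b] by blast
  have "poly (F X * B X) t = 0" for t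
    using fb by (auto simp: F B)
  then have "F X * B X = 0"
    using poly_all_0_iff_0 by blast
  moreover have "poly (B X) 1 = b w0"
    unfolding B[rule_format] by (rule arg_cong[of _ _ b]) (simp add: X_def vec_eq_iff)
  ultimately have "F X = 0"
    using w0 by auto
  moreover have "poly (F X) 0 = f w"
    unfolding F[rule_format] by (rule arg_cong[of _ _ f]) (simp add: X_def vec_eq_iff)
  ultimately show ?thesis by simp
qed

lemma polyfun_cmult: "f \<in> polyfun \<Longrightarrow> (\<lambda>z. c * f z) \<in> polyfun"
  by (rule polyfun.mult[OF polyfun.const])

lemma polyfun_diff: "f \<in> polyfun \<Longrightarrow> g \<in> polyfun \<Longrightarrow> (\<lambda>z. f z - g z) \<in> polyfun"
  using polyfun.add[OF _ polyfun_cmult[of g "-1"], of f] by simp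

lemma polyfun_uminus: "f \<in> polyfun \<Longrightarrow> (\<lambda>z. - f z) \<in> polyfun"
  using polyfun_cmult[of f "-1"] by simp

lemma polyfun_sum:
  assumes "finite A" "\<And>x. x \<in> A \<Longrightarrow> f x \<in> polyfun" shows "(\<lambda>z. \<Sum>x\<in>A. f x z) \<in> polyfun"
  using assms by (induction A) (auto intro: polyfun.intros)

lemma polyfun_prod:
  assumes "finite A" "\<And>x. x \<in> A \<Longrightarrow> f x \<in> polyfun" shows "(\<lambda>z. \<Prod>x\<in>A. f x z) \<in> polyfun"
  using assms by (induction A) (auto intro: polyfun.intros)

lemmas polyfun_intros = polyfun.intros polyfun_diff polyfun_uminus

lemma polyfun_compose:
  assumes "g \<in> polyfun" "\<And>j b. (\<lambda>w. F w $ j $ b) \<in> polyfun"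
  shows "(\<lambda>w. g (F w)) \<in> polyfun"
  using assms(1) by induction (use assms(2) in \<open>auto intro: polyfun.intros\<close>)

lemma polyfun_prod_nonzero:
  fixes f :: "'a \<Rightarrow> 'k::field_char_0^'n::finite^'m::finite \<Rightarrow> 'k"
  assumes "finite A" "\<And>x. x \<in> A \<Longrightarrow> f x \<in> polyfun" "\<And>x. x \<in> A \<Longrightarrow> \<exists>w. f x w \<noteq> 0"
  shows "\<exists>w. (\<Prod>x\<in>A. f x w) \<noteq> 0"
  using assms
proof (induction A)
  case (insert x A)
  then obtain w0 where w0: "(\<Prod>x\<in>A. f x w0) \<noteq> 0" by auto
  have p: "(\<lambda>z. \<Prod>x\<in>A. f x z) \<in> polyfun" using insert by (intro polyfun_prod) auto
  show ?case
  proof (rule ccontr)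
    assume "\<not> ?thesis"
    then have "f x w = 0" if "(\<Prod>x\<in>A. f x w) \<noteq> 0" for w
      using insert(1,2) that by auto
    then have "f x w = 0" for w
      using polyfun_no_zero_divisors[OF insert.prems(1)[of x] p _ w0] by blast
    then show False using insert.prems(2)[of x] by auto
  qed
qed auto

section \<open>Multihomogeneous forms and projective points\<close>

lemma mform_polyfun: "f \<in> mform d \<Longrightarrow> f \<in> polyfun" by (simp add: mform_def)

lemma mform_scale: "f \<in> mform d \<Longrightarrow> f (\<chi> i. c i *s (z $ i)) = (\<Prod>i\<in>UNIV. c i ^ d i) * f z"
  by (simp add: mform_def)

lemma mform_mult:
  "f \<in> mform d \<Longrightarrow> g \<in> mform e \<Longrightarrow> (\<lambda>z. f z * g z) \<in> mform (\<lambda>i. d i + e i)"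
  by (auto simp: mform_def polyfun.mult power_add prod.distrib)

lemma mform_diff: "f \<in> mform d \<Longrightarrow> g \<in> mform d \<Longrightarrow> (\<lambda>z. f z - g z) \<in> mform d"
  by (auto simp: mform_def polyfun_diff algebra_simps)

lemma mform_add: "f \<in> mform d \<Longrightarrow> g \<in> mform d \<Longrightarrow> (\<lambda>z. f z + g z) \<in> mform d"
  by (auto simp: mform_def polyfun.add algebra_simps)

lemma mform_cmult: "f \<in> mform d \<Longrightarrow> (\<lambda>z. c * f z) \<in> mform d"
  by (auto simp: mform_def polyfun_cmult algebra_simps)

lemma mform_multc: "f \<in> mform d \<Longrightarrow> (\<lambda>z. f z * c) \<in> mform d"
  by (drule mform_cmult[of _ _ c]) (simp add: mult.commute)

lemma mform_const: "(\<lambda>z. c) \<in> mform (\<lambda>i. 0)"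
  by (auto simp: mform_def polyfun.const)

lemma mform_zero: "(\<lambda>z. 0) \<in> mform d"
  by (auto simp: mform_def polyfun.const)

lemma mform_coord:
  "(\<lambda>z::'c::field^'b::finite^'a::finite. z $ i $ a) \<in> mform (\<lambda>j. if j = i then 1 else 0)"
proof -
  have "(\<Prod>j\<in>UNIV. c j ^ (if j = i then 1 else 0)) = (\<Prod>j\<in>UNIV. if j = i then c j else 1)" for c :: "'a \<Rightarrow> 'c"
    by (intro prod.cong) auto
  then show ?thesis
    by (auto simp: mform_def polyfun.coord)
qed

lemma mform_sum:
  assumes "finite A" "\<And>x. x \<in> A \<Longrightarrow> f x \<in> mform d" shows "(\<lambda>z. \<Sum>x\<in>A. f x z) \<in> mform d"
  using assms by (induction A) (auto intro: mform_add mform_zero)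

lemma mform_compose:
  fixes F :: "'k::field^'n::finite^'m::finite \<Rightarrow> 'k^'a::finite^'b::finite"
  assumes F: "\<And>j b. (\<lambda>w. F w $ j $ b) \<in> mform (d j)" and g: "g \<in> mform e"
  shows "(\<lambda>w. g (F w)) \<in> mform (\<lambda>i. \<Sum>j\<in>UNIV. d j i * e j)"
proof -
  have "g (F (\<chi> i. c i *s (z $ i))) = (\<Prod>i\<in>UNIV. c i ^ (\<Sum>j\<in>UNIV. d j i * e j)) * g (F z)" for c z
  proof -
    have "F (\<chi> i. c i *s (z $ i)) = (\<chi> j. (\<Prod>i\<in>UNIV. c i ^ d j i) *s (F z $ j))"
      using mform_scale[OF F] by (simp add: vec_eq_iff)
    then have "g (F (\<chi> i. c i *s (z $ i))) = (\<Prod>j\<in>UNIV. (\<Prod>i\<in>UNIV. c i ^ d j i) ^ e j) * g (F z)"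
      by (simp add: mform_scale[OF g])
    also have "(\<Prod>j\<in>UNIV. (\<Prod>i\<in>UNIV. c i ^ d j i) ^ e j) = (\<Prod>j\<in>UNIV. \<Prod>i\<in>UNIV. c i ^ (d j i * e j))"
      by (simp add: prod_power_distrib power_mult)
    also have "\<dots> = (\<Prod>i\<in>UNIV. \<Prod>j\<in>UNIV. c i ^ (d j i * e j))"
      by (rule prod.swap)
    also have "\<dots> = (\<Prod>i\<in>UNIV. c i ^ (\<Sum>j\<in>UNIV. d j i * e j))"
      by (simp add: power_sum)
    finally show ?thesis .
  qed
  then show ?thesis
    using polyfun_compose[OF mform_polyfun[OF g] mform_polyfun[OF F]] by (simp add: mform_def)
qed

text \<open>
  On the projective line a form has a single degree, so homogeneity is tested with one scalar.
\<close>

lemma mform_P1: "f \<in> mform (\<lambda>_::1. n) \<longleftrightarrow> f \<in> polyfun \<and> (\<forall>c z. f (\<chi> i. c *s (z $ i)) = c ^ n * f z)"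
proof -
  have "(\<chi> i. (c i::'a) *s (z $ i)) = (\<chi> i. c 1 *s (z $ i))" for c and z :: "'a^'b^1"
    by (simp add: vec_eq_iff)
  then show ?thesis
    by (auto simp: mform_def UNIV_1) metis
qed

lemma proj_eq_refl [simp]: "proj_eq x x"
  unfolding proj_eq_def by (intro exI[of _ 1]) simp

lemma proj_eq_sym: "proj_eq x y \<Longrightarrow> proj_eq y x"
  unfolding proj_eq_def
proof safe
  fix c assume "c \<noteq> (0::'a)"
  then show "\<exists>ca. ca \<noteq> 0 \<and> y = ca *s (c *s y)" by (intro exI[of _ "1/c"]) simp
qed

lemma proj_eq_trans: "proj_eq x y \<Longrightarrow> proj_eq y z \<Longrightarrow> proj_eq x z"
  unfolding proj_eq_def by (metis mult_eq_0_iff vector_smult_assoc)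

lemma proj_eq_nonzero: "proj_eq x y \<Longrightarrow> x \<noteq> 0 \<longleftrightarrow> y \<noteq> 0"
  unfolding proj_eq_def by auto

lemma mproj_eq_refl [simp]: "mproj_eq z z" by (simp add: mproj_eq_def)
lemma mproj_eq_sym: "mproj_eq z w \<Longrightarrow> mproj_eq w z" by (simp add: mproj_eq_def proj_eq_sym)
lemma mproj_eq_trans: "mproj_eq z w \<Longrightarrow> mproj_eq w v \<Longrightarrow> mproj_eq z v"
  unfolding mproj_eq_def using proj_eq_trans by blast
lemma mproj_eq_mproj: "mproj_eq z w \<Longrightarrow> z \<in> mproj \<longleftrightarrow> w \<in> mproj"
  unfolding mproj_eq_def mproj_def using proj_eq_nonzero by auto

lemma proj_eq_iff_minors:
  fixes x y :: "'k::field^'n::finite"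
  assumes "x \<noteq> 0" "y \<noteq> 0"
  shows "proj_eq x y \<longleftrightarrow> (\<forall>a b. x $ a * y $ b = x $ b * y $ a)"
proof
  assume "proj_eq x y" then show "\<forall>a b. x $ a * y $ b = x $ b * y $ a"
    by (auto simp: proj_eq_def)
next
  assume m: "\<forall>a b. x $ a * y $ b = x $ b * y $ a"
  obtain b where b: "y $ b \<noteq> 0" using assms by (auto simp: vec_eq_iff)
  have *: "x = (x $ b / y $ b) *s y"
    using m b by (simp add: vec_eq_iff field_simps)
  then have "x $ b / y $ b \<noteq> 0" using assms(1) by (metis vector_smult_lzero)
  then show "proj_eq x y" using * unfolding proj_eq_def by blast
qed

lemma mform_mproj_eqE:
  assumes "mproj_eq z w"
  obtains c where "\<And>i. c i \<noteq> 0" "z = (\<chi> i. c i *s (w $ i))"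
proof -
  from assms obtain c where "\<forall>i. c i \<noteq> 0 \<and> z $ i = c i *s (w $ i)"
    unfolding mproj_eq_def proj_eq_def by metis
  then show thesis by (intro that[of c]) (auto simp: vec_eq_iff)
qed

lemma mform_zero_iff:
  assumes "f \<in> mform d" "mproj_eq z w" shows "f z = 0 \<longleftrightarrow> f w = 0"
proof -
  obtain c where "\<And>i. c i \<noteq> 0" "z = (\<chi> i. c i *s (w $ i))" using mform_mproj_eqE[OF assms(2)] by blast
  then show ?thesis using mform_scale[OF assms(1), of c w] by auto
qed

lemma forms_respect:
  assumes "\<And>j b. (\<lambda>w. F w $ j $ b) \<in> mform (d j)" "mproj_eq z w"
  shows "mproj_eq (F z) (F w)"
proof -
  obtain c where c: "\<And>i. c i \<noteq> 0" "z = (\<chi> i. c i *s (w $ i))" using mform_mproj_eqE[OF assms(2)] by blast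
  have "F z $ j = (\<Prod>i\<in>UNIV. c i ^ d j i) *s F w $ j" for j
    using mform_scale[OF assms(1), of c w j] by (simp add: vec_eq_iff c(2))
  moreover have "(\<Prod>i\<in>UNIV. c i ^ d j i) \<noteq> 0" for j using c(1) by simp
  ultimately show ?thesis unfolding mproj_eq_def proj_eq_def by blast
qed

lemma regular_map_respects:
  assumes r: "regular_map A B f" and "z \<in> A" "w \<in> A" "mproj_eq z w"
  shows "mproj_eq (f z) (f w)"
proof -
  obtain F where F: "\<forall>j. \<exists>d. \<forall>b. (\<lambda>w. F w $ j $ b) \<in> mform d" "F z \<in> mproj"
    "\<forall>w\<in>A. F w \<in> mproj \<longrightarrow> mproj_eq (f w) (F w)"
    using r assms(2) unfolding regular_map_def by blast
  obtain d where d: "\<And>j b. (\<lambda>w. F w $ j $ b) \<in> mform (d j)" using F(1) by metis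
  have e: "mproj_eq (F z) (F w)" by (rule forms_respect[OF d assms(4)])
  then have "F w \<in> mproj" using F(2) mproj_eq_mproj by blast
  then show ?thesis using F e assms by (meson mproj_eq_sym mproj_eq_trans)
qed

section \<open>Brackets on the projective line\<close>

definition scal :: "'k::field \<Rightarrow> 'k^'n^'m \<Rightarrow> 'k^'n^'m" where
  "scal c s = (\<chi> i. c *s (s $ i))"

lemma scal_nth [simp]: "scal c s $ i $ a = c * s $ i $ a" by (simp add: scal_def)

lemma P1_eqI: "s $ 1 $ 1 = t $ 1 $ 1 \<Longrightarrow> s $ 1 $ 2 = t $ 1 $ 2 \<Longrightarrow> s = (t :: 'a^2^1)"
  by (simp add: vec_eq_iff forall_2)

lemma P1_iff: "s \<in> P1 \<longleftrightarrow> s $ 1 $ 1 \<noteq> 0 \<or> s $ 1 $ 2 \<noteq> 0"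
  by (simp add: mproj_def vec_eq_iff forall_2)

lemma bracket_scal [simp]: "bracket (scal c s) t = c * bracket s t" "bracket s (scal c t) = c * bracket s t"
  by (simp_all add: bracket_def algebra_simps)

lemma bracket_add: "bracket (s + s') t = bracket s t + bracket s' t" "bracket s (t + t') = bracket s t + bracket s t'"
  by (simp_all add: bracket_def algebra_simps)

lemma bracket_self [simp]: "bracket s s = 0" by (simp add: bracket_def)

lemma bracket_swap: "bracket s t = - bracket t s" by (simp add: bracket_def)

lemma plucker: "bracket a b * bracket c d - bracket a c * bracket b d + bracket a d * bracket b c = 0"
  by (simp add: bracket_def algebra_simps)

lemma P1_decompose: "scal (bracket u v) w = scal (bracket w v) u + scal (bracket u w) v"
  by (intro P1_eqI) (simp_all add: bracket_def algebra_simps)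

lemma bracket_nonzero_exists:
  assumes "s \<in> P1" shows "\<exists>t. bracket s t \<noteq> 0"
proof -
  have "bracket s (\<chi> i. vector [0,1]) = s $ 1 $ 1" "bracket s (\<chi> i. vector [1,0]) = - (s $ 1 $ 2)"
    by (simp_all add: bracket_def)
  then show ?thesis using assms unfolding P1_iff by (metis neg_equal_0_iff_equal)
qed

lemma bracket_nonzero_P1: "bracket s t \<noteq> 0 \<Longrightarrow> s \<in> P1" "bracket s t \<noteq> 0 \<Longrightarrow> t \<in> P1"
  by (auto simp: P1_iff bracket_def)

lemma P1_eq_iff_bracket:
  assumes "s \<in> P1" "t \<in> P1" shows "mproj_eq s t \<longleftrightarrow> bracket s t = 0"
proof -
  have "s $ 1 \<noteq> 0" "t $ 1 \<noteq> 0" using assms by (auto simp: mproj_def)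
  then have "proj_eq (s $ 1) (t $ 1) \<longleftrightarrow> bracket s t = 0"
    by (subst proj_eq_iff_minors) (auto simp: forall_2 bracket_def algebra_simps)
  then show ?thesis by (simp add: mproj_eq_def)
qed

lemma P1_eq_scal: "mproj_eq s t \<longleftrightarrow> (\<exists>c. c \<noteq> 0 \<and> s = scal c t)" for s t :: "'k::field^2^1"
  by (simp add: mproj_eq_def proj_eq_def scal_def vec_eq_iff)

lemma polyfun_bracket:
  assumes "\<And>b. (\<lambda>w. F w $ 1 $ b) \<in> polyfun" "\<And>b. (\<lambda>w. G w $ 1 $ b) \<in> polyfun"
  shows "(\<lambda>w. bracket (F w) (G w)) \<in> polyfun"
  unfolding bracket_def by (intro polyfun_intros assms)

section \<open>Automorphisms of the projective line\<close>

text \<open>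
  Bezout: by division with remainder, a nonzero element \<open>g\<close> of least degree in the ideal of \<open>a\<close> and \<open>b\<close>
  divides both.
\<close>

lemma poly_bezout:
  fixes a b :: "'k::field poly"
  assumes "a \<noteq> 0"
  obtains g a' b' x y where "a = g * a'" "b = g * b'" "x * a' + y * b' = 1"
proof -
  define I where "I = {x * a + y * b | x y. True} - {0}"
  have "a = 1 * a + 0 * b" by simp
  then have "a \<in> I" unfolding I_def using assms by blast
  then obtain g where g: "g \<in> I" "\<And>h. h \<in> I \<Longrightarrow> degree g \<le> degree h"
    using ex_has_least_nat[of "\<lambda>h. h \<in> I" a degree] by blast
  from g(1) obtain x y where xy: "g = x * a + y * b" "g \<noteq> 0" by (auto simp: I_def)
  have dvd: "g dvd u * a + v * b" for u v
  proof (rule ccontr)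
    assume n: "\<not> g dvd u * a + v * b"
    let ?r = "(u * a + v * b) mod g"
    let ?q = "(u * a + v * b) div g"
    have "?r = u * a + v * b - ?q * g" by (simp add: minus_div_mult_eq_mod)
    also have "\<dots> = u * a + v * b - ?q * (x * a + y * b)" by (simp only: xy(1)[symmetric])
    also have "\<dots> = (u - ?q * x) * a + (v - ?q * y) * b"
      by (simp add: ring_distribs mult.assoc)
    finally have "?r = (u - ?q * x) * a + (v - ?q * y) * b" .
    moreover have "?r \<noteq> 0" using n by (simp add: dvd_eq_mod_eq_0)
    ultimately have "?r \<in> I" unfolding I_def by blast
    then have "degree g \<le> degree ?r" by (rule g(2))
    moreover have "degree ?r < degree g" using degree_mod_less[OF xy(2), of "u * a + v * b"] \<open>?r \<noteq> 0\<close> by auto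
    ultimately show False by simp
  qed
  obtain a' where a': "a = g * a'" using dvd[of 1 0] by (auto elim: dvdE)
  obtain b' where b': "b = g * b'" using dvd[of 0 1] by (auto elim: dvdE)
  have "g * (x * a' + y * b') = g * 1" using xy(1) a' b' by (simp add: algebra_simps)
  then have "x * a' + y * b' = 1" using xy(2) by (metis mult_left_cancel)
  then show thesis using a' b' that by blast
qed

lemma degree_le_1E:
  fixes p :: "'k::comm_ring_1 poly"
  assumes "degree p \<le> 1"
  obtains a b where "p = [:a, b:]"
proof -
  have "p = [:coeff p 0, coeff p 1:]"
    using assms by (intro poly_eqI) (auto simp: coeff_pCons coeff_eq_0 split: nat.splits)
  then show thesis by (rule that)
qed

lemma bezout_dvd_power:
  fixes a b :: "'k::field poly"
  assumes "x * a + y * b = 1" "a dvd b ^ m * c" shows "a dvd c"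
  using assms(2)
proof (induction m)
  case (Suc m)
  have "b ^ m * c = (x * a + y * b) * (b ^ m * c)"
    by (simp add: assms(1))
  also have "\<dots> = x * a * (b ^ m * c) + y * (b ^ Suc m * c)"
    by (simp add: algebra_simps)
  finally have e: "b ^ m * c = x * a * (b ^ m * c) + y * (b ^ Suc m * c)" .
  have "a dvd x * a * (b ^ m * c) + y * (b ^ Suc m * c)"
    using dvd_mult[OF Suc.prems, of y] by (intro dvd_add) simp_all
  then have "a dvd b ^ m * c" using e by simp
  then show ?case using Suc.IH by blast
qed simp

text \<open>
  A pair of forms \<open>H\<close> on the line with a left inverse \<open>K\<close> agrees with a linear map \<open>M\<close>, by the
  argument of the rational root theorem. In coordinates with respect to two points \<open>u\<close> and \<open>v\<close>, write
  \<open>H = g (a' u + b' v)\<close> along an affine line of parameters \<open>w\<close>, with \<open>a'\<close> and \<open>b'\<close> coprime polynomials.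
  Then \<open>w\<close> is proportional to \<open>K (a' u + b' v)\<close>, which is congruent to \<open>b' ^ m K v\<close> modulo \<open>a'\<close>; so \<open>a'\<close>
  divides the linear polynomial \<open>[w, K v]\<close>, and in the same way \<open>b'\<close> divides \<open>[w, K u]\<close>. Choosing \<open>u\<close>
  and \<open>v\<close> with \<open>K u\<close> and \<open>K v\<close> nonzero makes both linear polynomials nonzero, hence \<open>a'\<close> and \<open>b'\<close>
  have degree at most one.
\<close>

lemma moebius_of_inverse_forms:
  fixes H K :: "'k::field_char_0^2^1 \<Rightarrow> 'k^2^1"
  assumes H: "\<And>b. (\<lambda>w. H w $ 1 $ b) \<in> mform d"
    and K: "\<And>b. (\<lambda>w. K w $ 1 $ b) \<in> mform e"
    and inv: "\<And>w. bracket w (K (H w)) = 0"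
    and z: "z \<in> P1" "H z \<in> P1" "K (H z) \<in> P1"
  obtains M \<delta> where "\<delta> \<noteq> 0" "\<And>x y. bracket (M x) (M y) = \<delta> * bracket x y"
    "\<And>b. (\<lambda>w. M w $ 1 $ b) \<in> polyfun" "\<And>w. bracket (H w) (M w) = 0"
proof -
  define u where "u = H z"
  obtain \<beta> where \<beta>: "K u $ 1 $ \<beta> \<noteq> 0"
    using z(3) unfolding u_def P1_iff by metis
  obtain v0 where v0: "bracket u v0 \<noteq> 0"
    using bracket_nonzero_exists z(2) unfolding u_def by blast
  have pbu: "(\<lambda>w. bracket u w) \<in> polyfun" by (intro polyfun_bracket polyfun_intros)
  obtain v where v: "bracket u v \<noteq> 0" "K v $ 1 $ \<beta> \<noteq> 0"
    using polyfun_no_zero_divisors[OF mform_polyfun[OF K[of \<beta>]] pbu _ v0] \<beta> by metis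
  obtain w1 where w1: "bracket z w1 \<noteq> 0" using bracket_nonzero_exists z(1) by blast
  \<comment> \<open>The affine line of parameters \<open>z + t w1\<close>, with \<open>t\<close> the variable of the polynomials.\<close>
  define W where "W = (\<lambda>(i::1) a. [:z $ 1 $ a, w1 $ 1 $ a:])"
  have W: "(\<chi> i a. poly (W i a) t) = z + scal t w1" for t
    by (intro P1_eqI) (simp_all add: W_def)
  have "\<exists>h. \<forall>t. poly h t = H (z + scal t w1) $ 1 $ b" for b
  proof -
    obtain F where "\<forall>X t. poly (F X) t = H (\<chi> i a. poly (X i a) t) $ 1 $ b"
      using polyfun_subst[OF mform_polyfun[OF H[of b]]] by auto
    then have "\<forall>t. poly (F W) t = H (z + scal t w1) $ 1 $ b" by (simp add: W)
    then show ?thesis by blast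
  qed
  then have "\<forall>b. \<exists>h. \<forall>t. poly h t = H (z + scal t w1) $ 1 $ b" by blast
  from choice[OF this] obtain h where h: "\<And>b t. poly (h b) t = H (z + scal t w1) $ 1 $ b" by auto
  define a where "a = smult (1 / bracket u v) (h 1 * [:v $ 1 $ 2:] - h 2 * [:v $ 1 $ 1:])"
  define b where "b = smult (1 / bracket u v) (h 2 * [:u $ 1 $ 1:] - h 1 * [:u $ 1 $ 2:])"
  have a: "poly a t = bracket (H (z + scal t w1)) v / bracket u v" for t
    by (simp add: a_def h bracket_def)
  have b: "poly b t = bracket u (H (z + scal t w1)) / bracket u v" for t
    by (simp add: b_def h bracket_def mult.commute)
  have Hab: "H (z + scal t w1) = scal (poly a t) u + scal (poly b t) v" for t
  proof -
    have "scal (bracket u v) (H (z + scal t w1)) =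
        scal (bracket u v) (scal (poly a t) u + scal (poly b t) v)"
      using v(1) unfolding a b P1_decompose[of u v "H (z + scal t w1)"]
      by (intro P1_eqI) (simp_all add: field_simps)
    then have "bracket u v * H (z + scal t w1) $ 1 $ c = bracket u v * (scal (poly a t) u + scal (poly b t) v) $ 1 $ c" for c
      by (metis scal_nth)
    then show ?thesis using v(1) by (intro P1_eqI) auto
  qed
  have z0: "z + scal 0 w1 = z" by (intro P1_eqI) auto
  have a0: "poly a 0 = 1" using v(1) unfolding a z0 u_def by simp
  have b0: "poly b 0 = 0" unfolding b z0 u_def by simp
  have "a \<noteq> 0" using a0 by auto
  then obtain g a' b' x y where g: "a = g * a'" "b = g * b'" "x * a' + y * b' = 1"
    by (rule poly_bezout)
  have g0: "poly g 0 \<noteq> 0" using a0 g(1) by auto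
  then have "g \<noteq> 0" by auto
  define m where "m = e 1"
  have Km: "K (scal c s) $ 1 $ \<gamma> = c ^ m * K s $ 1 $ \<gamma>" for c s \<gamma>
    using mform_scale[OF K, of "\<lambda>_. c" s \<gamma>] by (simp add: scal_def m_def UNIV_1)
  have "\<forall>b. \<exists>F :: (1 \<Rightarrow> 2 \<Rightarrow> 'k poly) \<Rightarrow> 'k poly.
    (\<forall>X t. poly (F X) t = K (\<chi> i a. poly (X i a) t) $ 1 $ b) \<and>
    (\<forall>X Y c. c dvd F (\<lambda>i a. X i a + c * Y i a) - F X)"
    using polyfun_subst[OF mform_polyfun[OF K]] by blast
  from choice[OF this] obtain F :: "2 \<Rightarrow> (1 \<Rightarrow> 2 \<Rightarrow> 'k poly) \<Rightarrow> 'k poly" where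
    F: "\<And>b X t. poly (F b X) t = K (\<chi> i a. poly (X i a) t) $ 1 $ b"
    "\<And>b X Y c. c dvd F b (\<lambda>i a. X i a + c * Y i a) - F b X" by blast
  define lin where "lin = (\<lambda>f::2 \<Rightarrow> 'k poly. W 1 1 * f 2 - W 1 2 * f 1)"
  have linb: "poly (lin f) t = bracket (z + scal t w1) (\<chi> i b. poly (f b) t)" for f t
    by (simp add: lin_def bracket_def W_def algebra_simps)
  define con where "con = (\<lambda>(s::'k^2^1) (c::'k poly) (i::1) \<gamma>. c * [:s $ 1 $ \<gamma>:])"
  have Fcon: "F \<gamma> (con s c) = c ^ m * [:K s $ 1 $ \<gamma>:]" for \<gamma> s c
  proof -
    have "poly (F \<gamma> (con s c)) t = poly (c ^ m * [:K s $ 1 $ \<gamma>:]) t" for t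
    proof -
      have "(\<chi> i a. poly (con s c i a) t) = scal (poly c t) s"
        by (intro P1_eqI) (simp_all add: con_def)
      then show ?thesis by (simp add: F(1) Km)
    qed
    then show ?thesis using poly_eq_poly_eq_iff by blast
  qed
  define comb where "comb = (\<lambda>(i::1) \<gamma>. a' * [:u $ 1 $ \<gamma>:] + b' * [:v $ 1 $ \<gamma>:])"
  have comb: "(\<chi> i \<gamma>. poly (comb i \<gamma>) t) = scal (poly a' t) u + scal (poly b' t) v" for t
    by (intro P1_eqI) (simp_all add: comb_def)
  have "lin (\<lambda>\<gamma>. F \<gamma> comb) = 0"
  proof -
    have "poly (g ^ m * lin (\<lambda>\<gamma>. F \<gamma> comb)) t = 0" for t
    proof -
      have "H (z + scal t w1) = scal (poly g t) (\<chi> i \<gamma>. poly (comb i \<gamma>) t)"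
        unfolding Hab comb g by (intro P1_eqI) (simp_all add: algebra_simps)
      then have "K (H (z + scal t w1)) = scal (poly g t ^ m) (\<chi> i \<gamma>. poly (F \<gamma> comb) t)"
        by (intro P1_eqI) (simp_all add: Km F)
      then show ?thesis using inv[of "z + scal t w1"] by (simp add: linb)
    qed
    then have "g ^ m * lin (\<lambda>\<gamma>. F \<gamma> comb) = 0" using poly_all_0_iff_0 by blast
    then show ?thesis using \<open>g \<noteq> 0\<close> by simp
  qed note lin0 = this
  have lin_dvd: "c dvd lin f - lin f'" if "\<And>\<gamma>. c dvd f \<gamma> - f' \<gamma>" for c f f'
  proof -
    have "lin f - lin f' = W 1 1 * (f 2 - f' 2) - W 1 2 * (f 1 - f' 1)"
      by (simp add: lin_def algebra_simps)
    then show ?thesis using that by simp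
  qed
  have lin_mult: "lin (\<lambda>\<gamma>. c * f \<gamma>) = c * lin f" for c f
    by (simp add: lin_def algebra_simps)
  define lc where "lc = (\<lambda>s. lin (\<lambda>\<gamma>. [:K s $ 1 $ \<gamma>:]))"
  have lc_deg: "degree (lc s) \<le> 1" for s
    unfolding lc_def lin_def W_def by (intro degree_diff_le) (auto simp: degree_pCons_eq_if)
  have lc_nz: "lc s \<noteq> 0" if "K s $ 1 $ \<beta> \<noteq> 0" for s
  proof
    assume "lc s = 0"
    then have "bracket (z + scal t w1) (K s) = 0" for t
      using linb[of "\<lambda>\<gamma>. [:K s $ 1 $ \<gamma>:]" t] by (simp add: lc_def bracket_def)
    from this[of 0] this[of 1] have "bracket z (K s) = 0" "bracket w1 (K s) = 0"
      by (auto simp: bracket_add)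
    then have "scal (bracket z w1) (K s) = 0"
      unfolding P1_decompose[of z w1 "K s"]
      by (intro P1_eqI) (simp_all add: bracket_swap[of "K s" w1])
    then have "bracket z w1 * K s $ 1 $ \<beta> = 0" by (metis scal_nth zero_index)
    then show False using w1 that by simp
  qed
  have "a' dvd b' ^ m * lc v"
  proof -
    have e: "comb = (\<lambda>i \<gamma>. con v b' i \<gamma> + a' * con u 1 i \<gamma>)"
      by (simp add: comb_def con_def fun_eq_iff)
    have "a' dvd F \<gamma> comb - F \<gamma> (con v b')" for \<gamma>
      unfolding e by (rule F(2)[where X = "con v b'" and Y = "con u 1"])
    then have "a' dvd lin (\<lambda>\<gamma>. F \<gamma> comb) - lin (\<lambda>\<gamma>. F \<gamma> (con v b'))" by (rule lin_dvd)
    then show ?thesis unfolding lin0 Fcon lin_mult lc_def by simp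
  qed
  then have "a' dvd lc v" using bezout_dvd_power[OF g(3)] by blast
  then have a'deg: "degree a' \<le> 1"
    using dvd_imp_degree_le[OF _ lc_nz[OF v(2)]] lc_deg[of v] by (meson order_trans)
  have b'lc: "b' dvd a' ^ m * lc u"
  proof -
    have e: "comb = (\<lambda>i \<gamma>. con u a' i \<gamma> + b' * con v 1 i \<gamma>)"
      by (simp add: comb_def con_def fun_eq_iff)
    have "b' dvd F \<gamma> comb - F \<gamma> (con u a')" for \<gamma>
      unfolding e by (rule F(2)[where X = "con u a'" and Y = "con v 1"])
    then have "b' dvd lin (\<lambda>\<gamma>. F \<gamma> comb) - lin (\<lambda>\<gamma>. F \<gamma> (con u a'))" by (rule lin_dvd)
    then show ?thesis unfolding lin0 Fcon lin_mult lc_def by simp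
  qed
  have g3: "y * b' + x * a' = 1" using g(3) by (simp add: add.commute)
  have "b' dvd lc u" using bezout_dvd_power[OF g3 b'lc] .
  then have b'deg: "degree b' \<le> 1"
    using dvd_imp_degree_le[OF _ lc_nz[OF \<beta>]] lc_deg[of u] by (meson order_trans)
  have "a' \<noteq> 0" using \<open>a \<noteq> 0\<close> g(1) by auto
  then have "b' \<noteq> 0" using b'lc lc_nz[OF \<beta>] by auto
  obtain a0 a1 where a': "a' = [:a0, a1:]" using degree_le_1E[OF a'deg] .
  obtain b0' b1 where "b' = [:b0', b1:]" using degree_le_1E[OF b'deg] .
  moreover have "poly b' 0 = 0" using b0 g(2) g0 by auto
  ultimately have b': "b' = [:0, b1:]" by auto
  have nz: "a0 \<noteq> 0" "b1 \<noteq> 0" using a0 g(1) \<open>b' \<noteq> 0\<close> unfolding a' b' by auto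
  \<comment> \<open>The linear map sends \<open>z\<close> to \<open>V0\<close> and \<open>w1\<close> to \<open>V1\<close>, up to the factor \<open>[z, w1]\<close>.\<close>
  define V0 V1 where "V0 = scal a0 u" and "V1 = scal a1 u + scal b1 v"
  have V: "bracket V0 V1 = a0 * b1 * bracket u v"
    by (simp add: V0_def V1_def bracket_add)
  define M where "M = (\<lambda>w. scal (bracket w w1) V0 + scal (bracket z w) V1)"
  have "bracket (M s) (M t) = (bracket z w1 * bracket V0 V1) * bracket s t" for s t
  proof -
    have "bracket (M s) (M t) = (bracket s w1 * bracket z t - bracket z s * bracket t w1) * bracket V0 V1"
      by (simp add: M_def bracket_add bracket_swap[of V1 V0] algebra_simps)
    also have "bracket s w1 * bracket z t - bracket z s * bracket t w1 = bracket z w1 * bracket s t"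
      by (simp add: bracket_def algebra_simps)
    finally show ?thesis by simp
  qed
  moreover have Mp: "(\<lambda>w. M w $ 1 $ c) \<in> polyfun" for c
    unfolding M_def by (auto intro!: polyfun_intros polyfun_bracket)
  moreover have "bracket (H w) (M w) = 0" for w
  proof (rule polyfun_no_zero_divisors[where f = "\<lambda>w. bracket (H w) (M w)" and b = "\<lambda>w. bracket w w1" and ?w0.0 = z])
    show "(\<lambda>w. bracket (H w) (M w)) \<in> polyfun"
      by (intro polyfun_bracket mform_polyfun[OF H] Mp)
    show "(\<lambda>w. bracket w w1) \<in> polyfun" by (intro polyfun_bracket polyfun_intros)
    show "bracket z w1 \<noteq> 0" by fact
    fix w assume n: "bracket w w1 \<noteq> 0"
    define \<tau> where "\<tau> = bracket z w / bracket w w1"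
    define \<sigma> where "\<sigma> = bracket w w1 / bracket z w1"
    have "bracket z w1 * w $ 1 $ c = bracket z w1 * scal \<sigma> (z + scal \<tau> w1) $ 1 $ c" for c
      using P1_decompose[of z w1 w, THEN arg_cong[where f = "\<lambda>s. s $ 1 $ c"]] n w1
      by (simp add: \<sigma>_def \<tau>_def field_simps)
    then have w: "w = scal \<sigma> (z + scal \<tau> w1)" using w1 by (intro P1_eqI) auto
    have "H w = scal (\<sigma> ^ d 1) (H (z + scal \<tau> w1))"
      unfolding w using mform_scale[OF H, of "\<lambda>_. \<sigma>" "z + scal \<tau> w1"]
      by (intro P1_eqI) (simp_all add: scal_def UNIV_1)
    moreover have "H (z + scal \<tau> w1) = scal (poly g \<tau>) (V0 + scal \<tau> V1)"
      unfolding Hab g a' b' V0_def V1_def by (intro P1_eqI) (simp_all add: algebra_simps)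
    moreover have "M w = scal (bracket w w1) (V0 + scal \<tau> V1)"
      using n unfolding M_def by (intro P1_eqI) (simp_all add: \<tau>_def field_simps)
    ultimately show "bracket (H w) (M w) = 0" by simp
  qed
  moreover have "bracket z w1 * bracket V0 V1 \<noteq> 0" using V nz v(1) w1 by simp
  ultimately show thesis using that by blast
qed

section \<open>Parametrized rational curves\<close>

text \<open>
  A parametrization \<open>\<psi>\<close> and its inverse \<open>g\<close>, both given globally by forms. Unlike an arbitrary
  isomorphism, such a pair can be composed and evaluated without choosing local representatives.
\<close>

definition curve_param ::
  "('k::field^'n^'m) set \<Rightarrow> ('k^2^1 \<Rightarrow> 'k^'n^'m) \<Rightarrow> ('k^'n^'m \<Rightarrow> 'k^2^1) \<Rightarrow> bool" where
  "curve_param C \<psi> g \<longleftrightarrow>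
     C = {z. \<exists>s\<in>P1. mproj_eq z (\<psi> s)} \<and>
     (\<forall>s\<in>P1. \<psi> s \<in> mproj \<and> mproj_eq (g (\<psi> s)) s) \<and>
     (\<forall>j. \<exists>d. \<forall>b. (\<lambda>s. \<psi> s $ j $ b) \<in> mform d) \<and>
     (\<forall>j. \<exists>d. \<forall>b. (\<lambda>z. g z $ j $ b) \<in> mform d)"

lemma curve_paramD:
  assumes "curve_param C \<psi> g"
  shows "z \<in> C \<longleftrightarrow> (\<exists>s\<in>P1. mproj_eq z (\<psi> s))"
    and "s \<in> P1 \<Longrightarrow> \<psi> s \<in> mproj" "s \<in> P1 \<Longrightarrow> mproj_eq (g (\<psi> s)) s"
    and "\<exists>d. \<forall>j b. (\<lambda>s. \<psi> s $ j $ b) \<in> mform (d j)"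
    and "\<exists>d. \<forall>j b. (\<lambda>z. g z $ j $ b) \<in> mform (d j)"
    and "z \<in> C \<Longrightarrow> mproj_eq z' z \<Longrightarrow> z' \<in> C"
    and "s \<in> P1 \<Longrightarrow> \<psi> s \<in> C"
    and "z \<in> C \<Longrightarrow> z \<in> mproj"
proof -
  have C: "C = {z. \<exists>s\<in>P1. mproj_eq z (\<psi> s)}" using assms by (simp add: curve_param_def)
  show mem: "z \<in> C \<longleftrightarrow> (\<exists>s\<in>P1. mproj_eq z (\<psi> s))" for z using C by simp
  show P: "s \<in> P1 \<Longrightarrow> \<psi> s \<in> mproj" "s \<in> P1 \<Longrightarrow> mproj_eq (g (\<psi> s)) s" for s
    using assms by (simp_all add: curve_param_def)
  have "\<forall>j. \<exists>d. \<forall>b. (\<lambda>s. \<psi> s $ j $ b) \<in> mform d" "\<forall>j. \<exists>d. \<forall>b. (\<lambda>z. g z $ j $ b) \<in> mform d"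
    using assms unfolding curve_param_def by blast+
  from this[THEN choice]
  show "\<exists>d. \<forall>j b. (\<lambda>s. \<psi> s $ j $ b) \<in> mform (d j)" "\<exists>d. \<forall>j b. (\<lambda>z. g z $ j $ b) \<in> mform (d j)"
    by blast+
  show "z \<in> C \<Longrightarrow> mproj_eq z' z \<Longrightarrow> z' \<in> C" using mem mproj_eq_trans by blast
  show "s \<in> P1 \<Longrightarrow> \<psi> s \<in> C" using mem mproj_eq_refl by blast
  show "z \<in> C \<Longrightarrow> z \<in> mproj" using mem P(1) mproj_eq_mproj by blast
qed

lemma curve_param_respects:
  assumes "curve_param C \<psi> g"
  shows "mproj_eq s t \<Longrightarrow> mproj_eq (\<psi> s) (\<psi> t)" "mproj_eq z w \<Longrightarrow> mproj_eq (g z) (g w)"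
  using curve_paramD(4,5)[OF assms] forms_respect by metis+

lemma curve_param_inverse:
  assumes c: "curve_param C \<psi> g" and z: "z \<in> C"
  shows "g z \<in> P1" "mproj_eq (\<psi> (g z)) z"
proof -
  obtain s where s: "s \<in> P1" "mproj_eq z (\<psi> s)" using curve_paramD(1)[OF c] z by blast
  have gs: "mproj_eq (g z) s"
    using curve_param_respects(2)[OF c s(2)] curve_paramD(3)[OF c s(1)] mproj_eq_trans by blast
  then show "g z \<in> P1" using s(1) mproj_eq_mproj by blast
  show "mproj_eq (\<psi> (g z)) z"
    using curve_param_respects(1)[OF c gs] s(2) mproj_eq_sym mproj_eq_trans by blast
qed

lemma curve_param_isomorphism:
  assumes c: "curve_param C \<psi> g" shows "isomorphism P1 C \<psi>"
proof -
  have "regular_map P1 C \<psi>"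
    using curve_paramD[OF c] c unfolding regular_map_def curve_param_def
    by (auto intro!: exI[of _ \<psi>])
  moreover have "regular_map C P1 g"
    using curve_param_inverse[OF c] c unfolding regular_map_def curve_param_def
    by (auto intro!: exI[of _ g])
  ultimately show ?thesis
    using curve_param_inverse(2)[OF c] curve_paramD(3)[OF c] unfolding isomorphism_def by blast
qed

text \<open>
  A point \<open>z\<close> of the curve satisfies the
  multihomogeneous equations saying that each block of \<open>z\<close> is proportional to that of \<open>\<psi> (g z)\<close>, and
  these equations define the curve wherever \<open>g z\<close> is a point of the line, which the additional
  form \<open>h\<close> ensures. Conversely, a form vanishing at \<open>\<psi> s\<close> for generic \<open>s\<close> vanishes for all \<open>s\<close>.
\<close>

lemma zariski_closure_param:
  fixes \<psi> :: "'k::field_char_0^2^1 \<Rightarrow> 'k^'n::finite^'m::finite"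
  assumes c: "curve_param C \<psi> g"
    and b: "b \<in> polyfun" "b w0 \<noteq> 0"
    and S: "S \<subseteq> C" "\<And>s. s \<in> P1 \<Longrightarrow> b s \<noteq> 0 \<Longrightarrow> \<psi> s \<in> S"
    and h: "h \<in> mform e" "\<And>z. z \<in> C \<Longrightarrow> h z = 0" "\<And>z. z \<in> mproj \<Longrightarrow> h z = 0 \<Longrightarrow> g z \<in> P1"
  shows "zariski_closure S = C"
proof
  obtain d where d: "\<And>j b. (\<lambda>s. \<psi> s $ j $ b) \<in> mform (d j)" using curve_paramD(4)[OF c] by blast
  obtain d' where d': "\<And>j b. (\<lambda>s. g s $ j $ b) \<in> mform (d' j)" using curve_paramD(5)[OF c] by blast
  show "zariski_closure S \<subseteq> C"
  proof
    fix z assume z: "z \<in> zariski_closure S"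
    then have zm: "z \<in> mproj" by (simp add: zariski_closure_def)
    have van: "f z = 0" if "f \<in> mform d" "\<And>w. w \<in> C \<Longrightarrow> f w = 0" for f d
      using z that S(1) unfolding zariski_closure_def by blast
    have gz: "g z \<in> P1" using van[OF h(1,2)] h(3)[OF zm] by blast
    have "z $ j $ a * \<psi> (g z) $ j $ a' - z $ j $ a' * \<psi> (g z) $ j $ a = 0" for j a a'
    proof (rule van[where f = "\<lambda>z. z $ j $ a * \<psi> (g z) $ j $ a' - z $ j $ a' * \<psi> (g z) $ j $ a"])
      show "(\<lambda>z. z $ j $ a * \<psi> (g z) $ j $ a' - z $ j $ a' * \<psi> (g z) $ j $ a)
          \<in> mform (\<lambda>i. (if i = j then 1 else 0) + (\<Sum>k\<in>UNIV. d' k i * d j k))"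
        by (intro mform_diff mform_mult mform_coord mform_compose[where g = "\<lambda>s. \<psi> s $ j $ b" for b, OF d' d])
      fix w assume "w \<in> C"
      then have "proj_eq (\<psi> (g w) $ j) (w $ j)"
        using curve_param_inverse(2)[OF c] by (simp add: mproj_eq_def)
      then obtain k where "\<psi> (g w) $ j = k *s (w $ j)" by (auto simp: proj_eq_def)
      then show "w $ j $ a * \<psi> (g w) $ j $ a' - w $ j $ a' * \<psi> (g w) $ j $ a = 0" by simp
    qed
    then have "proj_eq (z $ j) (\<psi> (g z) $ j)" for j
      using zm curve_paramD(2)[OF c gz] by (subst proj_eq_iff_minors) (auto simp: mproj_def)
    then show "z \<in> C" using gz curve_paramD(1)[OF c] unfolding mproj_eq_def by blast
  qed
  show "C \<subseteq> zariski_closure S"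
  proof
    fix z assume z: "z \<in> C"
    then obtain s where s: "s \<in> P1" "mproj_eq z (\<psi> s)" using curve_paramD(1)[OF c] by blast
    have "f z = 0" if f: "f \<in> mform d" "\<forall>w\<in>S. f w = 0" for f d
    proof -
      obtain i :: 2 where i: "s $ 1 $ i \<noteq> 0" using s(1) unfolding P1_iff by metis
      have fp: "(\<lambda>s. f (\<psi> s)) \<in> polyfun"
        using polyfun_compose[OF mform_polyfun[OF f(1)]] mform_polyfun[OF d] by blast
      have f0: "f (\<psi> t) * t $ 1 $ i = 0" for t
      proof (rule polyfun_no_zero_divisors[OF _ b(1) _ b(2), where f = "\<lambda>t. f (\<psi> t) * t $ 1 $ i"])
        show "(\<lambda>t. f (\<psi> t) * t $ 1 $ i) \<in> polyfun" by (intro polyfun_intros fp)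
        fix t assume "b t \<noteq> 0"
        then show "f (\<psi> t) * t $ 1 $ i = 0"
          using S(2)[of t] f(2) by (cases "t \<in> P1") (auto simp: mproj_def vec_eq_iff)
      qed
      then have "f (\<psi> s) = 0" using f0[of s] i by simp
      then show ?thesis using mform_zero_iff[OF f(1) s(2)] by simp
    qed
    then show "z \<in> zariski_closure S"
      using curve_paramD(8)[OF c z] by (simp add: zariski_closure_def)
  qed
qed

lemma cross_ratio_moebius:
  assumes "\<delta> \<noteq> 0" "\<And>x y. bracket (M x) (M y) = \<delta> * bracket x y"
    and "\<And>i. i \<in> {x, y, z, w} \<Longrightarrow> mproj_eq (h i) (M i)"
  shows "cross_ratio (h x) (h y) (h z) (h w) = cross_ratio x y z w"
proof -
  obtain c where c: "\<And>i. i \<in> {x, y, z, w} \<Longrightarrow> c i \<noteq> 0 \<and> h i = scal (c i) (M i)"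
    using assms(3) unfolding P1_eq_scal by metis
  then have b: "bracket (h i) (h j) = c i * c j * \<delta> * bracket i j" if "i \<in> {x,y,z,w}" "j \<in> {x,y,z,w}" for i j
    using that by (simp add: assms(2) ac_simps)
  have "cross_ratio (h x) (h y) (h z) (h w) =
    (c x * c y * c z * c w * \<delta> * \<delta> * (bracket x z * bracket y w)) /
    (c x * c y * c z * c w * \<delta> * \<delta> * (bracket x w * bracket y z))"
    unfolding cross_ratio_def by (simp add: b ac_simps)
  also have "\<dots> = cross_ratio x y z w"
    unfolding cross_ratio_def using c assms(1) by (intro mult_divide_mult_cancel_left) auto
  finally show ?thesis .
qed

text \<open>
  Two isomorphisms from the line onto the same curve differ by an automorphism \<open>h\<close> of the line, and
  automorphisms are Moebius transformations. Near one point, \<open>h\<close> is given by forms with a left inverse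
  given by forms, so it is a linear map \<open>M\<close> at generic points; the local forms of \<open>h\<close> at any
  other point agree with \<open>M\<close> generically, hence at that point.
\<close>

lemma isomorphism_cross_ratio:
  fixes \<psi> :: "'k::field_char_0^2^1 \<Rightarrow> 'k^'n::finite^'m::finite"
  assumes c: "curve_param C \<psi> g" and iso: "isomorphism P1 C \<psi>'"
    and P: "x \<in> P1" "y \<in> P1" "z \<in> P1" "w \<in> P1"
  shows "cross_ratio (g (\<psi>' x)) (g (\<psi>' y)) (g (\<psi>' z)) (g (\<psi>' w)) = cross_ratio x y z w"
proof -
  obtain g' where reg: "regular_map P1 C \<psi>'" "regular_map C P1 g'"
    and inv: "\<And>z. z \<in> P1 \<Longrightarrow> mproj_eq (g' (\<psi>' z)) z"
    using iso unfolding isomorphism_def by blast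
  obtain d where d: "\<And>j b. (\<lambda>s. \<psi> s $ j $ b) \<in> mform (d j)" using curve_paramD(4)[OF c] by blast
  obtain d' where d': "\<And>j b. (\<lambda>s. g s $ j $ b) \<in> mform (d' j)" using curve_paramD(5)[OF c] by blast
  define h where "h = (\<lambda>z. g (\<psi>' z))"
  have \<psi>'C: "\<psi>' z \<in> C" if "z \<in> P1" for z using reg(1) that unfolding regular_map_def by blast
  have hP: "h z \<in> P1" if "z \<in> P1" for z
    using curve_param_inverse(1)[OF c \<psi>'C[OF that]] by (simp add: h_def)
  have local: "\<exists>H e b. (\<forall>\<beta>. (\<lambda>w. H w $ 1 $ \<beta>) \<in> mform e) \<and> b \<in> polyfun \<and> b z \<noteq> 0 \<and>
      (\<forall>w\<in>P1. b w \<noteq> 0 \<longrightarrow> mproj_eq (h w) (H w))" if z: "z \<in> P1" for z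
  proof -
    obtain F where F: "\<forall>j. \<exists>d. \<forall>b. (\<lambda>w. F w $ j $ b) \<in> mform d" "F z \<in> mproj"
      "\<And>w. w \<in> P1 \<Longrightarrow> F w \<in> mproj \<Longrightarrow> mproj_eq (\<psi>' w) (F w)"
      using reg(1) z unfolding regular_map_def by metis
    obtain dF where dF: "\<And>j b. (\<lambda>w. F w $ j $ b) \<in> mform (dF j)" using F(1) by metis
    have "\<forall>j. \<exists>a. F z $ j $ a \<noteq> 0" using F(2) by (auto simp: mproj_def vec_eq_iff)
    then obtain a where a: "\<And>j. F z $ j $ a j \<noteq> 0" by metis
    define b where "b = (\<lambda>w. \<Prod>j\<in>UNIV. F w $ j $ a j)"
    have "b \<in> polyfun" unfolding b_def by (intro polyfun_prod mform_polyfun[OF dF]) auto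
    moreover have "b z \<noteq> 0" using a by (simp add: b_def)
    moreover have "mproj_eq (h w) (g (F w))" if "w \<in> P1" "b w \<noteq> 0" for w
    proof -
      have "F w \<in> mproj" using that(2) by (auto simp: b_def mproj_def) (metis zero_index)
      from curve_param_respects(2)[OF c F(3)[OF that(1) this]] show ?thesis by (simp add: h_def)
    qed
    moreover have "(\<lambda>w. g (F w) $ 1 $ \<beta>) \<in> mform (\<lambda>i. \<Sum>j\<in>UNIV. dF j i * d' 1 j)" for \<beta>
      using mform_compose[OF dF d'] by blast
    ultimately show ?thesis
      by (intro exI[of _ "\<lambda>w. g (F w)"] exI[of _ "\<lambda>i. \<Sum>j\<in>UNIV. dF j i * d' 1 j"] exI[of _ b]) simp
  qed
  obtain H e b where H: "\<And>\<beta>. (\<lambda>w. H w $ 1 $ \<beta>) \<in> mform e" "b \<in> polyfun" "b x \<noteq> 0"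
    "\<And>w. w \<in> P1 \<Longrightarrow> b w \<noteq> 0 \<Longrightarrow> mproj_eq (h w) (H w)"
    using local[OF P(1)] by metis
  \<comment> \<open>The forms of the inverse are taken at \<open>\<psi> (h x)\<close>, so that the composition does not vanish at \<open>x\<close>.\<close>
  obtain G where G: "\<forall>j. \<exists>d. \<forall>b. (\<lambda>w. G w $ j $ b) \<in> mform d" "G (\<psi> (h x)) \<in> P1"
    "\<And>w. w \<in> C \<Longrightarrow> G w \<in> P1 \<Longrightarrow> mproj_eq (g' w) (G w)"
    using reg(2) curve_paramD(7)[OF c hP[OF P(1)]] unfolding regular_map_def by metis
  obtain dG where dG: "\<And>j b. (\<lambda>w. G w $ j $ b) \<in> mform (dG j)" using G(1) by metis
  define K where "K = (\<lambda>s. G (\<psi> s))"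
  obtain e' where K: "\<And>\<beta>. (\<lambda>s. K s $ 1 $ \<beta>) \<in> mform e'"
    using mform_compose[OF d dG] unfolding K_def by blast
  have Kresp: "mproj_eq (K s) (K t)" if "mproj_eq s t" for s t
    using forms_respect[OF dG curve_param_respects(1)[OF c that]] by (simp add: K_def)
  have xH: "mproj_eq (h x) (H x)" using H(3,4) P(1) by blast
  have HxP: "H x \<in> P1" using xH hP[OF P(1)] mproj_eq_mproj by blast
  have KHx: "K (H x) \<in> P1" using Kresp[OF xH] G(2) mproj_eq_mproj unfolding K_def by blast
  have "bracket w (K (H w)) = 0" for w
  proof (rule polyfun_no_zero_divisors[OF _ H(2) _ H(3), where f = "\<lambda>w. bracket w (K (H w))"])
    show "(\<lambda>w. bracket w (K (H w))) \<in> polyfun"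
    proof (intro polyfun_bracket polyfun_intros)
      show "(\<lambda>w. K (H w) $ 1 $ b) \<in> polyfun" for b
      proof (rule polyfun_compose[OF mform_polyfun[OF K]])
        show "(\<lambda>w. H w $ j $ b) \<in> polyfun" for j b
          using mform_polyfun[OF H(1)] num1_eq1[of j] by metis
      qed
    qed
    fix w assume bw: "b w \<noteq> 0"
    show "bracket w (K (H w)) = 0"
    proof (cases "w \<in> P1 \<and> K (H w) \<in> P1")
      case True
      then have w: "w \<in> P1" and KP: "K (H w) \<in> P1" by auto
      have hH: "mproj_eq (h w) (H w)" using H(4) w bw by blast
      then have HP: "H w \<in> P1" using hP[OF w] mproj_eq_mproj by blast
      have "mproj_eq (\<psi>' w) (\<psi> (h w))"
        using curve_param_inverse(2)[OF c \<psi>'C[OF w]] by (simp add: h_def mproj_eq_sym)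
      then have "mproj_eq (\<psi>' w) (\<psi> (H w))"
        using curve_param_respects(1)[OF c hH] mproj_eq_trans by blast
      then have "mproj_eq (g' (\<psi>' w)) (g' (\<psi> (H w)))"
        by (intro regular_map_respects[OF reg(2)] \<psi>'C[OF w] curve_paramD(7)[OF c HP])
      moreover have "mproj_eq (g' (\<psi> (H w))) (K (H w))"
        using G(3)[OF curve_paramD(7)[OF c HP]] KP by (simp add: K_def)
      ultimately have "mproj_eq w (K (H w))"
        using inv[OF w] by (meson mproj_eq_sym mproj_eq_trans)
      then show ?thesis using P1_eq_iff_bracket w KP by blast
    qed (auto simp: P1_iff bracket_def)
  qed
  note KH = this
  obtain M \<delta> where M: "\<delta> \<noteq> 0" "\<And>x y. bracket (M x) (M y) = \<delta> * bracket x y"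
    "\<And>b. (\<lambda>w. M w $ 1 $ b) \<in> polyfun" "\<And>w. bracket (H w) (M w) = 0"
    by (rule moebius_of_inverse_forms[OF H(1) K KH P(1) HxP KHx]) (rule that)
  have MP: "M s \<in> P1" if s: "s \<in> P1" for s
  proof -
    obtain t where "bracket s t \<noteq> 0" using bracket_nonzero_exists[OF s] by blast
    then have "bracket (M s) (M t) \<noteq> 0" using M(1,2) by simp
    then show ?thesis by (rule bracket_nonzero_P1)
  qed
  have hM: "mproj_eq (h s) (M s)" if s: "s \<in> P1" for s
  proof -
    obtain H' e' b' where H': "\<And>\<beta>. (\<lambda>w. H' w $ 1 $ \<beta>) \<in> mform e'" "b' \<in> polyfun" "b' s \<noteq> 0"
      "\<And>w. w \<in> P1 \<Longrightarrow> b' w \<noteq> 0 \<Longrightarrow> mproj_eq (h w) (H' w)"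
      using local[OF s] by metis
    have p: "(\<lambda>w. bracket (H' w) (M w)) \<in> polyfun"
      by (intro polyfun_bracket mform_polyfun[OF H'(1)] M(3))
    have gen: "bracket (H' w) (M w) = 0" if n: "b w \<noteq> 0" "b' w \<noteq> 0" "w \<in> P1" for w
    proof -
      have "mproj_eq (H w) (H' w)" using H(4) H'(4) n mproj_eq_sym mproj_eq_trans by blast
      moreover have "mproj_eq (H w) (M w)"
      proof (subst P1_eq_iff_bracket)
        show "H w \<in> P1" using H(4) hP n mproj_eq_mproj by blast
      qed (use M(4) MP n in auto)
      ultimately have "mproj_eq (H' w) (M w)" using mproj_eq_sym mproj_eq_trans by blast
      moreover have "H' w \<in> P1" using H'(4) hP n mproj_eq_mproj by blast
      ultimately show ?thesis using P1_eq_iff_bracket MP n by blast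
    qed
    obtain i :: 2 where i: "s $ 1 $ i \<noteq> 0" using s unfolding P1_iff by metis
    have "bracket (H' w) (M w) * (b' w * w $ 1 $ i) = 0" for w
    proof (rule polyfun_no_zero_divisors[OF _ H(2) _ H(3), where f = "\<lambda>w. bracket (H' w) (M w) * (b' w * w $ 1 $ i)"])
      show "(\<lambda>w. bracket (H' w) (M w) * (b' w * w $ 1 $ i)) \<in> polyfun"
        by (intro polyfun_intros p H'(2))
      fix w assume bw: "b w \<noteq> 0"
      show "bracket (H' w) (M w) * (b' w * w $ 1 $ i) = 0"
        using gen[OF bw] by (cases "w \<in> P1") (auto simp: mproj_def vec_eq_iff)
    qed
    from this[of s] have z: "bracket (H' s) (M s) = 0" using i H'(3) by simp
    have hs: "mproj_eq (h s) (H' s)" using H'(3,4) s by blast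
    then have "H' s \<in> P1" using hP[OF s] mproj_eq_mproj by blast
    then have "mproj_eq (H' s) (M s)" using z P1_eq_iff_bracket MP[OF s] by blast
    then show ?thesis using hs mproj_eq_trans by blast
  qed
  show ?thesis
    using cross_ratio_moebius[OF M(1,2), of x y z w h] hM P unfolding h_def by auto
qed

section \<open>Trees on a line\<close>

lemma simple_path_set:
  assumes "simple_path E u us v" shows "set us \<subseteq> insert u (\<Union>E)"
proof -
  have "us \<noteq> [] \<Longrightarrow> successively (\<lambda>x y. {x, y} \<in> E) us \<Longrightarrow> set us \<subseteq> insert (hd us) (\<Union>E)"
    by (induction us rule: induct_list012) auto
  then show ?thesis using assms unfolding simple_path_def by auto
qed

lemma simple_path_length:
  assumes "simple_path E u us v" "u \<in> V" "\<Union>E \<subseteq> V" "finite V"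
  shows "length us \<le> card V"
proof -
  have "set us \<subseteq> V" using simple_path_set[OF assms(1)] assms by auto
  then have "card (set us) \<le> card V" using assms(4) by (rule card_mono[rotated])
  then show ?thesis using assms(1) by (simp add: simple_path_def distinct_card)
qed

lemma tree_dist_eq:
  assumes "\<And>us. simple_path (edges T) u us v \<longleftrightarrow> us = ps"
  shows "tree_dist T u v = (\<Sum>k<length ps - 1. len T {ps ! k, ps ! Suc k})"
  unfolding tree_dist_def assms by simp

text \<open>
  A tree that is embedded isometrically into the real line by \<open>pos\<close>. The edges are recovered from the
  distances: they join the pairs of vertices with no other vertex on the geodesic between them.
\<close>

definition line_tree :: "('v, 'l) metric_tree \<Rightarrow> ('v \<Rightarrow> real) \<Rightarrow> bool" where
  "line_tree T pos \<longleftrightarrow> inj_on pos (verts T) \<and>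
     (\<forall>u\<in>verts T. \<forall>v\<in>verts T. tree_dist T u v = \<bar>pos u - pos v\<bar>) \<and>
     edges T = {{u, v} | u v. u \<in> verts T \<and> v \<in> verts T \<and> u \<noteq> v \<and>
       (\<forall>w\<in>verts T. tree_dist T u w + tree_dist T w v = tree_dist T u v \<longrightarrow> w = u \<or> w = v)} \<and>
     (\<forall>u\<in>verts T. \<forall>v\<in>verts T. {u, v} \<in> edges T \<longrightarrow> len T {u, v} = tree_dist T u v)"

lemma list_le_3_cases:
  assumes "length us \<le> 3" "us \<noteq> []"
  obtains p where "us = [p]" | p q where "us = [p, q]" | p q r where "us = [p, q, r]"
proof -
  obtain p us1 where 1: "us = p # us1" using assms by (cases us) auto
  show thesis
  proof (cases us1)
    case Nil then show thesis using 1 that by simp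
  next
    case 2: (Cons q us2)
    show thesis
    proof (cases us2)
      case Nil then show thesis using 1 2 that by simp
    next
      case (Cons r us3)
      then have "us3 = []" using assms 1 2 by simp
      then show thesis using 1 2 Cons that by simp
    qed
  qed
qed

lemma paths_one:
  assumes "u \<in> {x}" "v \<in> {x}"
  shows "simple_path {} u us v \<longleftrightarrow> us = [x]"
proof
  assume p: "simple_path {} u us v"
  then have "length us \<le> 1" using simple_path_length[OF p, of "{x}"] assms by auto
  then show "us = [x]" using p assms by (cases us) (auto simp: simple_path_def)
qed (use assms in \<open>auto simp: simple_path_def\<close>)

lemma paths_two:
  assumes "x \<noteq> y" "u \<in> {x, y}" "v \<in> {x, y}"
  shows "simple_path {{x, y}} u us v \<longleftrightarrow> us = (if u = v then [u] else [u, v])"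
proof
  assume p: "simple_path {{x, y}} u us v"
  then have "length us \<le> 2" using simple_path_length[OF p, of "{x, y}"] assms by auto
  moreover have "us \<noteq> []" using p by (simp add: simple_path_def)
  ultimately show "us = (if u = v then [u] else [u, v])"
    using p assms by (elim list_le_3_cases[rotated]) (auto simp: simple_path_def)
qed (use assms in \<open>auto simp: simple_path_def insert_commute\<close>)

lemma paths_three:
  assumes "distinct [x, y, z]" "u \<in> {x, y, z}" "v \<in> {x, y, z}"
  shows "simple_path {{x, y}, {y, z}} u us v \<longleftrightarrow>
    us = (if u = v then [u] else if u = y \<or> v = y then [u, v] else [u, y, v])"
proof
  assume p: "simple_path {{x, y}, {y, z}} u us v"
  then have "length us \<le> 3" using simple_path_length[OF p, of "{x, y, z}"] assms by auto
  moreover have "us \<noteq> []" using p by (simp add: simple_path_def)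
  ultimately show "us = (if u = v then [u] else if u = y \<or> v = y then [u, v] else [u, y, v])"
    using p assms by (elim list_le_3_cases) (auto simp: simple_path_def doubleton_eq_iff)
qed (use assms in \<open>auto simp: simple_path_def insert_commute\<close>)

lemma line_tree_one:
  assumes "verts T = {x}" "edges T = {}"
  shows "line_tree T (\<lambda>_. 0)"
proof -
  have "tree_dist T x x = 0"
    using tree_dist_eq[of T x x "[x]"] paths_one[of x x x] assms by auto
  then show ?thesis using assms by (auto simp: line_tree_def)
qed

lemma line_tree_two:
  assumes "verts T = {x, y}" "edges T = {{x, y}}" "x \<noteq> y" "len T {x, y} > 0"
    and pos: "pos y = pos x + len T {x, y}"
  shows "line_tree T pos"
proof -
  have d: "tree_dist T u v = (if u = v then 0 else len T {x, y})" if "u \<in> {x, y}" "v \<in> {x, y}" for u v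
    using tree_dist_eq[of T u v, OF paths_two[OF assms(3) that, folded assms(2)]] that
    by (auto simp: insert_commute)
  show ?thesis
    unfolding line_tree_def using assms
    by (auto simp: d insert_commute doubleton_eq_iff inj_on_def)
qed

lemma line_tree_three:
  assumes "verts T = {x, y, z}" "edges T = {{x, y}, {y, z}}" "distinct [x, y, z]"
    and l: "len T {x, y} > 0" "len T {y, z} > 0"
    and pos: "pos y = pos x + len T {x, y}" "pos z = pos y + len T {y, z}"
  shows "line_tree T pos"
proof -
  have d: "tree_dist T u v = \<bar>pos u - pos v\<bar>" if "u \<in> {x, y, z}" "v \<in> {x, y, z}" for u v
    using tree_dist_eq[of T u v, OF paths_three[OF assms(3) that, folded assms(2)]] that assms
    by (auto simp: insert_commute numeral_2_eq_2)
  have e: "{{u, v} | u v. u \<in> verts T \<and> v \<in> verts T \<and> u \<noteq> v \<and>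
       (\<forall>w\<in>verts T. tree_dist T u w + tree_dist T w v = tree_dist T u v \<longrightarrow> w = u \<or> w = v)}
     = {{x, y}, {y, z}}" (is "?L = ?R")
  proof
    show "?L \<subseteq> ?R"
      unfolding assms(1) using assms(3) l by (auto simp: d pos insert_commute)
    have "{x, y} \<in> ?L" unfolding assms(1)
      using assms(3) l by (intro CollectI exI[of _ x] exI[of _ y]) (auto simp: d pos)
    moreover have "{y, z} \<in> ?L" unfolding assms(1)
      using assms(3) l by (intro CollectI exI[of _ y] exI[of _ z]) (auto simp: d pos)
    ultimately show "?R \<subseteq> ?L" by simp
  qed
  have "inj_on pos (verts T)" unfolding assms(1) using l by (auto simp: inj_on_def pos)
  moreover have "\<forall>u\<in>verts T. \<forall>v\<in>verts T. {u, v} \<in> edges T \<longrightarrow> len T {u, v} = tree_dist T u v"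
    unfolding assms(1,2) using assms(3) l by (auto simp: d pos doubleton_eq_iff insert_commute)
  moreover have "\<forall>u\<in>verts T. \<forall>v\<in>verts T. tree_dist T u v = \<bar>pos u - pos v\<bar>"
    unfolding assms(1) using d by blast
  ultimately show ?thesis unfolding line_tree_def using e[folded assms(2), symmetric] by blast
qed

text \<open>
  If every vertex carries a leaf, the leaf distances determine the distances between all vertices,
  and these determine the edges and their lengths.
\<close>

lemma line_tree_isomorphic:
  assumes T: "line_tree T pos" "verts T = attach T ` leaves T"
    and T': "line_tree T' pos'" "verts T' = attach T' ` leaves T'"
    and \<sigma>: "bij_betw \<sigma> (leaves T) (leaves T')"
    and d: "\<And>x y. x \<in> leaves T \<Longrightarrow> y \<in> leaves T \<Longrightarrow> leaf_dist T' (\<sigma> x) (\<sigma> y) = leaf_dist T x y"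
  shows "identical_up_to_relabeling T T'"
proof -
  define \<phi> where "\<phi> v = attach T' (\<sigma> (SOME x. x \<in> leaves T \<and> attach T x = v))" for v
  have zero: "tree_dist T u v = 0 \<longleftrightarrow> u = v" if "u \<in> verts T" "v \<in> verts T" for u v
    using T(1) that unfolding line_tree_def inj_on_def by auto
  have zero': "tree_dist T' u v = 0 \<longleftrightarrow> u = v" if "u \<in> verts T'" "v \<in> verts T'" for u v
    using T'(1) that unfolding line_tree_def inj_on_def by auto
  have \<sigma>l: "\<sigma> x \<in> leaves T'" if "x \<in> leaves T" for x using \<sigma> that bij_betwE by blast
  have \<phi>: "\<phi> (attach T x) = attach T' (\<sigma> x)" if x: "x \<in> leaves T" for x
  proof -
    define y where "y = (SOME y. y \<in> leaves T \<and> attach T y = attach T x)"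
    have y: "y \<in> leaves T" "attach T y = attach T x"
      using someI[of "\<lambda>y. y \<in> leaves T \<and> attach T y = attach T x" x] x by (auto simp: y_def)
    have "leaf_dist T' (\<sigma> y) (\<sigma> x) = leaf_dist T y x" using d x y by blast
    also have "\<dots> = 0" using zero[of "attach T y" "attach T x"] y x T(2) by auto
    finally have "attach T' (\<sigma> y) = attach T' (\<sigma> x)"
      using zero' \<sigma>l x y(1) T'(2) by blast
    then show ?thesis by (simp add: \<phi>_def y_def)
  qed
  have \<phi>v: "\<phi> u \<in> verts T'" if "u \<in> verts T" for u
    using that T(2) T'(2) \<phi> \<sigma>l by auto
  have \<phi>d: "tree_dist T' (\<phi> u) (\<phi> v) = tree_dist T u v" if "u \<in> verts T" "v \<in> verts T" for u v
    using that T(2) d \<phi> by auto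
  have inj: "inj_on \<phi> (verts T)"
    by (intro inj_onI) (metis \<phi>d \<phi>v zero zero')
  have onto: "verts T' = \<phi> ` verts T"
  proof -
    have "verts T' = attach T' ` (\<sigma> ` leaves T)" using T'(2) \<sigma> by (simp add: bij_betw_def)
    also have "\<dots> = \<phi> ` (attach T ` leaves T)" using \<phi> by (auto simp: image_image)
    finally show ?thesis using T(2) by simp
  qed
  have E: "edges T = {{u, v} | u v. u \<in> verts T \<and> v \<in> verts T \<and> u \<noteq> v \<and>
       (\<forall>w\<in>verts T. tree_dist T u w + tree_dist T w v = tree_dist T u v \<longrightarrow> w = u \<or> w = v)}"
    and len: "\<And>u v. u \<in> verts T \<Longrightarrow> v \<in> verts T \<Longrightarrow> {u, v} \<in> edges T \<Longrightarrow> len T {u, v} = tree_dist T u v"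
    using T(1) unfolding line_tree_def by blast+
  have E': "edges T' = {{u, v} | u v. u \<in> verts T' \<and> v \<in> verts T' \<and> u \<noteq> v \<and>
       (\<forall>w\<in>verts T'. tree_dist T' u w + tree_dist T' w v = tree_dist T' u v \<longrightarrow> w = u \<or> w = v)}"
    and len': "\<And>u v. u \<in> verts T' \<Longrightarrow> v \<in> verts T' \<Longrightarrow> {u, v} \<in> edges T' \<Longrightarrow> len T' {u, v} = tree_dist T' u v"
    using T'(1) unfolding line_tree_def by blast+
  have edge_iff: "(\<phi> u \<noteq> \<phi> v \<and>
       (\<forall>w\<in>verts T'. tree_dist T' (\<phi> u) w + tree_dist T' w (\<phi> v) = tree_dist T' (\<phi> u) (\<phi> v) \<longrightarrow> w = \<phi> u \<or> w = \<phi> v))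
     \<longleftrightarrow> (u \<noteq> v \<and> (\<forall>w\<in>verts T. tree_dist T u w + tree_dist T w v = tree_dist T u v \<longrightarrow> w = u \<or> w = v))"
    if "u \<in> verts T" "v \<in> verts T" for u v
    unfolding onto using that \<phi>d inj by (auto simp: inj_on_eq_iff)
  have EE: "edges T' = (\<lambda>e. \<phi> ` e) ` edges T"
  proof (intro equalityI subsetI)
    fix e assume "e \<in> edges T'"
    then obtain u' v' where e: "e = {u', v'}" "u' \<in> verts T'" "v' \<in> verts T'" "u' \<noteq> v'"
       "\<forall>w\<in>verts T'. tree_dist T' u' w + tree_dist T' w v' = tree_dist T' u' v' \<longrightarrow> w = u' \<or> w = v'"
      unfolding E' by auto
    obtain u v where uv: "u' = \<phi> u" "v' = \<phi> v" "u \<in> verts T" "v \<in> verts T"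
      using e(2,3) onto by auto
    have "{u, v} \<in> edges T" unfolding E using edge_iff[OF uv(3,4)] e(4,5) uv by blast
    moreover have "e = \<phi> ` {u, v}" using e(1) uv by simp
    ultimately show "e \<in> (\<lambda>e. \<phi> ` e) ` edges T" by blast
  next
    fix e assume "e \<in> (\<lambda>e. \<phi> ` e) ` edges T"
    then obtain u v where e: "e = {\<phi> u, \<phi> v}" "u \<in> verts T" "v \<in> verts T" "u \<noteq> v"
       "\<forall>w\<in>verts T. tree_dist T u w + tree_dist T w v = tree_dist T u v \<longrightarrow> w = u \<or> w = v"
      unfolding E by auto
    then show "e \<in> edges T'" unfolding E' using edge_iff[OF e(2,3)] \<phi>v by blast
  qed
  have "len T' (\<phi> ` e) = len T e" if "e \<in> edges T" for e
  proof -
    obtain u v where e: "e = {u, v}" "u \<in> verts T" "v \<in> verts T" using \<open>e \<in> edges T\<close> unfolding E by auto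
    have "{\<phi> u, \<phi> v} = \<phi> ` {u, v}" by simp
    then have "{\<phi> u, \<phi> v} \<in> edges T'" using EE that e(1) by blast
    then have "len T' {\<phi> u, \<phi> v} = tree_dist T' (\<phi> u) (\<phi> v)" using len' \<phi>v e by blast
    then show ?thesis using len e that \<phi>d by auto
  qed
  moreover have "bij_betw \<phi> (verts T) (verts T')" using inj onto by (simp add: bij_betw_def)
  ultimately show ?thesis unfolding identical_up_to_relabeling_def
    using \<sigma> EE \<phi> by (intro exI[of _ \<sigma>] exI[of _ \<phi>]) auto
qed

section \<open>Trees with five leaves\<close>

text \<open>
  For a pair \<open>a, c\<close> separated from a pair \<open>b, d\<close>, this is the length of the path separating them.
\<close>

definition quartet :: "('v, 'l) metric_tree \<Rightarrow> 'l \<Rightarrow> 'l \<Rightarrow> 'l \<Rightarrow> 'l \<Rightarrow> real" where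
  "quartet T a b c d = (leaf_dist T a d + leaf_dist T b c - leaf_dist T a c - leaf_dist T b d) / 2"

text \<open>
  Every tree with five leaves has this shape, with up to three vertices on a line: two leaves at one
  end, two at the other, one in between. The distances between the three places may be \<open>0\<close>.
\<close>

definition caterpillar :: "('v, 'l) metric_tree \<Rightarrow> ('v \<Rightarrow> real) \<Rightarrow> bool" where
  "caterpillar T pos \<longleftrightarrow> line_tree T pos \<and> verts T = attach T ` leaves T \<and>
    (\<exists>a b c d e. leaves T = {a, b, c, d, e} \<and> distinct [a, b, c, d, e] \<and>
      pos (attach T a) = pos (attach T b) \<and> pos (attach T b) \<le> pos (attach T c) \<and>
      pos (attach T c) \<le> pos (attach T d) \<and> pos (attach T d) = pos (attach T e))"

text \<open>
  The bound is the triangle inequality. It is attained if \<open>c\<close> sits at the vertex of \<open>x\<close> and \<open>d\<close> at or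
  beyond that of \<open>y\<close>, or conversely; as both ends carry two leaves, such \<open>c\<close> and \<open>d\<close> exist unless \<open>x\<close>
  and \<open>y\<close> share a vertex. So the quartet values determine all leaf distances.
\<close>

lemma caterpillar_dist:
  assumes T: "caterpillar T pos" and xy: "x \<in> leaves T" "y \<in> leaves T" "x \<noteq> y"
  shows "0 \<le> leaf_dist T x y"
    and "c \<in> leaves T \<Longrightarrow> d \<in> leaves T \<Longrightarrow> quartet T x d c y \<le> leaf_dist T x y"
    and "leaf_dist T x y = 0 \<or> (\<exists>c\<in>leaves T. \<exists>d\<in>leaves T. distinct [x, d, c, y] \<and>
           leaf_dist T x y = quartet T x d c y)"
proof -
  define P where "P x = pos (attach T x)" for x
  have d: "leaf_dist T x y = \<bar>P x - P y\<bar>" if "x \<in> leaves T" "y \<in> leaves T" for x y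
    using T that unfolding caterpillar_def line_tree_def P_def by auto
  show "0 \<le> leaf_dist T x y" using d xy by simp
  show "quartet T x d c y \<le> leaf_dist T x y" if "c \<in> leaves T" "d \<in> leaves T"
    unfolding quartet_def using that xy by (simp add: d)
  obtain a b c d' e where L: "leaves T = {a, b, c, d', e}" "distinct [a, b, c, d', e]"
      "P a = P b" "P b \<le> P c" "P c \<le> P d'" "P d' = P e"
    using T unfolding caterpillar_def P_def by auto
  have q: "quartet T x d c y = (\<bar>P x - P y\<bar> + \<bar>P d - P c\<bar> - \<bar>P x - P c\<bar> - \<bar>P d - P y\<bar>) / 2"
    if "d \<in> leaves T" "c \<in> leaves T" for c d
    unfolding quartet_def using that xy by (simp add: d)
  have *: "leaf_dist T x y = 0 \<or> leaf_dist T x y = quartet T x g f y"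
    if "g \<in> leaves T" "f \<in> leaves T" "P x = P y \<or> P x = P f \<and> P y \<le> P x \<and> P g \<le> P y \<or> P x = P f \<and> P x \<le> P y \<and> P y \<le> P g
      \<or> P y = P g \<and> P x \<le> P y \<and> P f \<le> P x \<or> P y = P g \<and> P y \<le> P x \<and> P x \<le> P f" for f g
    using that xy by (auto simp: q d)
  define Q where "Q x y f g \<longleftrightarrow> f \<in> leaves T \<and> g \<in> leaves T \<and> distinct [x, g, f, y] \<and>
     (P x = P f \<and> P y \<le> P x \<and> P g \<le> P y \<or> P x = P f \<and> P x \<le> P y \<and> P y \<le> P g
      \<or> P y = P g \<and> P x \<le> P y \<and> P f \<le> P x \<or> P y = P g \<and> P y \<le> P x \<and> P x \<le> P f)" for x y f g
  have "Q a c b d'" "Q b c a d'" "Q a d' b e" "Q a e b d'" "Q b d' a e" "Q b e a d'"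
    "Q c d' a e" "Q c e a d'" "Q c a d' b" "Q c b d' a" "Q d' a e b" "Q d' b e a" "Q e a d' b"
    "Q e b d' a" "Q d' c e a" "Q e c d' a"
    using L by (auto simp: Q_def)
  moreover have "P a = P b" "P b = P a" "P d' = P e" "P e = P d'" using L by auto
  moreover have "x \<in> {a, b, c, d', e}" "y \<in> {a, b, c, d', e}" using xy L by auto
  ultimately consider "P x = P y" | f g where "Q x y f g" using xy(3) by blast
  then show "leaf_dist T x y = 0 \<or> (\<exists>c\<in>leaves T. \<exists>d\<in>leaves T. distinct [x, d, c, y] \<and>
           leaf_dist T x y = quartet T x d c y)"
  proof cases
    case 1
    then show ?thesis using d xy by simp
  next
    case 2
    then show ?thesis using *[of g f] xy unfolding Q_def by blast
  qed
qed

lemma caterpillars_isomorphic: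
  assumes T: "caterpillar T pos" and T': "caterpillar T' pos'"
    and \<sigma>: "bij_betw \<sigma> (leaves T) (leaves T')"
    and q: "\<And>a b c d. {a, b, c, d} \<subseteq> leaves T \<Longrightarrow> distinct [a, b, c, d] \<Longrightarrow>
      quartet T' (\<sigma> a) (\<sigma> b) (\<sigma> c) (\<sigma> d) = quartet T a b c d"
  shows "identical_up_to_relabeling T T'"
proof (rule line_tree_isomorphic)
  show "line_tree T pos" "verts T = attach T ` leaves T" "line_tree T' pos'" "verts T' = attach T' ` leaves T'"
    using T T' by (auto simp: caterpillar_def)
  show "bij_betw \<sigma> (leaves T) (leaves T')" by fact
  have inj: "\<sigma> x = \<sigma> y \<longleftrightarrow> x = y" if "x \<in> leaves T" "y \<in> leaves T" for x y
    using \<sigma> that by (auto simp: bij_betw_def inj_on_eq_iff)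
  have \<sigma>l: "leaves T' = \<sigma> ` leaves T" using \<sigma> by (simp add: bij_betw_def)
  fix x y assume x: "x \<in> leaves T" and y: "y \<in> leaves T"
  show "leaf_dist T' (\<sigma> x) (\<sigma> y) = leaf_dist T x y"
  proof (cases "x = y")
    case True
    then show ?thesis using x T T' \<sigma>l unfolding caterpillar_def line_tree_def by auto
  next
    case False
    then have ne: "\<sigma> x \<noteq> \<sigma> y" and l: "\<sigma> x \<in> leaves T'" "\<sigma> y \<in> leaves T'" using inj x y \<sigma>l by auto
    show ?thesis
    proof (rule antisym)
      consider "leaf_dist T' (\<sigma> x) (\<sigma> y) = 0" | c d where "c \<in> leaves T" "d \<in> leaves T"
        "distinct [\<sigma> x, \<sigma> d, \<sigma> c, \<sigma> y]" "leaf_dist T' (\<sigma> x) (\<sigma> y) = quartet T' (\<sigma> x) (\<sigma> d) (\<sigma> c) (\<sigma> y)"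
        using caterpillar_dist(3)[OF T' l ne] unfolding \<sigma>l by blast
      then show "leaf_dist T' (\<sigma> x) (\<sigma> y) \<le> leaf_dist T x y"
      proof cases
        case 2
        then have "quartet T' (\<sigma> x) (\<sigma> d) (\<sigma> c) (\<sigma> y) = quartet T x d c y" using q x y by auto
        then show ?thesis using 2 caterpillar_dist(2)[OF T x y False] by auto
      qed (use caterpillar_dist(1)[OF T x y False] in auto)
      consider "leaf_dist T x y = 0" | c d where "c \<in> leaves T" "d \<in> leaves T"
        "distinct [x, d, c, y]" "leaf_dist T x y = quartet T x d c y"
        using caterpillar_dist(3)[OF T x y False] by blast
      then show "leaf_dist T x y \<le> leaf_dist T' (\<sigma> x) (\<sigma> y)"
      proof cases
        case 2
        then have "quartet T' (\<sigma> x) (\<sigma> d) (\<sigma> c) (\<sigma> y) = quartet T x d c y" using q x y by auto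
        then show ?thesis using 2 caterpillar_dist(2)[OF T' l ne, of "\<sigma> c" "\<sigma> d"] \<sigma>l by auto
      qed (use caterpillar_dist(1)[OF T' l ne] in auto)
    qed
  qed
qed

text \<open>
  Fix a root \<open>r\<close>. Every edge is the last edge of the path from \<open>r\<close> to one of its two ends, so there
  are at most as many edges as vertices other than \<open>r\<close>.
\<close>

lemma metric_tree_card_edges:
  assumes T: "is_metric_tree T" shows "card (edges T) < card (verts T)"
proof -
  have fin: "finite (verts T)" and ne: "verts T \<noteq> {}"
    and E: "edges T \<subseteq> {{u, v} | u v. u \<in> verts T \<and> v \<in> verts T \<and> u \<noteq> v}"
    and path: "\<And>u v. u \<in> verts T \<Longrightarrow> v \<in> verts T \<Longrightarrow> \<exists>!us. simple_path (edges T) u us v"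
    using T[unfolded is_metric_tree_def] by simp_all
  obtain r where r: "r \<in> verts T" using ne by blast
  define P where "P v = (THE us. simple_path (edges T) r us v)" for v
  have P: "simple_path (edges T) r (P v) v" if "v \<in> verts T" for v
    using theI'[OF path[OF r that]] by (simp add: P_def)
  have Pu: "us = P v" if "v \<in> verts T" "simple_path (edges T) r us v" for us v
    using path[OF r that(1)] P[OF that(1)] that(2) by blast
  have "edges T \<subseteq> (\<lambda>x. {last (butlast (P x)), x}) ` (verts T - {r})"
  proof
    fix e assume e: "e \<in> edges T"
    then obtain u v where uv: "e = {u, v}" "u \<in> verts T" "v \<in> verts T" "u \<noteq> v" using E by blast
    note pu = P[OF uv(2), unfolded simple_path_def]
    show "e \<in> (\<lambda>x. {last (butlast (P x)), x}) ` (verts T - {r})"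
    proof (cases "v \<in> set (P u)")
      case True
      then obtain xs ys where s: "P u = xs @ v # ys" using split_list by metis
      have "ys \<noteq> []" using pu s uv(4) by auto
      then have u: "u \<in> set ys" using pu s by (metis last_ConsR last_appendR last_in_set list.distinct(1))
      have "successively (\<lambda>x y. {x, y} \<in> edges T) (xs @ [v, u])"
        using pu e uv unfolding s by (auto simp: successively_append_iff insert_commute)
      moreover have "hd (xs @ [v, u]) = r" "distinct (xs @ [v, u])"
        using pu u uv unfolding s by (cases xs; auto)+
      ultimately have sp: "simple_path (edges T) r (xs @ [v, u]) u" by (simp add: simple_path_def)
      have "P u = xs @ [v, u]" using Pu[OF uv(2) sp] by simp
      moreover have "u \<noteq> r" using pu u unfolding s by (cases xs) auto
      ultimately show ?thesis using uv by (intro image_eqI[of _ _ u]) (auto simp: butlast_append)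
    next
      case False
      have sp: "simple_path (edges T) r (P u @ [v]) v"
        using pu False e uv unfolding simple_path_def by (auto simp: successively_append_iff)
      have "P v = P u @ [v]" using Pu[OF uv(3) sp] by simp
      moreover have "v \<noteq> r" using pu False by auto
      ultimately show ?thesis using uv pu by (intro image_eqI[of _ _ v]) (auto simp: butlast_append)
    qed
  qed
  then have "card (edges T) \<le> card ((\<lambda>x. {last (butlast (P x)), x}) ` (verts T - {r}))"
    using fin by (intro card_mono) auto
  also have "\<dots> \<le> card (verts T - {r})" using fin by (intro card_image_le) auto
  also have "\<dots> < card (verts T)" using fin r by (intro psubset_card_mono) auto
  finally show ?thesis .
qed

text \<open>
  Counting incidences, \<open>3 |V| \<le> 2 |E| + |L| \<le> 2 |V| - 2 + |L|\<close>.
\<close>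

lemma metric_tree_card_verts:
  assumes T: "is_metric_tree T" shows "card (verts T) + 2 \<le> card (leaves T)"
proof -
  have fin: "finite (verts T)" "finite (leaves T)"
    and E: "edges T \<subseteq> {{u, v} | u v. u \<in> verts T \<and> v \<in> verts T \<and> u \<noteq> v}"
    and att: "attach T ` leaves T \<subseteq> verts T"
    and deg: "\<And>v. v \<in> verts T \<Longrightarrow> card {e \<in> edges T. v \<in> e} + card {a \<in> leaves T. attach T a = v} \<ge> 3"
    using T[unfolded is_metric_tree_def] by simp_all
  have "edges T \<subseteq> Pow (verts T)" using E by auto
  then have finE: "finite (edges T)" using fin finite_subset by blast
  have "(\<Sum>v\<in>verts T. card {e \<in> edges T. v \<in> e}) = (\<Sum>e\<in>edges T. card {v \<in> verts T. v \<in> e})"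
    using fin(1) finE by (rule sum_multicount_gen) auto
  also have "\<dots> = (\<Sum>e\<in>edges T. 2)"
  proof (rule sum.cong)
    fix e assume "e \<in> edges T"
    then obtain u v where "e = {u, v}" "u \<in> verts T" "v \<in> verts T" "u \<noteq> v" using E by blast
    moreover from this have "{v \<in> verts T. v \<in> e} = {u, v}" by auto
    ultimately show "card {v \<in> verts T. v \<in> e} = 2" by simp
  qed simp
  finally have e: "(\<Sum>v\<in>verts T. card {e \<in> edges T. v \<in> e}) = 2 * card (edges T)" by simp
  have "(\<Sum>v\<in>verts T. card {a \<in> leaves T. attach T a = v}) = (\<Sum>a\<in>leaves T. card {v \<in> verts T. attach T a = v})"
    using fin by (rule sum_multicount_gen) auto
  also have "\<dots> = (\<Sum>a\<in>leaves T. 1)"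
  proof (rule sum.cong)
    fix a assume "a \<in> leaves T"
    then have "{v \<in> verts T. attach T a = v} = {attach T a}" using att by auto
    then show "card {v \<in> verts T. attach T a = v} = 1" by simp
  qed simp
  finally have l: "(\<Sum>v\<in>verts T. card {a \<in> leaves T. attach T a = v}) = card (leaves T)" by simp
  have "3 * card (verts T) = (\<Sum>v\<in>verts T. 3)" by simp
  also have "\<dots> \<le> (\<Sum>v\<in>verts T. card {e \<in> edges T. v \<in> e} + card {a \<in> leaves T. attach T a = v})"
    using deg by (rule sum_mono)
  also have "\<dots> = 2 * card (edges T) + card (leaves T)" by (simp add: sum.distrib e l)
  finally show ?thesis using metric_tree_card_edges[OF T] by simp
qed

lemma metric_tree_neighbour:
  assumes T: "is_metric_tree T" and uv: "u \<in> verts T" "v \<in> verts T" "u \<noteq> v"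
  shows "\<exists>w. {u, w} \<in> edges T"
proof -
  have "\<forall>u\<in>verts T. \<forall>v\<in>verts T. \<exists>!us. simple_path (edges T) u us v"
    using T by (simp add: is_metric_tree_def)
  then obtain us where us: "simple_path (edges T) u us v" using uv by blast
  then have "us \<noteq> []" "hd us = u" "last us = v" by (simp_all add: simple_path_def)
  then obtain us' where 1: "us = u # us'" by (cases us) auto
  then have "us' \<noteq> []" using \<open>last us = v\<close> uv(3) by auto
  then obtain w ws where "us = u # w # ws" using 1 by (cases us') auto
  then have "{u, w} \<in> edges T" using us by (simp add: simple_path_def)
  then show ?thesis by blast
qed

lemma caterpillar_two:
  assumes "verts T = {u, v}" "u \<noteq> v" "edges T = {{u, v}}" "len T {u, v} > 0"
    and "attach T ` leaves T \<subseteq> verts T"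
    and "card {a \<in> leaves T. attach T a = u} = 2" "card {a \<in> leaves T. attach T a = v} = 3"
  shows "\<exists>pos. caterpillar T pos"
proof -
  define pos where "pos w = (if w = u then 0 else len T {u, v})" for w
  have line: "line_tree T pos"
    using assms by (intro line_tree_two[of T u v]) (auto simp: pos_def)
  obtain a b where ab: "{x \<in> leaves T. attach T x = u} = {a, b}" "a \<noteq> b"
    using assms(6) by (auto simp: card_2_iff)
  obtain c d e where cde: "{x \<in> leaves T. attach T x = v} = {c, d, e}" "distinct [c, d, e]"
    using assms(7) by (auto simp: card_3_iff)
  have mem: "attach T a = u" "attach T b = u" "attach T c = v" "attach T d = v" "attach T e = v"
    using ab(1) cde(1) by blast+
  have L: "leaves T = {a, b, c, d, e}"
  proof -
    have "leaves T = {x \<in> leaves T. attach T x = u} \<union> {x \<in> leaves T. attach T x = v}"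
      using assms(1,5) by auto
    then show ?thesis unfolding ab(1) cde(1) by auto
  qed
  have dist: "distinct [a, b, c, d, e]" using ab(2) cde(2) mem assms(2) by auto
  show ?thesis unfolding caterpillar_def
  proof (intro exI conjI)
    show "line_tree T pos" by (rule line)
    show "leaves T = {a, b, c, d, e}" "distinct [a, b, c, d, e]" by fact+
    show "verts T = attach T ` leaves T" using mem assms(1) L by auto
  qed (use mem assms in \<open>auto simp: pos_def\<close>)
qed

lemma two_of_three:
  assumes "E \<subseteq> {p, q, r}" "E \<noteq> {p, q, r}" "p \<in> E \<or> r \<in> E" "p \<in> E \<or> q \<in> E" "q \<in> E \<or> r \<in> E"
  shows "E = {p, q} \<or> E = {p, r} \<or> E = {q, r}"
  using assms by blast

text \<open>
  With five leaves there are at most three vertices. The degree condition then leaves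
  a single vertex, two vertices carrying two and three leaves, or a path of three vertices carrying
  two, one and two leaves.
\<close>

lemma metric_tree_caterpillar:
  assumes T: "is_metric_tree T" and card: "card (leaves T) = 5"
  shows "\<exists>pos. caterpillar T pos"
proof -
  have fin: "finite (verts T)" "finite (leaves T)" and ne: "verts T \<noteq> {}"
    and E: "edges T \<subseteq> {{u, v} | u v. u \<in> verts T \<and> v \<in> verts T \<and> u \<noteq> v}"
    and att: "attach T ` leaves T \<subseteq> verts T"
    and len: "\<And>e. e \<in> edges T \<Longrightarrow> len T e > 0"
    and deg: "\<And>v. v \<in> verts T \<Longrightarrow> card {e \<in> edges T. v \<in> e} + card {a \<in> leaves T. attach T a = v} \<ge> 3"
    using T[unfolded is_metric_tree_def] by simp_all
  define L where "L v = {a \<in> leaves T. attach T a = v}" for v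
  have finL: "finite (L v)" for v using fin by (simp add: L_def)
  have "card (verts T) \<le> 3" using metric_tree_card_verts[OF T] card by simp
  moreover have "card (verts T) \<noteq> 0" using fin ne by simp
  ultimately consider "card (verts T) = 1" | "card (verts T) = 2" | "card (verts T) = 3" by linarith
  then show ?thesis
  proof cases
    case 1
    then obtain u where V: "verts T = {u}" using card_1_singletonE by blast
    then have "edges T = {}" using E by auto
    with V have line: "line_tree T (\<lambda>_. 0)" by (rule line_tree_one)
    obtain xs where xs: "set xs = leaves T" "distinct xs" using finite_distinct_list[OF fin(2)] by blast
    then have "length xs = 5" using card distinct_card[OF xs(2)] by simp
    then obtain a b c d e where "xs = [a, b, c, d, e]"
      by (auto simp: length_Suc_conv eval_nat_numeral)
    then have L: "leaves T = {a, b, c, d, e}" "distinct [a, b, c, d, e]" using xs by auto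
    have m: "attach T x = u" if "x \<in> leaves T" for x using att V that by auto
    show ?thesis unfolding caterpillar_def
    proof (intro exI conjI)
      show "line_tree T (\<lambda>_. 0)" by (rule line)
      show "verts T = attach T ` leaves T" unfolding V L using m L by auto
      show "leaves T = {a, b, c, d, e}" "distinct [a, b, c, d, e]" by fact+
    qed simp_all
  next
    case 2
    then obtain u v where V: "verts T = {u, v}" "u \<noteq> v" by (auto simp: card_2_iff)
    have sub: "edges T \<subseteq> {{u, v}}" using E V by auto
    moreover obtain w where "{u, w} \<in> edges T" using metric_tree_neighbour[OF T, of u v] V by blast
    ultimately have e: "edges T = {{u, v}}" by auto
    have "{e \<in> edges T. u \<in> e} = {{u, v}}" "{e \<in> edges T. v \<in> e} = {{u, v}}" using e by auto
    then have "card (L u) \<ge> 2" "card (L v) \<ge> 2"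
      using deg[of u] deg[of v] V by (simp_all add: L_def)
    moreover have "leaves T = L u \<union> L v" "L u \<inter> L v = {}" using att V by (auto simp: L_def)
    then have "card (L u) + card (L v) = 5" using card card_Un_disjoint finL by metis
    ultimately consider "card (L u) = 2" "card (L v) = 3" | "card (L v) = 2" "card (L u) = 3" by linarith
    then show ?thesis
    proof cases
      case 1
      show ?thesis
        by (rule caterpillar_two[of T u v]) (use 1 V e len att in \<open>auto simp: L_def\<close>)
    next
      case 2
      show ?thesis
        by (rule caterpillar_two[of T v u]) (use 2 V e len att in \<open>auto simp: L_def insert_commute\<close>)
    qed
  next
    case 3
    then obtain x y z where V: "verts T = {x, y, z}" "distinct [x, y, z]" by (auto simp: card_3_iff)
    have sub: "edges T \<subseteq> {{x, y}, {y, z}, {x, z}}" using E V by (auto simp: insert_commute)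
    have ce: "card (edges T) \<le> 2" using metric_tree_card_edges[OF T] 3 by simp
    have "z \<noteq> x" using V by auto
    then have nb: "\<exists>w. {x, w} \<in> edges T" "\<exists>w. {y, w} \<in> edges T" "\<exists>w. {z, w} \<in> edges T"
      using metric_tree_neighbour[OF T, of x y] metric_tree_neighbour[OF T, of y z]
        metric_tree_neighbour[OF T, of z x] V by simp_all
    have ne3: "{x, y} \<noteq> {y, z}" "{x, y} \<noteq> {x, z}" "{y, z} \<noteq> {x, z}" using V(2) by (auto simp: doubleton_eq_iff)
    have "card {{x, y}, {y, z}, {x, z}} = 3" using ne3 by simp
    then have nall: "edges T \<noteq> {{x, y}, {y, z}, {x, z}}" using ce by auto
    then have "edges T = {{x, y}, {y, z}} \<or> edges T = {{x, y}, {x, z}} \<or> edges T = {{y, z}, {x, z}}"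
    proof -
      have n: "{x, w} \<noteq> {y, z}" "{y, w} \<noteq> {x, z}" "{z, w} \<noteq> {x, y}" for w
        using V(2) by (auto simp: doubleton_eq_iff)
      obtain w1 where w1: "{x, w1} \<in> edges T" using nb(1) by blast
      then have "{x, w1} = {x, y} \<or> {x, w1} = {x, z}" using n(1)[of w1] subsetD[OF sub w1] by simp
      then have 1: "{x, y} \<in> edges T \<or> {x, z} \<in> edges T" using w1 by metis
      obtain w2 where w2: "{y, w2} \<in> edges T" using nb(2) by blast
      then have "{y, w2} = {x, y} \<or> {y, w2} = {y, z}" using n(2)[of w2] subsetD[OF sub w2] by simp
      then have 2: "{x, y} \<in> edges T \<or> {y, z} \<in> edges T" using w2 by metis
      obtain w3 where w3: "{z, w3} \<in> edges T" using nb(3) by blast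
      then have "{z, w3} = {y, z} \<or> {z, w3} = {x, z}" using n(3)[of w3] subsetD[OF sub w3] by simp
      then have 3: "{y, z} \<in> edges T \<or> {x, z} \<in> edges T" using w3 by metis
      show ?thesis by (rule two_of_three[OF sub nall 1 2 3])
    qed
    then obtain u w v where V: "verts T = {u, w, v}" "distinct [u, w, v]" and e: "edges T = {{u, w}, {w, v}}"
    proof (elim disjE)
      assume "edges T = {{x, y}, {y, z}}" then show thesis using V by (intro that[of x y z]) auto
    next
      assume "edges T = {{x, y}, {x, z}}" then show thesis using V by (intro that[of y x z]) auto
    next
      assume "edges T = {{y, z}, {x, z}}" then show thesis using V by (intro that[of y z x]) auto
    qed
    define pos where "pos t = (if t = u then 0 else if t = w then len T {u, w} else len T {u, w} + len T {w, v})" for t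
    have line: "line_tree T pos"
      using V e len by (intro line_tree_three[of T u w v]) (auto simp: pos_def)
    have "{e \<in> edges T. u \<in> e} = {{u, w}}" "{e \<in> edges T. v \<in> e} = {{w, v}}"
      "{e \<in> edges T. w \<in> e} = {{u, w}, {w, v}}" using e V(2) by auto
    moreover have "card {{u, w}, {w, v}} = 2" using V(2) by (auto simp: card_2_iff doubleton_eq_iff)
    ultimately have "card (L u) \<ge> 2" "card (L v) \<ge> 2" "card (L w) \<ge> 1"
      using deg[of u] deg[of v] deg[of w] V by (simp_all add: L_def)
    moreover have Lu: "leaves T = L u \<union> L v \<union> L w" and "(L u \<union> L v) \<inter> L w = {}" "L u \<inter> L v = {}"
      using att V by (auto simp: L_def)
    then have "card (L u) + card (L v) + card (L w) = 5" using card card_Un_disjoint finL finite_UnI by metis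
    ultimately have cards: "card (L u) = 2" "card (L v) = 2" "card (L w) = 1" by linarith+
    obtain a b where ab: "L u = {a, b}" "a \<noteq> b" using cards(1) by (auto simp: card_2_iff)
    obtain d e where de: "L v = {d, e}" "d \<noteq> e" using cards(2) by (auto simp: card_2_iff)
    obtain c where c: "L w = {c}" using cards(3) card_1_singletonE by blast
    have mem: "attach T a = u" "attach T b = u" "attach T c = w" "attach T d = v" "attach T e = v"
      using ab(1) de(1) c unfolding L_def by blast+
    have L: "leaves T = {a, b, c, d, e}" using Lu ab(1) de(1) c by auto
    have dist: "distinct [a, b, c, d, e]" using ab(2) de(2) mem V(2) by auto
    have l0: "len T {u, w} > 0" "len T {w, v} > 0" using len \<open>edges T = _\<close> by auto
    show ?thesis unfolding caterpillar_def
    proof (intro exI conjI)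
      show "line_tree T pos" by (rule line)
      show "leaves T = {a, b, c, d, e}" "distinct [a, b, c, d, e]" by fact+
      show "verts T = attach T ` leaves T" using mem V L by auto
    qed (use mem V l0 in \<open>auto simp: pos_def\<close>)
  qed
qed

lemma caterpillar_exists:
  fixes P :: "'l \<Rightarrow> real"
  assumes dist: "distinct [a, b, c, d, e]" and P: "P a = P b" "P b \<le> P c" "P c \<le> P d" "P d = P e"
  shows "\<exists>T :: (nat, 'l) metric_tree. is_metric_tree T \<and> leaves T = {a, b, c, d, e} \<and>
    (\<forall>x\<in>leaves T. \<forall>y\<in>leaves T. leaf_dist T x y = \<bar>P x - P y\<bar>)"
proof -
  let ?L = "{a, b, c, d, e}"
  have card_ge: "card X \<le> card {x \<in> ?L. Q x}" if "X \<subseteq> {x \<in> ?L. Q x}" for X Q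
    using that by (intro card_mono) auto
  have ex1: "\<exists>!us. R us" if "\<And>us. R us \<longleftrightarrow> us = X" for R and X :: "nat list" using that by auto
  consider "P a = P d" | "P a < P d" "P c = P a \<or> P c = P d" | "P a < P c" "P c < P d"
    using P by fastforce
  then show ?thesis
  proof cases
    case 1
    define T :: "(nat, 'l) metric_tree" where
      "T = \<lparr>verts = {0}, edges = {}, len = (\<lambda>_. 1), leaves = ?L, attach = (\<lambda>_. 0)\<rparr>"
    have line: "line_tree T (\<lambda>_. 0)" by (intro line_tree_one[of T 0]) (auto simp: T_def)
    have "is_metric_tree T" unfolding is_metric_tree_def
    proof (intro conjI ballI)
      fix u v assume "u \<in> verts T" "v \<in> verts T"
      then show "\<exists>!us. simple_path (edges T) u us v"
        using ex1[OF paths_one[of u 0 v]] by (auto simp: T_def)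
    next
      fix v assume "v \<in> verts T"
      then have "card {a, b, c} \<le> card {a \<in> leaves T. attach T a = v}"
        unfolding T_def metric_tree.simps by (intro card_ge) auto
      then show "3 \<le> card {e \<in> edges T. v \<in> e} + card {a \<in> leaves T. attach T a = v}"
        using dist by simp
    qed (auto simp: T_def)
    moreover have "leaf_dist T x y = \<bar>P x - P y\<bar>" if "x \<in> leaves T" "y \<in> leaves T" for x y
      using line that 1 P unfolding line_tree_def by (auto simp: T_def)
    moreover have "leaves T = ?L" by (simp add: T_def)
    ultimately show ?thesis by blast
  next
    case 2
    define T :: "(nat, 'l) metric_tree" where
      "T = \<lparr>verts = {0, 1}, edges = {{0, 1}}, len = (\<lambda>_. P d - P a), leaves = ?L,
        attach = (\<lambda>x. if P x = P a then 0 else 1)\<rparr>"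
    define pos where "pos n = (if n = 0 then P a else P d)" for n :: nat
    have line: "line_tree T pos"
      by (intro line_tree_two[of T 0 1]) (use 2 in \<open>auto simp: T_def pos_def\<close>)
    have "is_metric_tree T" unfolding is_metric_tree_def
    proof (intro conjI ballI)
      fix u v assume "u \<in> verts T" "v \<in> verts T"
      then show "\<exists>!us. simple_path (edges T) u us v"
        using ex1[OF paths_two[of 0 1 u v]] by (simp add: T_def)
    next
      fix v assume "v \<in> verts T"
      then consider "v = 0" | "v = 1" by (auto simp: T_def)
      then show "3 \<le> card {e \<in> edges T. v \<in> e} + card {a \<in> leaves T. attach T a = v}"
      proof cases
        case 1
        then have "{e \<in> edges T. v \<in> e} = {{0, 1}}" by (auto simp: T_def)
        moreover have "card {a, b} \<le> card {a \<in> leaves T. attach T a = v}"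
          using 1 P unfolding T_def metric_tree.simps by (intro card_ge) auto
        ultimately show ?thesis using dist by simp
      next
        case 2
        then have "{e \<in> edges T. v \<in> e} = {{0, 1}}" by (auto simp: T_def)
        moreover have "card {d, e} \<le> card {a \<in> leaves T. attach T a = v}"
          using 2 P \<open>P a < P d\<close> unfolding T_def metric_tree.simps by (intro card_ge) auto
        ultimately show ?thesis using dist by simp
      qed
    qed (use 2 in \<open>auto simp: T_def\<close>)
    moreover have "leaf_dist T x y = \<bar>P x - P y\<bar>" if "x \<in> leaves T" "y \<in> leaves T" for x y
    proof -
      have "leaf_dist T x y = \<bar>pos (attach T x) - pos (attach T y)\<bar>"
        using line unfolding line_tree_def by (auto simp: T_def)
      moreover have "pos (attach T x) = P x" if "x \<in> leaves T" for x
        using that P 2 by (auto simp: T_def pos_def)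
      ultimately show ?thesis using that by simp
    qed
    moreover have "leaves T = ?L" by (simp add: T_def)
    ultimately show ?thesis by blast
  next
    case 3
    define T :: "(nat, 'l) metric_tree" where
      "T = \<lparr>verts = {0, 1, 2}, edges = {{0, 1}, {1, 2}},
        len = (\<lambda>e. if 0 \<in> e then P c - P a else P d - P c), leaves = ?L,
        attach = (\<lambda>x. if P x = P a then 0 else if P x = P c then 1 else 2)\<rparr>"
    define pos where "pos n = (if n = 0 then P a else if n = 1 then P c else P d)" for n :: nat
    have line: "line_tree T pos"
      by (intro line_tree_three[of T 0 1 2]) (use 3 in \<open>auto simp: T_def pos_def\<close>)
    have "is_metric_tree T" unfolding is_metric_tree_def
    proof (intro conjI ballI)
      fix u v assume "u \<in> verts T" "v \<in> verts T"
      then show "\<exists>!us. simple_path (edges T) u us v"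
        using ex1[OF paths_three[of 0 1 2 u v]] by (simp add: T_def)
    next
      fix v assume "v \<in> verts T"
      then consider "v = 0" | "v = 1" | "v = 2" by (auto simp: T_def)
      then show "3 \<le> card {e \<in> edges T. v \<in> e} + card {a \<in> leaves T. attach T a = v}"
      proof cases
        case 1
        then have "{e \<in> edges T. v \<in> e} = {{0, 1}}" by (auto simp: T_def)
        moreover have "card {a, b} \<le> card {a \<in> leaves T. attach T a = v}"
          using 1 P unfolding T_def metric_tree.simps by (intro card_ge) auto
        ultimately show ?thesis using dist by simp
      next
        case 2
        then have "{e \<in> edges T. v \<in> e} = {{0, 1}, {1, 2}}" by (auto simp: T_def)
        moreover have "card {{0, 1}, {1, 2::nat}} = 2" by (auto simp: card_2_iff doubleton_eq_iff)
        moreover have "card {c} \<le> card {a \<in> leaves T. attach T a = v}"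
          using 2 P 3 unfolding T_def metric_tree.simps by (intro card_ge) auto
        ultimately show ?thesis using dist by simp
      next
        case 3
        then have "{e \<in> edges T. v \<in> e} = {{1, 2}}" by (auto simp: T_def)
        moreover have "card {d, e} \<le> card {a \<in> leaves T. attach T a = v}"
          using 3 P \<open>P a < P c\<close> \<open>P c < P d\<close> unfolding T_def metric_tree.simps by (intro card_ge) auto
        ultimately show ?thesis using dist by simp
      qed
    next
      have "{0, 1} \<in> {{u, v} | u v. u \<in> verts T \<and> v \<in> verts T \<and> u \<noteq> v}"
        by (intro CollectI exI[of _ 0] exI[of _ 1]) (simp add: T_def)
      moreover have "{1, 2} \<in> {{u, v} | u v. u \<in> verts T \<and> v \<in> verts T \<and> u \<noteq> v}"
        by (intro CollectI exI[of _ 1] exI[of _ 2]) (simp add: T_def)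
      moreover have "edges T = {{0, 1}, {1, 2}}" by (simp add: T_def)
      ultimately show "edges T \<subseteq> {{u, v} | u v. u \<in> verts T \<and> v \<in> verts T \<and> u \<noteq> v}" by simp
    qed (use 3 in \<open>auto simp: T_def\<close>)
    moreover have "leaf_dist T x y = \<bar>P x - P y\<bar>" if "x \<in> leaves T" "y \<in> leaves T" for x y
    proof -
      have "leaf_dist T x y = \<bar>pos (attach T x) - pos (attach T y)\<bar>"
        using line unfolding line_tree_def by (auto simp: T_def)
      moreover have "pos (attach T x) = P x" if "x \<in> leaves T" for x
        using that P 3 by (auto simp: T_def pos_def)
      ultimately show ?thesis using that by simp
    qed
    moreover have "leaves T = ?L" by (simp add: T_def)
    ultimately show ?thesis by blast
  qed
qed

section \<open>Trees from the four-point condition\<close>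

lemma pairs_of_five:
  assumes "\<And>x y. G x y \<Longrightarrow> G y x"
    and "G a b" "G a c" "G a d" "G a e" "G b c" "G b d" "G b e" "G c d" "G c e" "G d e"
  shows "\<forall>x\<in>{a, b, c, d, e}. \<forall>y\<in>{a, b, c, d, e}. x \<noteq> y \<longrightarrow> G x y"
  using assms by blast

text \<open>
  Adding a function of the single points to \<open>W\<close> (moving the leaf rays) makes \<open>W\<close> vanish on all pairs
  containing a fixed point \<open>e\<close>. The four-point condition then says that the resulting \<open>V\<close> is an
  ultrametric valuation on the other four points: in each triple the minimum is attained twice. A
  closest pair \<open>a, b\<close> has equal values to \<open>c\<close> and to \<open>d\<close>, and the triple \<open>a, c, d\<close> decides whether \<open>e\<close>
  sits between \<open>{a, b}\<close> and \<open>{c, d}\<close>, or \<open>c\<close> between \<open>{a, b}\<close> and \<open>{d, e}\<close> (after possibly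
  exchanging \<open>c\<close> and \<open>d\<close>).
\<close>

lemma four_point_caterpillar:
  fixes W :: "'l \<Rightarrow> 'l \<Rightarrow> real"
  assumes L: "card L = 5" and sym: "\<And>x y. W x y = W y x"
    and four: "\<And>x y z w. {x, y, z, w} \<subseteq> L \<Longrightarrow> distinct [x, y, z, w] \<Longrightarrow>
      W x y + W z w \<ge> min (W x z + W y w) (W x w + W y z)"
  shows "\<exists>a b c d e P f. L = {a, b, c, d, e} \<and> distinct [a, b, c, d, e] \<and>
    P a = P b \<and> P b \<le> P c \<and> P c \<le> P d \<and> P d = (P e :: real) \<and>
    (\<forall>x\<in>L. \<forall>y\<in>L. x \<noteq> y \<longrightarrow> W x y = f x + f y - \<bar>P x - P y\<bar> / 2)"
proof -
  have fin: "finite L" using L card.infinite by fastforce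
  obtain e where e: "e \<in> L" using L by fastforce
  define V where "V x y = W x y - W x e - W y e" for x y
  have Vsym: "V x y = V y x" for x y using sym by (simp add: V_def)
  have ultra: "V x y \<ge> min (V x z) (V y z)" if "{x, y, z} \<subseteq> L - {e}" "distinct [x, y, z]" for x y z
    using four[of x y z e] that e sym by (auto simp: V_def)
  \<comment> \<open>A closest pair among the four points other than \<open>e\<close> maximizes \<open>V\<close>.\<close>
  define R where "R = {(x, y). x \<in> L - {e} \<and> y \<in> L - {e} \<and> x \<noteq> y}"
  have cardLe: "card (L - {e}) = 4" using L e fin by simp
  have "R \<subseteq> L \<times> L" by (auto simp: R_def)
  then have "finite R" using fin finite_subset by blast
  moreover have "R \<noteq> {}"
  proof -
    have "\<not> card (L - {e}) \<le> 1" using cardLe by simp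
    then show ?thesis using fin by (force simp: R_def card_le_Suc0_iff_eq)
  qed
  ultimately have "Max ((\<lambda>xy. V (fst xy) (snd xy)) ` R) \<in> (\<lambda>xy. V (fst xy) (snd xy)) ` R" by simp
  then obtain ab where "ab \<in> R" "V (fst ab) (snd ab) = Max ((\<lambda>xy. V (fst xy) (snd xy)) ` R)" by auto
  then have ab: "ab \<in> R" "\<forall>xy\<in>R. V (fst xy) (snd xy) \<le> V (fst ab) (snd ab)"
    using \<open>finite R\<close> by auto
  obtain a b where "ab = (a, b)" by force
  then have a: "a \<in> L" "b \<in> L" "a \<noteq> e" "b \<noteq> e" "a \<noteq> b"
    and max: "\<And>x y. x \<in> L \<Longrightarrow> y \<in> L \<Longrightarrow> x \<noteq> e \<Longrightarrow> y \<noteq> e \<Longrightarrow> x \<noteq> y \<Longrightarrow> V x y \<le> V a b"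
    using ab by (auto simp: R_def)
  have "card (L - {e, a, b}) = 2" using L e a fin by (simp add: card_Diff_subset)
  then obtain c0 d0 where cd0: "L - {e, a, b} = {c0, d0}" "c0 \<noteq> d0" by (auto simp: card_2_iff)
  have "\<exists>c d. L - {e, a, b} = {c, d} \<and> c \<noteq> d \<and> V a d \<le> V a c"
  proof (cases "V a d0 \<le> V a c0")
    case True
    show ?thesis by (intro exI[of _ c0] exI[of _ d0] conjI) fact+
  next
    case False
    then have "V a c0 \<le> V a d0" by simp
    moreover have "L - {e, a, b} = {d0, c0}" using cd0(1) by (simp only: insert_commute)
    moreover have "d0 \<noteq> c0" using cd0(2) by simp
    ultimately show ?thesis by (intro exI[of _ d0] exI[of _ c0] conjI)
  qed
  then obtain c d where cd: "L - {e, a, b} = {c, d}" "c \<noteq> d" and le: "V a d \<le> V a c" by (elim exE conjE)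
  have Leq: "L = {a, b, c, d, e}" using cd(1) e a by blast
  have mem: "c \<in> L" "d \<in> L" "c \<noteq> e" "d \<noteq> e" "c \<noteq> a" "c \<noteq> b" "d \<noteq> a" "d \<noteq> b"
    using cd(1) by blast+
  have 1: "V a c = V b c" "V a d = V b d"
    using ultra[of a c b] ultra[of b c a] ultra[of a d b] ultra[of b d a]
      max[of a c] max[of b c] max[of a d] max[of b d] a mem Vsym by (auto simp: min_def split: if_splits)
  have 2: "V a c \<ge> min (V a d) (V c d)" "V a d \<ge> min (V a c) (V c d)" "V c d \<ge> min (V a c) (V a d)"
    using ultra[of a c d] ultra[of a d c] ultra[of c d a] a mem cd(2) Vsym by (auto simp: min.commute)
  have 3: "V a c \<le> V a b" "V a d \<le> V a b" "V c d \<le> V a b" using max a mem cd(2) by auto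
  have W: "W x y = V x y + W x e + W y e" for x y by (simp add: V_def)
  consider "V a c = V a d" "V a c \<le> V c d" | "V a d = V c d" "V a d \<le> V a c"
  proof (cases "V a c = V a d")
    case True
    then show thesis using 2(3) that(1) by simp
  next
    case False
    then have "V c d \<le> V a d" using 2(2) le by (auto simp: min_le_iff_disj)
    moreover have "V a d \<le> V c d" using 2(3) le by (simp add: min_absorb2)
    ultimately show thesis using that(2) le by simp
  qed
  then show ?thesis
  proof cases
    case A: 1
    define P where "P x = (if x = a \<or> x = b then 0 else if x = e then V a b - V a c else V a b - V a c + V c d - V a c)" for x
    define f where "f x = (if x = a \<or> x = b then V a b / 2 + W x e else if x = e then - V a c / 2 else V c d / 2 + W x e)" for x
    have vals: "P a = 0" "P b = 0" "P c = V a b - V a c + V c d - V a c" "P d = V a b - V a c + V c d - V a c" "P e = V a b - V a c"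
      "f a = V a b / 2 + W a e" "f b = V a b / 2 + W b e" "f c = V c d / 2 + W c e" "f d = V c d / 2 + W d e" "f e = - V a c / 2"
      using a mem cd(2) by (auto simp: P_def f_def)
    have "\<forall>x\<in>L. \<forall>y\<in>L. x \<noteq> y \<longrightarrow> W x y = f x + f y - \<bar>P x - P y\<bar> / 2"
      unfolding Leq
    proof (rule pairs_of_five)
      show "W x y = f x + f y - \<bar>P x - P y\<bar> / 2 \<Longrightarrow> W y x = f y + f x - \<bar>P y - P x\<bar> / 2" for x y
        using sym by (simp add: abs_minus_commute)
    qed (unfold vals W[of a b] W[of a c] W[of a d] W[of b c] W[of b d] W[of c d],
        insert 1 A 3, simp_all add: abs_if field_simps)
    moreover have "L = {a, b, e, c, d}" using Leq by auto
    moreover have "distinct [a, b, e, c, d]" using a mem cd(2) by auto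
    moreover have "P a = P b" "P b \<le> P e" "P e \<le> P c" "P c = P d"
      unfolding vals using A 3 by simp_all
    ultimately show ?thesis by blast
  next
    case B: 2
    define P where "P x = (if x = a \<or> x = b then 0 else if x = c then V a b - V a c else V a b - V a d)" for x
    define f where "f x = (if x = a \<or> x = b then V a b / 2 + W x e else if x = c then V a c / 2 + W x e
       else if x = d then V a d / 2 + W x e else - V a d / 2)" for x
    have vals: "P a = 0" "P b = 0" "P c = V a b - V a c" "P d = V a b - V a d" "P e = V a b - V a d"
      "f a = V a b / 2 + W a e" "f b = V a b / 2 + W b e" "f c = V a c / 2 + W c e" "f d = V a d / 2 + W d e" "f e = - V a d / 2"
      using a mem cd(2) by (auto simp: P_def f_def)
    have "\<forall>x\<in>L. \<forall>y\<in>L. x \<noteq> y \<longrightarrow> W x y = f x + f y - \<bar>P x - P y\<bar> / 2"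
      unfolding Leq
    proof (rule pairs_of_five)
      show "W x y = f x + f y - \<bar>P x - P y\<bar> / 2 \<Longrightarrow> W y x = f y + f x - \<bar>P y - P x\<bar> / 2" for x y
        using sym by (simp add: abs_minus_commute)
    qed (unfold vals W[of a b] W[of a c] W[of a d] W[of b c] W[of b d] W[of c d],
        insert 1 B 3, simp_all add: abs_if field_simps)
    moreover have "L = {a, b, c, d, e}" using Leq by auto
    moreover have "distinct [a, b, c, d, e]" using a mem cd(2) by auto
    moreover have "P a = P b" "P b \<le> P c" "P c \<le> P d" "P d = P e"
      unfolding vals using B 3 by simp_all
    ultimately show ?thesis by blast
  qed
qed

section \<open>Points, lines and the standard conic\<close>

definition dotp :: "'k::field^'n \<Rightarrow> 'k^'n \<Rightarrow> 'k" where
  "dotp l x = (\<Sum>a\<in>UNIV. l $ a * x $ a)"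

lemma on_line_dotp: "on_line l x \<longleftrightarrow> dotp l x = 0"
  by (simp add: on_line_def dotp_def)

lemma dotp_smult [simp]: "dotp (c *s l) x = c * dotp l x" "dotp l (c *s x) = c * dotp l x"
  by (simp_all add: dotp_def sum_distrib_left mult_ac)

lemma dotp_add: "dotp (l + l') x = dotp l x + dotp l' x" "dotp l (x + y) = dotp l x + dotp l y"
  "dotp (l - l') x = dotp l x - dotp l' x" "dotp l (x - y) = dotp l x - dotp l y"
  by (simp_all add: dotp_def sum.distrib sum_subtractf algebra_simps)

lemma dotp_zero [simp]: "dotp 0 x = 0" "dotp l 0 = 0" by (simp_all add: dotp_def)

lemma dotp_adjoint: "dotp (l v* M) x = dotp l (M *v x)"
proof -
  have "dotp (l v* M) x = (\<Sum>a\<in>UNIV. \<Sum>b\<in>UNIV. l $ b * M $ b $ a * x $ a)"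
    by (simp add: dotp_def vector_matrix_mult_def sum_distrib_right sum_distrib_left mult_ac)
  also have "\<dots> = (\<Sum>b\<in>UNIV. \<Sum>a\<in>UNIV. l $ b * M $ b $ a * x $ a)" by (rule sum.swap)
  also have "\<dots> = dotp l (M *v x)"
    by (simp add: dotp_def matrix_vector_mult_def sum_distrib_left mult_ac)
  finally show ?thesis .
qed

lemma vector_matrix_assoc: "(l v* M) v* N = l v* (M ** N)"
  for l :: "'k::field^'n" 
  by (metis matrix_transpose_mul matrix_vector_mul_assoc transpose_matrix_vector)

lemma dotp_proj_eq: "proj_eq l l' \<Longrightarrow> proj_eq x x' \<Longrightarrow> dotp l x = 0 \<longleftrightarrow> dotp l' x' = 0"
  by (auto simp: proj_eq_def)

lemma dotp_3: "dotp l x = l $ 1 * x $ 1 + l $ 2 * x $ 2 + l $ 3 * x $ 3" for l x :: "'k::field^3"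
  by (simp add: dotp_def sum_3)

definition cross :: "'k::field^3 \<Rightarrow> 'k^3 \<Rightarrow> 'k^3" where
  "cross x y = vector [x $ 2 * y $ 3 - x $ 3 * y $ 2, x $ 3 * y $ 1 - x $ 1 * y $ 3, x $ 1 * y $ 2 - x $ 2 * y $ 1]"

lemma cross_eq_0_iff:
  assumes "x \<noteq> 0" "y \<noteq> 0" shows "cross x y = 0 \<longleftrightarrow> proj_eq x y"
  unfolding proj_eq_iff_minors[OF assms] by (auto simp: cross_def vec_eq_iff forall_3 algebra_simps)

lemma cross_cross:
  "cross x (cross l m) = dotp m x *s l - dotp l x *s m"
  by (simp add: cross_def dotp_3 vec_eq_iff forall_3 algebra_simps)

text \<open>
  Both points are proportional to the cross product of the two lines, if these are distinct.
\<close>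

lemma unique_line:
  fixes x y l m :: "'k::field^3"
  assumes nz: "l \<noteq> 0" "m \<noteq> 0" "x \<noteq> 0" "y \<noteq> 0" and ne: "\<not> proj_eq x y"
    and "dotp l x = 0" "dotp l y = 0" "dotp m x = 0" "dotp m y = 0"
  shows "proj_eq l m"
proof (rule ccontr)
  assume n: "\<not> ?thesis"
  then have c: "cross l m \<noteq> 0" using cross_eq_0_iff nz by blast
  have "proj_eq x (cross l m)" "proj_eq y (cross l m)"
    using cross_cross[of x l m] cross_cross[of y l m] assms c cross_eq_0_iff[of x "cross l m"]
      cross_eq_0_iff[of y "cross l m"] by simp_all
  then show False using ne proj_eq_sym proj_eq_trans by blast
qed

text \<open>
  The conic is the Veronese image of the line. A line meeting it in the points with parameters \<open>s\<close>
  and \<open>t\<close> has the coordinates \<open>chord s t\<close>; this is the tangent if \<open>s = t\<close>.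
\<close>

definition veronese :: "'k::field^2^1 \<Rightarrow> 'k^3" where
  "veronese s = vector [s $ 1 $ 1 ^ 2, s $ 1 $ 1 * s $ 1 $ 2, s $ 1 $ 2 ^ 2]"

definition chord :: "'k::field^2^1 \<Rightarrow> 'k^2^1 \<Rightarrow> 'k^3" where
  "chord s t = vector [s $ 1 $ 2 * t $ 1 $ 2, - (s $ 1 $ 1 * t $ 1 $ 2 + s $ 1 $ 2 * t $ 1 $ 1), s $ 1 $ 1 * t $ 1 $ 1]"

lemma dotp_chord_veronese: "dotp (chord s t) (veronese r) = bracket s r * bracket t r"
  by (simp add: dotp_3 chord_def veronese_def bracket_def power2_eq_square algebra_simps)

lemma chord_commute: "chord s t = chord t s"
  by (simp add: chord_def vec_eq_iff forall_3 algebra_simps)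

lemma chord_linear: "chord r (scal a s + scal b t) = a *s chord r s + b *s chord r t"
  by (simp add: chord_def vec_eq_iff forall_3 algebra_simps)

lemma veronese_scal: "veronese (scal c s) = c\<^sup>2 *s veronese s"
  by (simp add: veronese_def vec_eq_iff forall_3 power2_eq_square)

lemma veronese_nonzero: "s \<in> P1 \<Longrightarrow> veronese s \<noteq> 0"
  by (auto simp: veronese_def vec_eq_iff forall_3 P1_iff)

lemma chord_nonzero: "s \<in> P1 \<Longrightarrow> t \<in> P1 \<Longrightarrow> chord s t \<noteq> 0"
  by (auto simp: chord_def vec_eq_iff forall_3 P1_iff)

lemma chord_of_incidence:
  assumes s: "s \<in> P1" and l: "dotp l (veronese s) = 0"
  shows "\<exists>t. l = chord s t"
proof (cases "s $ 1 $ 1 = 0")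
  case True
  then have s2: "s $ 1 $ 2 \<noteq> 0" using s by (simp add: P1_iff)
  then have "l $ 3 = 0" using l True by (simp add: dotp_3 veronese_def)
  then have "l = chord s (\<chi> i. vector [- l $ 2 / s $ 1 $ 2, l $ 1 / s $ 1 $ 2])"
    using True s2 by (simp add: chord_def vec_eq_iff forall_3)
  then show ?thesis by blast
next
  case False
  define t1 where "t1 = l $ 3 / s $ 1 $ 1"
  define t2 where "t2 = (- l $ 2 - s $ 1 $ 2 * t1) / s $ 1 $ 1"
  have t: "s $ 1 $ 1 * t1 = l $ 3" "s $ 1 $ 1 * t2 = - l $ 2 - s $ 1 $ 2 * t1"
    using False by (simp_all add: t1_def t2_def)
  have "l $ 1 * (s $ 1 $ 1)\<^sup>2 + l $ 2 * (s $ 1 $ 1 * s $ 1 $ 2) + l $ 3 * (s $ 1 $ 2)\<^sup>2 = 0"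
    using l by (simp add: dotp_3 veronese_def)
  then have "s $ 1 $ 1 ^ 2 * l $ 1 = s $ 1 $ 1 ^ 2 * (s $ 1 $ 2 * t2)" using t by algebra
  then have "l $ 1 = s $ 1 $ 2 * t2" using False by simp
  then have "l = chord s (\<chi> i. vector [t1, t2])"
    using t by (simp add: chord_def vec_eq_iff forall_3)
  then show ?thesis by blast
qed

lemma veronese_decompose:
  assumes "dotp (chord s t) x = 0"
  shows "(bracket s t)\<^sup>2 *s x = dotp (chord t t) x *s veronese s + dotp (chord s s) x *s veronese t"
proof -
  have "(bracket s t)\<^sup>2 *s x = dotp (chord t t) x *s veronese s + dotp (chord s s) x *s veronese t
     - dotp (chord s t) x *s vector [2 * s $ 1 $ 1 * t $ 1 $ 1, s $ 1 $ 1 * t $ 1 $ 2 + s $ 1 $ 2 * t $ 1 $ 1, 2 * s $ 1 $ 2 * t $ 1 $ 2]"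
    by (simp add: vec_eq_iff forall_3 bracket_def dotp_3 chord_def veronese_def power2_eq_square algebra_simps)
  then show ?thesis using assms by simp
qed

lemma veronese_of_conic:
  assumes "x \<noteq> 0" "x $ 2 ^ 2 = x $ 1 * x $ 3"
  shows "\<exists>s\<in>P1. proj_eq x (veronese s)"
proof (cases "x $ 1 = 0")
  case True
  then have "x $ 2 = 0" using assms(2) by simp
  then have 3: "x $ 3 \<noteq> 0" using assms(1) True by (auto simp: vec_eq_iff forall_3)
  let ?s = "(\<chi> i. vector [0, 1]) :: 'a^2^1"
  have "x = x $ 3 *s veronese ?s" using True \<open>x $ 2 = 0\<close> by (simp add: veronese_def vec_eq_iff forall_3)
  then have "proj_eq x (veronese ?s)" using 3 unfolding proj_eq_def by blast
  then show ?thesis by (intro bexI[of _ ?s]) (auto simp: P1_iff)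
next
  case False
  let ?s = "(\<chi> i. vector [x $ 1, x $ 2]) :: 'a^2^1"
  have "x = (1 / x $ 1) *s veronese ?s" using False assms(2)
    by (simp add: veronese_def vec_eq_iff forall_3 power2_eq_square field_simps)
  moreover have "1 / x $ 1 \<noteq> 0" using False by simp
  ultimately have "proj_eq x (veronese ?s)" unfolding proj_eq_def by blast
  then show ?thesis using False by (intro bexI[of _ ?s]) (auto simp: P1_iff)
qed

lemma chord_inverse_matrix:
  assumes s: "s \<in> P1"
  shows "\<exists>R :: 'k::field^3^2. \<forall>t. R *v chord s t = t $ 1"
proof (cases "s $ 1 $ 1 = 0")
  case True
  then have s2: "s $ 1 $ 2 \<noteq> 0" using s by (simp add: P1_iff)
  let ?R = "vector [vector [0, - 1 / s $ 1 $ 2, 0], vector [1 / s $ 1 $ 2, 0, 0]] :: 'k^3^2"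
  have "\<forall>t. ?R *v chord s t = t $ 1"
    using True s2 by (simp add: matrix_vector_mult_def chord_def vec_eq_iff forall_2 sum_3)
  then show ?thesis by blast
next
  case False
  let ?R = "vector [vector [0, 0, 1 / s $ 1 $ 1],
    vector [0, - 1 / s $ 1 $ 1, - s $ 1 $ 2 / s $ 1 $ 1 ^ 2]] :: 'k^3^2"
  have "\<forall>t. ?R *v chord s t = t $ 1"
    using False by (simp add: matrix_vector_mult_def chord_def vec_eq_iff forall_2 sum_3 field_simps power2_eq_square)
  then show ?thesis by blast
qed

text \<open>
  Dehomogenized, the binary quartic has five finite roots, or four of them and a vanishing
  leading coefficient, which is one too many for its degree.
\<close>

lemma quartic_five_roots:
  fixes c :: "nat \<Rightarrow> 'k::field" and q :: "5 \<Rightarrow> 'k^2^1"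
  assumes q: "\<And>i j. i \<noteq> j \<Longrightarrow> bracket (q i) (q j) \<noteq> 0"
    and root: "\<And>i. (\<Sum>n\<le>4. c n * q i $ 1 $ 1 ^ (4 - n) * q i $ 1 $ 2 ^ n) = 0"
    and n: "n \<le> 4"
  shows "c n = 0"
proof -
  define P where "P = (\<Sum>n\<le>4. monom (c n) n)"
  have cP: "coeff P n = c n" if "n \<le> 4" for n
    using that by (simp add: P_def coeff_sum if_distrib sum.delta' cong: if_cong)
  have degP: "degree P \<le> 4" unfolding P_def by (intro degree_sum_le) (auto intro: order_trans[OF degree_monom_le])
  define F where "F = {i. q i $ 1 $ 1 \<noteq> 0}"
  define r where "r i = q i $ 1 $ 2 / q i $ 1 $ 1" for i
  have inj: "inj_on r F"
    using q by (intro inj_onI) (force simp: r_def F_def bracket_def field_simps)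
  have roots: "poly P (r i) = 0" if "i \<in> F" for i
  proof -
    have z: "q i $ 1 $ 1 \<noteq> 0" using that by (simp add: F_def)
    have "q i $ 1 $ 1 ^ 4 * poly P (r i) = (\<Sum>n\<le>4. c n * q i $ 1 $ 1 ^ (4 - n) * q i $ 1 $ 2 ^ n)"
      unfolding P_def poly_sum sum_distrib_left
    proof (rule sum.cong)
      fix n assume "n \<in> {..4::nat}"
      then have "q i $ 1 $ 1 ^ 4 = q i $ 1 $ 1 ^ (4 - n) * q i $ 1 $ 1 ^ n" by (simp flip: power_add)
      then show "q i $ 1 $ 1 ^ 4 * poly (monom (c n) n) (r i) = c n * q i $ 1 $ 1 ^ (4 - n) * q i $ 1 $ 2 ^ n"
        using z by (simp add: poly_monom r_def power_divide)
    qed simp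
    then show ?thesis using root z by simp
  qed
  have "P = 0"
  proof (rule ccontr)
    assume P: "P \<noteq> 0"
    have "card F = card (r ` F)" using inj by (simp add: card_image)
    also have "\<dots> \<le> card {x. poly P x = 0}" using roots P poly_roots_finite by (intro card_mono) auto
    also have "\<dots> \<le> degree P" by (rule card_poly_roots_bound[OF P])
    finally have F: "card F \<le> degree P" .
    then have "F \<noteq> UNIV" using degP by auto
    then obtain i where i: "q i $ 1 $ 1 = 0" by (auto simp: F_def)
    have "- {i} \<subseteq> F" using q i by (force simp: F_def bracket_def)
    then have "card (- {i}) \<le> card F" by (intro card_mono) auto
    then have "4 \<le> card F" by (simp add: Compl_eq_Diff_UNIV)
    then have "degree P = 4" using F degP by simp
    then have "c 4 \<noteq> 0" using cP[of 4] P by (metis leading_coeff_0_iff order_refl)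
    moreover have "q i $ 1 $ 2 \<noteq> 0" using q[of i "i + 1"] i by (auto simp: bracket_def)
    moreover have "c 4 * q i $ 1 $ 2 ^ 4 = 0" using root[of i] i by (simp add: eval_nat_numeral atMost_Suc)
    ultimately show False by simp
  qed
  then show ?thesis using cP[OF n] by simp
qed

lemma five_elements:
  assumes "i \<noteq> (j :: 5)"
  obtains k l m where "distinct [i, j, k, l, m]" "UNIV = {i, j, k, l, m}"
proof -
  have "card (UNIV - {i, j}) = 3" using assms by (simp add: card_Diff_subset)
  then obtain k l m where klm: "UNIV - {i, j} = {k, l, m}" "distinct [k, l, m]" by (auto simp: card_3_iff)
  then have "UNIV = {i, j, k, l, m}" by blast
  moreover have "distinct [i, j, k, l, m]" using klm assms by (auto simp: set_eq_iff)
  ultimately show thesis using that by blast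
qed

section \<open>The surface in coordinates adapted to the conic\<close>

text \<open>
  Coordinates in which the five points lie on the standard conic, with parameters \<open>q i\<close>.
\<close>

locale conic_points =
  fixes p :: "5 \<Rightarrow> 'k::field_char_0^3" and A B :: "'k^3^3" and q :: "5 \<Rightarrow> 'k^2^1"
  assumes AB: "A ** B = mat 1" "B ** A = mat 1"
    and p: "\<And>i. proj_eq (p i) (A *v veronese (q i))"
    and q: "\<And>i j. i \<noteq> j \<Longrightarrow> bracket (q i) (q j) \<noteq> 0"
begin

definition pt :: "'k^2^1 \<Rightarrow> 'k^3" where "pt s = A *v veronese s"
definition line :: "'k^2^1 \<Rightarrow> 'k^2^1 \<Rightarrow> 'k^3" where "line s t = chord s t v* B"

lemma qP: "q i \<in> P1"
proof -
  have "i \<noteq> i + 1" by simp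
  from bracket_nonzero_P1(1)[OF q[OF this]] show ?thesis .
qed

lemma q_iff: "bracket (q i) (q j) = 0 \<longleftrightarrow> i = j" using q by auto

lemma q_two: "s \<in> P1 \<Longrightarrow> i \<noteq> j \<Longrightarrow> bracket s (q i) = 0 \<Longrightarrow> bracket s (q j) \<noteq> 0"
  using P1_eq_iff_bracket qP q mproj_eq_sym mproj_eq_trans by metis

lemma invA: "B *v (A *v x) = x" "A *v (B *v x) = x" "(l v* B) v* A = l" "(l v* A) v* B = l"
  using AB by (simp_all add: matrix_vector_mul_assoc vector_matrix_assoc)

lemma dotp_inv: "dotp (l v* B) (A *v x) = dotp l x"
  by (simp add: dotp_adjoint invA)

lemma dotp_line_pt: "dotp (line s t) (pt r) = bracket s r * bracket t r"
  by (simp add: line_def pt_def dotp_inv dotp_chord_veronese)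

lemma pt_nonzero: "s \<in> P1 \<Longrightarrow> pt s \<noteq> 0"
  unfolding pt_def using invA(1)[of "veronese s"] veronese_nonzero by (metis matrix_vector_mult_0_right)

lemma vec_mult_smult: "(c *s l) v* M = c *s (l v* M)" for l :: "'k^3" and M :: "'k^3^3"
  by (simp add: vector_matrix_mult_def vec_eq_iff sum_distrib_left mult_ac)

lemma vec_mult_add: "(l + m) v* M = l v* M + m v* M" for l :: "'k^3" and M :: "'k^3^3"
  by (simp add: vector_matrix_mult_def vec_eq_iff sum.distrib algebra_simps)

lemma vec_mult_zero: "0 v* M = 0" for M :: "'k^3^3"
  by (simp add: vector_matrix_mult_def vec_eq_iff)

lemma line_nonzero: "s \<in> P1 \<Longrightarrow> t \<in> P1 \<Longrightarrow> line s t \<noteq> 0"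
  unfolding line_def using invA(3)[of "chord s t"] chord_nonzero by (metis vec_mult_zero)

lemma line_commute: "line s t = line t s" by (simp add: line_def chord_commute)

lemma line_linear: "line r (scal a s + scal b t) = a *s line r s + b *s line r t"
  by (simp add: line_def chord_linear vec_mult_smult vec_mult_add)

lemma pt_scal: "pt (scal c s) = c\<^sup>2 *s pt s"
  by (simp add: pt_def veronese_scal vector_scalar_commute)

lemma scal0: "scal c s + scal 0 t = scal c s" "scal 0 s + scal c t = scal c t"
  by (simp_all add: scal_def vec_eq_iff)

lemma line_scal: "line r (scal c s) = c *s line r s"
  using line_linear[of r c s 0 s] by (simp add: scal0)

lemma pt_proj_eq: assumes "s \<in> P1" "t \<in> P1" shows "proj_eq (pt s) (pt t) \<longleftrightarrow> bracket s t = 0"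
proof
  assume "proj_eq (pt s) (pt t)"
  then obtain c where "c \<noteq> 0" "pt s = c *s pt t" by (auto simp: proj_eq_def)
  moreover have "dotp (line s s) (pt s) = 0" by (simp add: dotp_line_pt)
  ultimately have "dotp (line s s) (pt t) = 0" by simp
  then show "bracket s t = 0" by (simp add: dotp_line_pt)
next
  assume "bracket s t = 0"
  then obtain c where "c \<noteq> 0" "s = scal c t" using P1_eq_iff_bracket[OF assms] P1_eq_scal by blast
  then show "proj_eq (pt s) (pt t)" unfolding proj_eq_def by (intro exI[of _ "c\<^sup>2"]) (simp add: pt_scal)
qed

lemma line_inverse_matrix: "s \<in> P1 \<Longrightarrow> \<exists>R :: 'k^3^2. \<forall>t. R *v line s t = t $ 1"
proof -
  assume "s \<in> P1"
  then obtain R :: "'k^3^2" where R: "\<And>t. R *v chord s t = t $ 1" using chord_inverse_matrix by blast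
  have "(R ** transpose A) *v line s t = t $ 1" for t
    using R invA(3)[of "chord s t"] unfolding line_def by (simp flip: matrix_vector_mul_assoc)
  then show ?thesis by blast
qed

lemma line_proj_eq: assumes "r \<in> P1" "s \<in> P1" "t \<in> P1"
  shows "proj_eq (line r s) (line r t) \<longleftrightarrow> bracket s t = 0"
proof
  obtain R :: "'k^3^2" where R: "\<And>t. R *v line r t = t $ 1" using line_inverse_matrix[OF assms(1)] by blast
  assume "proj_eq (line r s) (line r t)"
  then obtain c where c: "c \<noteq> 0" "line r s = c *s line r t" by (auto simp: proj_eq_def)
  then have "s $ 1 = c *s t $ 1" using R[of s] R[of t] by (simp add: vector_scalar_commute)
  then show "bracket s t = 0" by (simp add: bracket_def)
next
  assume "bracket s t = 0"
  then obtain c where "c \<noteq> 0" "s = scal c t" using P1_eq_iff_bracket assms P1_eq_scal by blast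
  then show "proj_eq (line r s) (line r t)" unfolding proj_eq_def by (intro exI[of _ c]) (simp add: line_scal)
qed

lemma line_through_pt:
  assumes "s \<in> P1" "l \<noteq> 0" "dotp l (pt s) = 0" shows "\<exists>t\<in>P1. l = line s t"
proof -
  have "dotp (l v* A) (veronese s) = 0" using assms(3) by (simp add: dotp_adjoint pt_def)
  then obtain t where "l v* A = chord s t" using chord_of_incidence assms(1) by blast
  then have l: "l = line s t" using invA(4)[of l] by (simp add: line_def)
  have "t \<in> P1"
  proof (rule ccontr)
    assume "t \<notin> P1"
    then have "t = scal 0 t" by (intro P1_eqI) (auto simp: P1_iff)
    then have "l = 0" using l line_scal[of s 0 t] by simp
    then show False using assms by simp
  qed
  then show ?thesis using l by blast
qed

lemma pt_decompose:
  assumes "dotp (line s t) x = 0"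
  shows "(bracket s t)\<^sup>2 *s x = dotp (line t t) x *s pt s + dotp (line s s) x *s pt t"
proof -
  have d: "dotp (line u v) x = dotp (chord u v) (B *v x)" for u v by (simp add: line_def dotp_adjoint)
  have "(bracket s t)\<^sup>2 *s (B *v x) = dotp (line t t) x *s veronese s + dotp (line s s) x *s veronese t"
    using veronese_decompose[of s t "B *v x"] assms by (simp add: d)
  then have "A *v ((bracket s t)\<^sup>2 *s (B *v x)) = A *v (dotp (line t t) x *s veronese s + dotp (line s s) x *s veronese t)"
    by simp
  then show ?thesis
    by (simp add: vector_scalar_commute invA pt_def matrix_vector_right_distrib)
qed

lemma del_pezzo_iff:
  "z \<in> del_pezzo p \<longleftrightarrow> z \<in> mproj \<and>
     (\<forall>i. dotp (z $ Some i) (z $ None) = 0 \<and> dotp (z $ Some i) (pt (q i)) = 0)"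
  unfolding del_pezzo_def on_line_dotp pt_def using dotp_proj_eq[OF proj_eq_refl p] by auto

lemma del_pezzo_respects:
  assumes e: "mproj_eq z w" and w: "w \<in> del_pezzo p" shows "z \<in> del_pezzo p"
proof -
  have b: "proj_eq (z $ b) (w $ b)" for b using e by (simp add: mproj_eq_def)
  show ?thesis
    using w mproj_eq_mproj[OF e] dotp_proj_eq[OF b b] dotp_proj_eq[OF b proj_eq_refl]
    unfolding del_pezzo_iff by auto
qed

lemma proj_eq_p_iff: "proj_eq x (p i) \<longleftrightarrow> proj_eq x (pt (q i))"
  using p[of i] proj_eq_sym proj_eq_trans unfolding pt_def by blast

text \<open>
  Two distinct points lie on only one line, so the blow-up of \<open>p k\<close> changes nothing away from \<open>p k\<close>.
\<close>

lemma line_unique: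
  assumes "z \<in> del_pezzo p" "\<not> proj_eq (z $ None) (pt (q k))" "l \<noteq> 0"
    "dotp l (z $ None) = 0" "dotp l (pt (q k)) = 0"
  shows "proj_eq (z $ Some k) l"
  using assms unfolding del_pezzo_iff mproj_def
  by (intro unique_line[of _ _ "z $ None" "pt (q k)"]) (auto simp: pt_nonzero qP)

lemma pt_component_mform: "(\<lambda>s. pt s $ b) \<in> mform (\<lambda>_. 2)"
proof -
  have v: "(\<lambda>s. veronese s $ b) \<in> polyfun" for b
    unfolding veronese_def using exhaust_3[of b] by (auto simp: power2_eq_square intro!: polyfun_intros)
  have "(\<lambda>s. pt s $ b) \<in> polyfun"
    unfolding pt_def matrix_vector_mult_def by (auto intro!: polyfun_sum polyfun_intros v)
  then show ?thesis unfolding mform_P1 scal_def[symmetric] by (simp add: pt_scal)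
qed

lemma line_component_mform: "(\<lambda>s. line r s $ b) \<in> mform (\<lambda>_. 1)"
proof -
  have v: "(\<lambda>s. chord r s $ b) \<in> polyfun" for b
    unfolding chord_def using exhaust_3[of b] by (auto intro!: polyfun_intros)
  have "(\<lambda>s. line r s $ b) \<in> polyfun"
    unfolding line_def vector_matrix_mult_def by (auto intro!: polyfun_sum polyfun_intros v)
  then show ?thesis unfolding mform_P1 scal_def[symmetric] by (simp add: line_scal)
qed

lemma block_linear_mform:
  fixes R :: "'k^3^2"
  shows "(\<lambda>z. (\<chi> i::1. R *v (z $ j)) $ i $ b) \<in> mform (\<lambda>i. if i = j then 1 else 0)"
  unfolding matrix_vector_mult_def
  by (auto intro!: mform_sum mform_cmult mform_coord)

section \<open>Exceptional curves\<close>

definition exc_param :: "5 \<Rightarrow> 'k^2^1 \<Rightarrow> 'k^3^(5 option)" where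
  "exc_param i s = (\<chi> b. case b of None \<Rightarrow> pt (q i) | Some k \<Rightarrow> if k = i then line (q i) s else line (q k) (q i))"

lemma exc_nth: "exc_param i s $ None = pt (q i)" "exc_param i s $ Some i = line (q i) s"
  "k \<noteq> i \<Longrightarrow> exc_param i s $ Some k = line (q k) (q i)"
  by (simp_all add: exc_param_def)

lemma exc_mproj: assumes "s \<in> P1" shows "exc_param i s \<in> mproj"
proof -
  have "exc_param i s $ b \<noteq> 0" for b
    using pt_nonzero line_nonzero[OF qP qP] line_nonzero[OF qP assms] qP by (auto simp: exc_param_def split: option.split)
  then show ?thesis by (simp add: mproj_def)
qed

lemma exc_del_pezzo: "s \<in> P1 \<Longrightarrow> exc_param i s \<in> del_pezzo p"
  unfolding del_pezzo_iff using exc_mproj by (auto simp: exc_param_def dotp_line_pt)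

text \<open>
  A point over \<open>p i\<close> is determined by a line through \<open>p i\<close>, and this line by its other intersection with
  the conic.
\<close>

lemma exc_curve: "\<exists>g. curve_param (exceptional_curve p i) (exc_param i) g"
proof -
  obtain R :: "'k^3^2" where R: "\<And>t. R *v line (q i) t = t $ 1" using line_inverse_matrix[OF qP] by blast
  define g :: "'k^3^(5 option) \<Rightarrow> 'k^2^1" where "g z = (\<chi> _. R *v (z $ Some i))" for z
  have 1: "z \<in> exceptional_curve p i \<longleftrightarrow> (\<exists>s\<in>P1. mproj_eq z (exc_param i s))" for z
  proof
    assume "z \<in> exceptional_curve p i"
    then have z: "z \<in> del_pezzo p" "proj_eq (z $ None) (pt (q i))"
      by (auto simp: exceptional_curve_def proj_eq_p_iff)
    then have "z $ Some i \<noteq> 0" "dotp (z $ Some i) (pt (q i)) = 0" by (auto simp: del_pezzo_iff mproj_def)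
    then obtain s where s: "s \<in> P1" "z $ Some i = line (q i) s" using line_through_pt qP by blast
    have "proj_eq (z $ Some k) (line (q k) (q i))" if "k \<noteq> i" for k
    proof (rule line_unique[OF z(1)])
      show "\<not> proj_eq (z $ None) (pt (q k))"
        using z(2) that pt_proj_eq[OF qP qP] q proj_eq_sym proj_eq_trans by metis
      show "line (q k) (q i) \<noteq> 0" using line_nonzero qP by blast
      show "dotp (line (q k) (q i)) (z $ None) = 0"
        using dotp_proj_eq[OF proj_eq_refl z(2)] by (simp add: dotp_line_pt)
    qed (simp add: dotp_line_pt)
    then have "proj_eq (z $ b) (exc_param i s $ b)" for b
      using z(2) s(2) by (cases b) (auto simp: exc_param_def)
    then show "\<exists>s\<in>P1. mproj_eq z (exc_param i s)" using s(1) unfolding mproj_eq_def by blast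
  next
    assume "\<exists>s\<in>P1. mproj_eq z (exc_param i s)"
    then obtain s where s: "s \<in> P1" "mproj_eq z (exc_param i s)" by blast
    then have "proj_eq (z $ None) (pt (q i))" unfolding mproj_eq_def by (metis exc_nth(1))
    then show "z \<in> exceptional_curve p i"
      using del_pezzo_respects[OF s(2) exc_del_pezzo[OF s(1)]]
      by (simp add: exceptional_curve_def proj_eq_p_iff)
  qed
  have 2: "g (exc_param i s) = s" for s by (simp add: g_def exc_nth R vec_eq_iff)
  have 3: "\<exists>d. \<forall>b. (\<lambda>s. exc_param i s $ j $ b) \<in> mform d" for j
  proof (cases j)
    case None
    then show ?thesis by (auto simp: exc_nth intro!: exI[of _ "\<lambda>_. 0"] mform_const)
  next
    case (Some k)
    show ?thesis
    proof (cases "k = i")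
      case True
      then show ?thesis using Some line_component_mform by (auto simp: exc_nth)
    next
      case False
      then show ?thesis using Some by (auto simp: exc_nth intro!: exI[of _ "\<lambda>_. 0"] mform_const)
    qed
  qed
  have 4: "\<exists>d. \<forall>b. (\<lambda>z. g z $ j $ b) \<in> mform d" for j
    unfolding g_def using block_linear_mform[of R "Some i" j] by blast
  show ?thesis unfolding curve_param_def
    by (intro exI[of _ g] conjI) (use 1 2 3 4 exc_mproj in auto)
qed

section \<open>The conic through the five points\<close>

definition conic_param :: "'k^2^1 \<Rightarrow> 'k^3^(5 option)" where
  "conic_param s = (\<chi> b. case b of None \<Rightarrow> pt s | Some k \<Rightarrow> line (q k) s)"

lemma conic_nth: "conic_param s $ None = pt s" "conic_param s $ Some k = line (q k) s"
  by (simp_all add: conic_param_def)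

lemma conic_mproj: assumes "s \<in> P1" shows "conic_param s \<in> mproj"
proof -
  have "conic_param s $ b \<noteq> 0" for b
    using pt_nonzero[OF assms] line_nonzero[OF qP assms] by (auto simp: conic_param_def split: option.split)
  then show ?thesis by (simp add: mproj_def)
qed

lemma conic_del_pezzo: "s \<in> P1 \<Longrightarrow> conic_param s \<in> del_pezzo p"
  unfolding del_pezzo_iff using conic_mproj by (auto simp: conic_param_def dotp_line_pt)

lemma matrix_mul_zero: "0 ** M = 0" "M ** 0 = 0" for M :: "'k^3^3"
  by (simp_all add: matrix_matrix_mult_def vec_eq_iff)

lemma symmetric_nth: "transpose Q = Q \<Longrightarrow> Q $ a $ b = Q $ b $ a"
  by (drule arg_cong[where f = "\<lambda>M. M $ b $ a"]) (simp add: transpose_def)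

lemma quadric_veronese:
  fixes Q :: "'k^3^3"
  assumes "transpose Q = Q"
  shows "dotp (veronese s) (Q *v veronese s) =
    (\<Sum>n\<le>4. (if n = 0 then Q $ 1 $ 1 else if n = 1 then 2 * Q $ 1 $ 2 else if n = 2 then 2 * Q $ 1 $ 3 + Q $ 2 $ 2
       else if n = 3 then 2 * Q $ 2 $ 3 else Q $ 3 $ 3) * s $ 1 $ 1 ^ (4 - n) * s $ 1 $ 2 ^ n)"
proof -
  have "Q $ 2 $ 1 = Q $ 1 $ 2" "Q $ 3 $ 1 = Q $ 1 $ 3" "Q $ 3 $ 2 = Q $ 2 $ 3"
    by (rule symmetric_nth[OF assms])+
  then show ?thesis
    by (simp add: dotp_3 matrix_vector_mult_def sum_3 veronese_def eval_nat_numeral algebra_simps)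
qed

text \<open>
  A quadric through the five points restricts to zero on the conic, so it is a multiple of the
  equation of the conic.
\<close>

lemma conic_through_iff: "x \<in> conic_through p \<longleftrightarrow> (\<exists>s\<in>P1. proj_eq x (pt s))"
proof -
  have quad: "(\<Sum>a\<in>UNIV. \<Sum>b\<in>UNIV. Q $ a $ b * y $ a * y $ b) = dotp y (Q *v y)" for Q :: "'k^3^3" and y
    by (simp add: dotp_def matrix_vector_mult_def sum_distrib_left mult_ac)
  have scale: "dotp (c *s y) (Q *v (c *s y)) = c\<^sup>2 * dotp y (Q *v y)" for Q :: "'k^3^3" and y c
    by (simp add: vector_scalar_commute power2_eq_square)
  have zero: "dotp y (Q *v y) = 0 \<longleftrightarrow> dotp w (Q *v w) = 0" if "proj_eq y w" for Q :: "'k^3^3" and y w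
    using that scale by (auto simp: proj_eq_def)
  have trans: "dotp (A *v y) (Q *v (A *v y)) = dotp y ((transpose A ** Q ** A) *v y)" for Q y
  proof -
    have "dotp y ((transpose A ** Q ** A) *v y) = dotp y (transpose A *v (Q *v (A *v y)))"
      by (simp add: matrix_vector_mul_assoc matrix_mul_assoc)
    also have "\<dots> = dotp (y v* transpose A) (Q *v (A *v y))" by (rule dotp_adjoint[symmetric])
    also have "y v* transpose A = A *v y" by (metis transpose_matrix_vector transpose_transpose)
    finally show ?thesis by simp
  qed
  show ?thesis
  proof
    assume "x \<in> conic_through p"
    then obtain Q :: "'k^3^3" where x: "x \<noteq> 0" and Q: "Q \<noteq> 0" "transpose Q = Q"
      "dotp x (Q *v x) = 0" "\<And>i. dotp (p i) (Q *v p i) = 0"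
      unfolding conic_through_def quad by auto
    define Q' where "Q' = transpose A ** Q ** A"
    have sym: "transpose Q' = Q'" unfolding Q'_def by (simp add: matrix_transpose_mul Q(2) matrix_mul_assoc)
    have s: "Q' $ 2 $ 1 = Q' $ 1 $ 2" "Q' $ 3 $ 1 = Q' $ 1 $ 3" "Q' $ 3 $ 2 = Q' $ 2 $ 3"
      by (rule symmetric_nth[OF sym])+
    have "Q = transpose B ** Q' ** B"
    proof -
      have "transpose B ** Q' ** B = (transpose B ** transpose A) ** Q ** (A ** B)"
        unfolding Q'_def by (simp add: matrix_mul_assoc)
      also have "transpose B ** transpose A = mat 1" using AB by (metis matrix_transpose_mul transpose_mat)
      finally show ?thesis using AB by simp
    qed
    then have Q'nz: "Q' \<noteq> 0" using Q(1) by (metis matrix_mul_zero)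
    have "dotp (veronese (q i)) (Q' *v veronese (q i)) = 0" for i
      using zero[OF p[of i], of Q] Q(4)[of i] trans[of "veronese (q i)" Q] by (simp add: Q'_def)
    note c = quartic_five_roots[where c = "\<lambda>n. if n = 0 then Q' $ 1 $ 1 else if n = 1 then 2 * Q' $ 1 $ 2
      else if n = 2 then 2 * Q' $ 1 $ 3 + Q' $ 2 $ 2 else if n = 3 then 2 * Q' $ 2 $ 3 else Q' $ 3 $ 3",
      OF q this[unfolded quadric_veronese[OF sym]]]
    have c': "Q' $ 1 $ 1 = 0" "Q' $ 1 $ 2 = 0" "2 * Q' $ 1 $ 3 + Q' $ 2 $ 2 = 0" "Q' $ 2 $ 3 = 0" "Q' $ 3 $ 3 = 0"
      using c[where n = 0] c[where n = 1] c[where n = 2] c[where n = 3] c[where n = 4] by simp_all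
    define w where "w = B *v x"
    have xw: "x = A *v w" by (simp add: w_def invA)
    then have "w \<noteq> 0" using x by auto
    have "dotp w (Q' *v w) = 0" using Q(3) trans[of w Q] by (simp add: Q'_def xw)
    moreover have "dotp w (Q' *v w) = 2 * Q' $ 1 $ 3 * (w $ 1 * w $ 3 - (w $ 2)\<^sup>2)"
    proof -
      have "Q' $ 2 $ 2 = - (2 * Q' $ 1 $ 3)" using c'(3) by (simp add: eq_neg_iff_add_eq_0 add.commute)
      then show ?thesis
        using c' s by (simp add: dotp_3 matrix_vector_mult_def sum_3 power2_eq_square algebra_simps)
    qed
    moreover have "Q' $ 1 $ 3 \<noteq> 0"
    proof
      assume "Q' $ 1 $ 3 = 0"
      then have "Q' = 0" using c' s by (simp add: vec_eq_iff forall_3)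
      then show False using Q'nz by simp
    qed
    ultimately have "(w $ 2)\<^sup>2 = w $ 1 * w $ 3" by simp
    then obtain t where "t \<in> P1" "proj_eq w (veronese t)" using veronese_of_conic \<open>w \<noteq> 0\<close> by blast
    then show "\<exists>s\<in>P1. proj_eq x (pt s)"
      unfolding proj_eq_def xw pt_def by (metis vector_scalar_commute)
  next
    assume "\<exists>s\<in>P1. proj_eq x (pt s)"
    then obtain s where s: "s \<in> P1" "proj_eq x (pt s)" by blast
    \<comment> \<open>Twice \<open>x1 x3 - x2^2\<close>, transported to the given plane.\<close>
    define Q0 :: "'k^3^3" where "Q0 = vector [vector [0, 0, 1], vector [0, - 2, 0], vector [1, 0, 0]]"
    define Q where "Q = transpose B ** Q0 ** B"
    have Q0: "dotp (veronese t) (Q0 *v veronese t) = 0" for t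
      by (simp add: Q0_def dotp_3 matrix_vector_mult_def sum_3 veronese_def power2_eq_square algebra_simps)
    have QA: "transpose A ** Q ** A = Q0"
    proof -
      have "transpose A ** Q ** A = (transpose A ** transpose B) ** Q0 ** (B ** A)"
        unfolding Q_def by (simp add: matrix_mul_assoc)
      also have "transpose A ** transpose B = mat 1" using AB by (metis matrix_transpose_mul transpose_mat)
      finally show ?thesis using AB by simp
    qed
    have "Q0 $ 1 $ 3 \<noteq> 0" by (simp add: Q0_def)
    then have "Q0 \<noteq> 0" by auto
    then have "Q \<noteq> 0" using QA by (metis matrix_mul_zero)
    moreover have "transpose Q0 = Q0" by (simp add: Q0_def transpose_def vec_eq_iff forall_3)
    then have "transpose Q = Q" unfolding Q_def by (simp add: matrix_transpose_mul matrix_mul_assoc)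
    moreover have van: "dotp (pt t) (Q *v pt t) = 0" for t
      using trans[of "veronese t" Q] Q0 by (simp add: pt_def QA)
    then have "dotp y (Q *v y) = 0" if "y \<in> insert x (range p)" for y
      using that zero[OF s(2)] zero[OF p, folded pt_def] by auto
    moreover have "x \<noteq> 0" using s pt_nonzero proj_eq_nonzero by blast
    ultimately show "x \<in> conic_through p" unfolding conic_through_def quad by blast
  qed
qed

text \<open>
  On the strict transform, \<open>z $ Some k\<close> is the line from \<open>p k\<close> to the point of the conic. It remains
  meaningful at \<open>p k\<close>, where it is the tangent, so one of these lines suffices to recover the parameter.
\<close>

lemma conic_curve: "\<exists>g. curve_param (strict_transform p (conic_through p)) conic_param g"
proof -
  obtain R :: "'k^3^2" where R: "\<And>t. R *v line (q 0) t = t $ 1" using line_inverse_matrix[OF qP] by blast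
  define g :: "'k^3^(5 option) \<Rightarrow> 'k^2^1" where "g z = (\<chi> _. R *v (z $ Some 0))" for z
  define C where "C = {z. \<exists>s\<in>P1. mproj_eq z (conic_param s)}"
  have 2: "g (conic_param s) = s" for s by (simp add: g_def conic_nth R vec_eq_iff)
  have 3: "\<exists>d. \<forall>b. (\<lambda>s. conic_param s $ j $ b) \<in> mform d" for j
    using pt_component_mform line_component_mform by (cases j) (auto simp: conic_nth)
  have 4: "\<exists>d. \<forall>b. (\<lambda>z. g z $ j $ b) \<in> mform d" for j
    unfolding g_def using block_linear_mform[of R "Some 0" j] by blast
  have c: "curve_param C conic_param g" unfolding curve_param_def C_def
    by (intro conjI) (use 2 3 4 conic_mproj in auto)
  define S where "S = {z \<in> del_pezzo p. z $ None \<in> conic_through p \<and> (\<forall>i. \<not> proj_eq (z $ None) (p i))}"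
  have bp: "(\<lambda>s. bracket (q i) s) \<in> polyfun" for i by (intro polyfun_bracket polyfun_intros)
  obtain w0 where w0: "(\<Prod>i\<in>UNIV. bracket (q i) w0) \<noteq> 0"
    using polyfun_prod_nonzero[of UNIV "\<lambda>i. bracket (q i)"] bp bracket_nonzero_exists[OF qP] by auto
  have "zariski_closure S = C"
  proof (rule zariski_closure_param[where b = "\<lambda>s. \<Prod>i\<in>UNIV. bracket (q i) s" and ?w0.0 = w0, OF c _ w0])
    show "(\<lambda>s. \<Prod>i\<in>UNIV. bracket (q i) s) \<in> polyfun" by (intro polyfun_prod bp) auto
    show "S \<subseteq> C"
    proof
      fix z assume "z \<in> S"
      then obtain s where z: "z \<in> del_pezzo p" "s \<in> P1" "proj_eq (z $ None) (pt s)"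
        "\<And>i. \<not> proj_eq (z $ None) (pt (q i))"
        unfolding S_def by (auto simp: conic_through_iff proj_eq_p_iff)
      have "proj_eq (z $ Some k) (line (q k) s)" for k
        using dotp_proj_eq[OF proj_eq_refl z(3)]
        by (intro line_unique[OF z(1)] z(4) line_nonzero qP z(2)) (simp_all add: dotp_line_pt)
      then have "proj_eq (z $ b) (conic_param s $ b)" for b using z(3) by (cases b) (auto simp: conic_nth)
      then show "z \<in> C" unfolding C_def mproj_eq_def using z(2) by blast
    qed
    show "conic_param s \<in> S" if "s \<in> P1" "(\<Prod>i\<in>UNIV. bracket (q i) s) \<noteq> 0" for s
      using that conic_del_pezzo[OF that(1)] pt_proj_eq[OF that(1) qP] bracket_swap[of s]
      by (auto simp: S_def conic_nth conic_through_iff proj_eq_p_iff intro: bexI[of _ s])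
    show "(\<lambda>z. dotp (z $ Some 0) (pt (q 0))) \<in> mform (\<lambda>j. if j = Some 0 then 1 else 0)"
      unfolding dotp_def by (intro mform_sum mform_multc mform_coord) auto
    show "dotp (z $ Some 0) (pt (q 0)) = 0" if "z \<in> C" for z
      using that conic_del_pezzo del_pezzo_respects unfolding C_def del_pezzo_iff by blast
    show "g z \<in> P1" if z: "z \<in> mproj" "dotp (z $ Some 0) (pt (q 0)) = 0" for z
    proof -
      have "z $ Some 0 \<noteq> 0" using z by (simp add: mproj_def)
      then obtain t where "t \<in> P1" "z $ Some 0 = line (q 0) t" using line_through_pt[OF qP _ z(2)] by blast
      then show ?thesis using R by (simp add: g_def mproj_def)
    qed
  qed
  then show ?thesis using c unfolding strict_transform_def S_def by auto
qed

section \<open>Lines through two of the points\<close>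

definition weight :: "5 \<Rightarrow> 5 set \<Rightarrow> 'k" where
  "weight j I = (\<Prod>m\<in>UNIV - I. bracket (q j) (q m))"

lemma weight_nonzero: "j \<in> I \<Longrightarrow> weight j I \<noteq> 0"
  unfolding weight_def using q by (auto simp: q_iff)

lemma weight_insert: "k \<notin> I \<Longrightarrow> weight j I = bracket (q j) (q k) * weight j (insert k I)"
proof -
  assume "k \<notin> I"
  then have "UNIV - I = insert k (UNIV - insert k I)" by auto
  then show ?thesis unfolding weight_def by (metis Diff_iff finite finite_Diff insertI1 prod.insert)
qed

text \<open>
  The scalars are chosen such that the parameter \<open>q m\<close> gives the intersection with the line through
  the other two points \<open>p k\<close> and \<open>p l\<close>, for each of the three \<open>m \<notin> {i, j}\<close>, while \<open>q j\<close> gives \<open>p i\<close>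
  and \<open>q i\<close> gives \<open>p j\<close>.
\<close>

definition lin_pt :: "5 \<Rightarrow> 5 \<Rightarrow> 'k^2^1 \<Rightarrow> 'k^3" where
  "lin_pt i j s = (weight j {i, j} * bracket (q i) s) *s pt (q i) - (weight i {i, j} * bracket (q j) s) *s pt (q j)"

text \<open>
  The parameter on the conic of the line from \<open>p k\<close> to \<open>lin_pt i j s\<close>. As a function of \<open>s\<close> it is the
  projectivity of the line exchanging \<open>q i\<close> with \<open>q j\<close> and the remaining two parameters \<open>q l\<close> and \<open>q m\<close>.
\<close>

definition lin_pencil :: "5 \<Rightarrow> 5 \<Rightarrow> 5 \<Rightarrow> 'k^2^1 \<Rightarrow> 'k^2^1" where
  "lin_pencil i j k s = scal (weight j {i, j, k} * bracket (q i) s) (q i) + scal (- weight i {i, j, k} * bracket (q j) s) (q j)"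

definition lin_param :: "5 \<Rightarrow> 5 \<Rightarrow> 'k^2^1 \<Rightarrow> 'k^3^(5 option)" where
  "lin_param i j s = (\<chi> b. case b of None \<Rightarrow> lin_pt i j s
     | Some k \<Rightarrow> if k = i \<or> k = j then line (q i) (q j) else line (q k) (lin_pencil i j k s))"

lemma lin_nth: "lin_param i j s $ None = lin_pt i j s" "lin_param i j s $ Some i = line (q i) (q j)"
  "lin_param i j s $ Some j = line (q i) (q j)"
  "k \<noteq> i \<Longrightarrow> k \<noteq> j \<Longrightarrow> lin_param i j s $ Some k = line (q k) (lin_pencil i j k s)"
  by (simp_all add: lin_param_def)

lemma dotp_line_lin_pt: "dotp (line r t) (lin_pt i j s) =
    weight j {i, j} * bracket (q i) s * (bracket r (q i) * bracket t (q i))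
    - weight i {i, j} * bracket (q j) s * (bracket r (q j) * bracket t (q j))"
  by (simp add: lin_pt_def dotp_add dotp_line_pt)

lemma dotp_line_lin_pt_self: "dotp (line (q i) (q j)) (lin_pt i j s) = 0"
  by (simp add: dotp_line_lin_pt)

lemma incidence_lin_pencil:
  assumes "k \<noteq> i" "k \<noteq> j"
  shows "dotp (line (q k) (lin_pencil i j k s)) (lin_pt i j s) = 0"
proof -
  have w: "weight j {i, j} = bracket (q j) (q k) * weight j {i, j, k}"
    "weight i {i, j} = bracket (q i) (q k) * weight i {i, j, k}"
    using weight_insert[of k "{i, j}"] assms by (auto simp: insert_commute)
  show ?thesis unfolding dotp_line_lin_pt w lin_pencil_def bracket_add bracket_scal
    by (simp add: bracket_swap[of "q k"] bracket_swap[of "q j" "q i"] algebra_simps)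
qed

context
  fixes i j :: 5 assumes ij: "i \<noteq> j"
begin

lemma two_brackets: "s \<in> P1 \<Longrightarrow> bracket (q i) s \<noteq> 0 \<or> bracket (q j) s \<noteq> 0"
  using q_two[of s i j] ij bracket_swap[of s] by auto

lemma lin_pt_nonzero: assumes "s \<in> P1" shows "lin_pt i j s \<noteq> 0"
proof
  assume "lin_pt i j s = 0"
  then have "dotp (line (q i) (q i)) (lin_pt i j s) = 0" "dotp (line (q j) (q j)) (lin_pt i j s) = 0" by simp_all
  then have "bracket (q i) s = 0" "bracket (q j) s = 0"
    using weight_nonzero ij q unfolding dotp_line_lin_pt by auto
  then show False using two_brackets[OF assms] by simp
qed

lemma lin_pencil_P1: assumes "s \<in> P1" shows "lin_pencil i j k s \<in> P1"
proof -
  have "bracket (lin_pencil i j k s) (q j) \<noteq> 0 \<or> bracket (lin_pencil i j k s) (q i) \<noteq> 0"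
    using two_brackets[OF assms] weight_nonzero[of j "{i, j, k}"] weight_nonzero[of i "{i, j, k}"] ij q[OF ij] q[OF ij[symmetric]]
    by (auto simp: lin_pencil_def bracket_add)
  then show ?thesis using bracket_nonzero_P1 by blast
qed

lemma lin_mproj: assumes "s \<in> P1" shows "lin_param i j s \<in> mproj"
proof -
  have "lin_param i j s $ b \<noteq> 0" for b
    using lin_pt_nonzero[OF assms] line_nonzero[OF qP qP] line_nonzero[OF qP lin_pencil_P1[OF assms]]
    by (auto simp: lin_param_def split: option.split)
  then show ?thesis by (simp add: mproj_def)
qed

lemma lin_del_pezzo: "s \<in> P1 \<Longrightarrow> lin_param i j s \<in> del_pezzo p"
  unfolding del_pezzo_iff using lin_mproj
  by (auto simp: lin_param_def dotp_line_pt dotp_line_lin_pt_self incidence_lin_pencil)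

lemma lin_pt_meets_pt:
  assumes s: "s \<in> P1"
  shows "proj_eq (lin_pt i j s) (pt (q k)) \<longleftrightarrow> k = i \<and> bracket (q j) s = 0 \<or> k = j \<and> bracket (q i) s = 0"
proof
  assume e: "proj_eq (lin_pt i j s) (pt (q k))"
  have "dotp (line (q i) (q j)) (pt (q k)) = 0"
    using dotp_proj_eq[OF proj_eq_refl e] dotp_line_lin_pt_self by blast
  then consider "k = i" | "k = j" by (auto simp: dotp_line_pt q_iff)
  then show "k = i \<and> bracket (q j) s = 0 \<or> k = j \<and> bracket (q i) s = 0"
  proof cases
    case 1
    then have "dotp (line (q i) (q i)) (lin_pt i j s) = 0"
      using dotp_proj_eq[OF proj_eq_refl e] by (simp add: dotp_line_pt)
    then show ?thesis using 1 ij weight_nonzero[of i "{i, j}"] q[OF ij] by (auto simp: dotp_line_lin_pt)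
  next
    case 2
    then have "dotp (line (q j) (q j)) (lin_pt i j s) = 0"
      using dotp_proj_eq[OF proj_eq_refl e] by (simp add: dotp_line_pt)
    then show ?thesis using 2 ij weight_nonzero[of j "{i, j}"] q[OF ij[symmetric]] by (auto simp: dotp_line_lin_pt)
  qed
next
  assume k: "k = i \<and> bracket (q j) s = 0 \<or> k = j \<and> bracket (q i) s = 0"
  show "proj_eq (lin_pt i j s) (pt (q k))"
  proof (cases "bracket (q j) s = 0")
    case True
    then have "bracket (q i) s \<noteq> 0" using two_brackets[OF s] by simp
    then have "k = i" using k by simp
    then show ?thesis unfolding proj_eq_def lin_pt_def using True \<open>bracket (q i) s \<noteq> 0\<close> weight_nonzero[of j "{i, j}"]
      by (intro exI[of _ "weight j {i, j} * bracket (q i) s"]) auto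
  next
    case False
    then have "k = j" "bracket (q i) s = 0" using k by auto
    then show ?thesis unfolding proj_eq_def lin_pt_def using False weight_nonzero[of i "{i, j}"]
      by (intro exI[of _ "- weight i {i, j} * bracket (q j) s"]) auto
  qed
qed

lemma line_through_iff: "x \<in> line_through (p i) (p j) \<longleftrightarrow> x \<noteq> 0 \<and> dotp (line (q i) (q j)) x = 0"
proof -
  obtain c d where c: "c \<noteq> 0" "p i = c *s pt (q i)" and d: "d \<noteq> 0" "p j = d *s pt (q j)"
    using p unfolding pt_def proj_eq_def by meson
  have "x \<in> vec.span {p i, p j} \<longleftrightarrow> (\<exists>a b. x = a *s p i + b *s p j)"
    by (simp add: vec.span_insert vec.span_singleton algebra_simps)
  also have "\<dots> \<longleftrightarrow> dotp (line (q i) (q j)) x = 0"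
  proof
    assume "\<exists>a b. x = a *s p i + b *s p j"
    then show "dotp (line (q i) (q j)) x = 0" by (auto simp: dotp_add c d dotp_line_pt)
  next
    assume z: "dotp (line (q i) (q j)) x = 0"
    let ?D = "(bracket (q i) (q j))\<^sup>2"
    have D: "?D \<noteq> 0" using q[OF ij] by simp
    have "x = (1 / ?D) *s (?D *s x)" using D by simp
    also have "\<dots> = (dotp (line (q j) (q j)) x / (?D * c)) *s p i + (dotp (line (q i) (q i)) x / (?D * d)) *s p j"
      unfolding pt_decompose[OF z] using c d D by (simp add: vec_eq_iff field_simps)
    finally show "\<exists>a b. x = a *s p i + b *s p j" by blast
  qed
  finally show ?thesis unfolding line_through_def by auto
qed

text \<open>
  The parameter of a point \<open>a (pt (q i)) + b (pt (q j))\<close> of the line is read off from \<open>a\<close> and \<open>b\<close>, which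
  the tangents at the two points extract up to a factor.
\<close>

definition lin_inv :: "'k^3^(5 option) \<Rightarrow> 'k^2^1" where
  "lin_inv z = scal (weight j {i, j} * dotp (line (q i) (q i)) (z $ None)) (q i)
     + scal (weight i {i, j} * dotp (line (q j) (q j)) (z $ None)) (q j)"

lemma lin_inv_lin: "lin_inv (lin_param i j s) = scal (weight j {i, j} * weight i {i, j} * bracket (q i) (q j) ^ 3) s"
proof -
  let ?c = "weight j {i, j} * weight i {i, j} * bracket (q i) (q j) ^ 2"
  have "lin_inv (lin_param i j s) = scal ?c (scal (bracket s (q j)) (q i) + scal (bracket (q i) s) (q j))"
    unfolding lin_inv_def lin_nth dotp_line_lin_pt
    by (intro P1_eqI) (simp_all add: bracket_swap[of "q j" "q i"] bracket_swap[of s] power2_eq_square algebra_simps)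
  also have "\<dots> = scal ?c (scal (bracket (q i) (q j)) s)" by (rule arg_cong[OF P1_decompose[symmetric]])
  also have "\<dots> = scal (weight j {i, j} * weight i {i, j} * bracket (q i) (q j) ^ 3) s"
    by (intro P1_eqI) (simp_all add: eval_nat_numeral)
  finally show ?thesis .
qed

lemma lin_inv_P1: assumes "z $ None \<noteq> 0" "dotp (line (q i) (q j)) (z $ None) = 0"
  shows "lin_inv z \<in> P1"
proof (rule ccontr)
  assume "lin_inv z \<notin> P1"
  then have "bracket (lin_inv z) (q j) = 0" "bracket (lin_inv z) (q i) = 0"
    using bracket_nonzero_P1 by blast+
  then have "dotp (line (q i) (q i)) (z $ None) = 0" "dotp (line (q j) (q j)) (z $ None) = 0"
    using weight_nonzero[of i "{i, j}"] weight_nonzero[of j "{i, j}"] q[OF ij] q[OF ij[symmetric]]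
    by (auto simp: lin_inv_def bracket_add)
  then have "(bracket (q i) (q j))\<^sup>2 *s z $ None = 0" using pt_decompose[OF assms(2)] by simp
  then show False using assms(1) q[OF ij] by simp
qed

lemma lin_pt_lin_inv:
  assumes "dotp (line (q i) (q j)) (z $ None) = 0"
  shows "lin_pt i j (lin_inv z) = (weight j {i, j} * weight i {i, j} * bracket (q i) (q j) ^ 3) *s z $ None"
proof -
  let ?c = "weight j {i, j} * weight i {i, j} * bracket (q i) (q j)"
  have "lin_pt i j (lin_inv z) = ?c *s (dotp (line (q j) (q j)) (z $ None) *s pt (q i)
      + dotp (line (q i) (q i)) (z $ None) *s pt (q j))"
    unfolding lin_pt_def lin_inv_def bracket_add bracket_scal
    by (simp add: bracket_swap[of "q j" "q i"] vec_eq_iff algebra_simps)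
  also have "\<dots> = (weight j {i, j} * weight i {i, j} * bracket (q i) (q j) ^ 3) *s z $ None"
    unfolding pt_decompose[OF assms, symmetric] by (simp add: vec_eq_iff eval_nat_numeral mult_ac)
  finally show ?thesis .
qed

definition lin_curve :: "('k^3^(5 option)) set" where
  "lin_curve = {z \<in> del_pezzo p. dotp (line (q i) (q j)) (z $ None) = 0 \<and>
     proj_eq (z $ Some i) (line (q i) (q j)) \<and> proj_eq (z $ Some j) (line (q i) (q j))}"

text \<open>
  On this set \<open>z $ None\<close> determines \<open>z\<close>: it fixes \<open>z $ Some k\<close> for the points \<open>p k\<close> off the line, and the
  other two components are the line itself, also over \<open>p i\<close> and \<open>p j\<close>.
\<close>

lemma lin_curve_param: "curve_param lin_curve (lin_param i j) lin_inv"
proof -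
  have c: "weight j {i, j} * weight i {i, j} * bracket (q i) (q j) ^ 3 \<noteq> 0"
    using weight_nonzero[of i "{i, j}"] weight_nonzero[of j "{i, j}"] q[OF ij] by auto
  have 1: "z \<in> lin_curve \<longleftrightarrow> (\<exists>s\<in>P1. mproj_eq z (lin_param i j s))" for z
  proof
    assume "z \<in> lin_curve"
    then have z: "z \<in> del_pezzo p" "dotp (line (q i) (q j)) (z $ None) = 0"
      "proj_eq (z $ Some i) (line (q i) (q j))" "proj_eq (z $ Some j) (line (q i) (q j))"
      by (auto simp: lin_curve_def)
    let ?s = "lin_inv z"
    have x0: "z $ None \<noteq> 0" using z(1) by (auto simp: del_pezzo_iff mproj_def)
    have sP: "?s \<in> P1" by (rule lin_inv_P1[OF x0 z(2)])
    have x: "proj_eq (z $ None) (lin_pt i j ?s)"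
      using proj_eq_sym lin_pt_lin_inv[OF z(2)] c unfolding proj_eq_def by blast
    have "proj_eq (z $ Some k) (line (q k) (lin_pencil i j k ?s))" if k: "k \<noteq> i" "k \<noteq> j" for k
    proof (rule line_unique[OF z(1)])
      show "\<not> proj_eq (z $ None) (pt (q k))"
      proof
        assume "proj_eq (z $ None) (pt (q k))"
        then have "dotp (line (q i) (q j)) (pt (q k)) = 0" using z(2) dotp_proj_eq[OF proj_eq_refl] by blast
        then show False using k by (simp add: dotp_line_pt q_iff)
      qed
      show "line (q k) (lin_pencil i j k ?s) \<noteq> 0" by (intro line_nonzero qP lin_pencil_P1 sP)
      show "dotp (line (q k) (lin_pencil i j k ?s)) (z $ None) = 0"
        using dotp_proj_eq[OF proj_eq_refl x] incidence_lin_pencil[OF k] by blast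
    qed (simp add: dotp_line_pt)
    then have "proj_eq (z $ b) (lin_param i j ?s $ b)" for b
      using x z(3,4) by (cases b) (auto simp: lin_param_def)
    then show "\<exists>s\<in>P1. mproj_eq z (lin_param i j s)" using sP unfolding mproj_eq_def by blast
  next
    assume "\<exists>s\<in>P1. mproj_eq z (lin_param i j s)"
    then obtain s where s: "s \<in> P1" "mproj_eq z (lin_param i j s)" by blast
    have e: "proj_eq (z $ b) (lin_param i j s $ b)" for b using s(2) by (simp add: mproj_eq_def)
    show "z \<in> lin_curve"
      using del_pezzo_respects[OF s(2) lin_del_pezzo[OF s(1)]] dotp_proj_eq[OF proj_eq_refl e[of None]]
        e[of "Some i"] e[of "Some j"]
      by (simp add: lin_curve_def lin_nth dotp_line_lin_pt_self)
  qed
  have bs: "(\<lambda>s. a * bracket (q k) s) \<in> mform (\<lambda>_. 1)" for a k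
    unfolding mform_P1 scal_def[symmetric]
    by (auto intro!: polyfun_cmult polyfun_bracket polyfun_intros)
  have pars: "(\<lambda>s. lin_pencil i j k s $ m $ b) \<in> mform (\<lambda>_. 1)" for k m b
  proof -
    have e: "(\<lambda>s. lin_pencil i j k s $ m $ b) = (\<lambda>s. (weight j {i, j, k} * q i $ 1 $ b) * bracket (q i) s
        + (- weight i {i, j, k} * q j $ 1 $ b) * bracket (q j) s)"
      by (simp add: lin_pencil_def num1_eq1[of m] fun_eq_iff algebra_simps)
    show ?thesis unfolding e by (intro mform_add bs)
  qed
  have 3: "\<exists>d. \<forall>b. (\<lambda>s. lin_param i j s $ l $ b) \<in> mform d" for l
  proof (cases l)
    case None
    have "(\<lambda>s. lin_pt i j s $ b) \<in> mform (\<lambda>_. 1)" for b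
    proof -
      have e: "(\<lambda>s. lin_pt i j s $ b) = (\<lambda>s. (weight j {i, j} * pt (q i) $ b) * bracket (q i) s
          - (weight i {i, j} * pt (q j) $ b) * bracket (q j) s)"
        by (simp add: lin_pt_def fun_eq_iff algebra_simps)
      show ?thesis unfolding e by (intro mform_diff bs)
    qed
    then show ?thesis using None by (auto simp: lin_nth)
  next
    case (Some k)
    show ?thesis
    proof (cases "k = i \<or> k = j")
      case True
      then show ?thesis using Some by (auto simp: lin_param_def intro!: exI[of _ "\<lambda>_. 0"] mform_const)
    next
      case False
      have "(\<lambda>s. line (q k) (lin_pencil i j k s) $ b) \<in> mform (\<lambda>i. \<Sum>j\<in>(UNIV :: 1 set). 1 * 1)" for b
        by (rule mform_compose[where F = "lin_pencil i j k" and g = "\<lambda>s. line (q k) s $ b" and d = "\<lambda>_ _. 1"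
              and e = "\<lambda>_. 1", OF pars line_component_mform])
      then show ?thesis using Some False by (auto simp: lin_nth)
    qed
  qed
  have dp: "(\<lambda>z. a * dotp l (z $ None) * b) \<in> mform (\<lambda>i. if i = None then 1 else 0)" for l :: "'k^3" and a b
  proof -
    have "(\<lambda>z. (a * b) * (\<Sum>m\<in>UNIV. l $ m * z $ None $ m)) \<in> mform (\<lambda>i. if i = None then 1 else 0)"
      by (intro mform_cmult mform_sum mform_coord) auto
    then show ?thesis by (simp add: dotp_def mult_ac)
  qed
  have 4: "\<exists>d. \<forall>b. (\<lambda>z. lin_inv z $ l $ b) \<in> mform d" for l
    unfolding lin_inv_def using mform_add[OF dp dp] by (auto intro!: exI[of _ "\<lambda>i. if i = None then 1 else 0"])
  have 2: "mproj_eq (lin_inv (lin_param i j s)) s" for s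
    unfolding lin_inv_lin P1_eq_scal using c by blast
  show ?thesis unfolding curve_param_def
    by (intro conjI) (use 1 2 3 4 lin_mproj in auto)
qed

lemma strict_transform_line: "strict_transform p (line_through (p i) (p j)) = lin_curve"
proof -
  define S where "S = {z \<in> del_pezzo p. z $ None \<in> line_through (p i) (p j) \<and> (\<forall>i. \<not> proj_eq (z $ None) (p i))}"
  obtain k l m where k: "distinct [i, j, k, l, m]" by (rule five_elements[OF ij])
  have w0: "bracket (q i) (q k) * bracket (q j) (q k) \<noteq> 0" using k q by auto
  have "zariski_closure S = lin_curve"
  proof (rule zariski_closure_param[where b = "\<lambda>s. bracket (q i) s * bracket (q j) s" and ?w0.0 = "q k",
        OF lin_curve_param _ w0])
    show "(\<lambda>s. bracket (q i) s * bracket (q j) s) \<in> polyfun"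
      by (intro polyfun.mult polyfun_bracket polyfun_intros)
    show "S \<subseteq> lin_curve"
    proof
      fix z assume "z \<in> S"
      then have z: "z \<in> del_pezzo p" "dotp (line (q i) (q j)) (z $ None) = 0"
        "\<And>i. \<not> proj_eq (z $ None) (pt (q i))"
        unfolding S_def by (auto simp: line_through_iff proj_eq_p_iff)
      have "proj_eq (z $ Some k) (line (q i) (q j))" if "k = i \<or> k = j" for k
        using that by (intro line_unique[OF z(1) z(3) _ z(2)] line_nonzero qP) (auto simp: dotp_line_pt)
      then show "z \<in> lin_curve" using z by (simp add: lin_curve_def)
    qed
    show "lin_param i j s \<in> S" if "s \<in> P1" "bracket (q i) s * bracket (q j) s \<noteq> 0" for s
      using that lin_del_pezzo[OF that(1)] lin_pt_meets_pt[OF that(1)] lin_pt_nonzero[OF that(1)]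
      by (auto simp: S_def lin_nth line_through_iff proj_eq_p_iff dotp_line_lin_pt_self)
    show "(\<lambda>z. dotp (line (q i) (q j)) (z $ None)) \<in> mform (\<lambda>j. if j = None then 1 else 0)"
      unfolding dotp_def by (intro mform_sum mform_cmult mform_coord) auto
    show "dotp (line (q i) (q j)) (z $ None) = 0" if "z \<in> lin_curve" for z
      using that by (simp add: lin_curve_def)
    show "lin_inv z \<in> P1" if "z \<in> mproj" "dotp (line (q i) (q j)) (z $ None) = 0" for z
      using that lin_inv_P1 by (auto simp: mproj_def)
  qed
  then show ?thesis unfolding strict_transform_def S_def by auto
qed

end

end

context conic_points
begin

section \<open>The marked points of the sixteen curves\<close>

abbreviation "Exc i \<equiv> exceptional_curve p i"
abbreviation "Lin i j \<equiv> strict_transform p (line_through (p i) (p j))"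
abbreviation "Conic \<equiv> strict_transform p (conic_through p)"

lemma Lin_commute: "Lin i j = Lin j i"
  by (simp add: line_through_def insert_commute)

lemma Lin_iff: assumes "i \<noteq> j"
  shows "z \<in> Lin i j \<longleftrightarrow> z \<in> del_pezzo p \<and> dotp (line (q i) (q j)) (z $ None) = 0 \<and>
     proj_eq (z $ Some i) (line (q i) (q j)) \<and> proj_eq (z $ Some j) (line (q i) (q j))"
  unfolding strict_transform_line[OF assms] lin_curve_def[OF assms] by simp

lemma Exc_iff: "z \<in> Exc i \<longleftrightarrow> z \<in> del_pezzo p \<and> proj_eq (z $ None) (pt (q i))"
  by (simp add: exceptional_curve_def proj_eq_p_iff)

lemma Conic_iff: "z \<in> Conic \<longleftrightarrow> (\<exists>t\<in>P1. mproj_eq z (conic_param t))"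
  using conic_curve curve_paramD(1) by blast

lemma curves_cases:
  assumes "D \<in> minus_one_curves p"
  obtains k where "D = Exc k" | k l where "k \<noteq> l" "D = Lin k l" | "D = Conic"
proof -
  from assms consider (a) "\<exists>i. D = Exc i" | (b) "\<exists>i j. D = Lin i j \<and> i \<noteq> j" | (c) "D = Conic"
    unfolding minus_one_curves_def by fastforce
  then show thesis
  proof cases
    case a
    then show thesis using that(1) by (elim exE)
  next
    case b
    then show thesis using that(2) by (elim exE conjE)
  next
    case c
    then show thesis by (rule that(3))
  qed
qed

lemma curves_mem: "Exc i \<in> minus_one_curves p" "i \<noteq> j \<Longrightarrow> Lin i j \<in> minus_one_curves p"
  "Conic \<in> minus_one_curves p"
  unfolding minus_one_curves_def by auto

lemma curves_param: assumes "D \<in> minus_one_curves p" shows "\<exists>\<psi> g. curve_param D \<psi> g"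
  using assms
proof (cases rule: curves_cases)
  case (2 k l)
  then show ?thesis using lin_curve_param[OF 2(1)] strict_transform_line[OF 2(1)] by auto
qed (use exc_curve conic_curve in blast)+

text \<open>
  The five curves meeting \<open>C\<close> are labelled such that a parametrization of \<open>C\<close> has its marked
  points at the parameters \<open>q a\<close> of the five points on the conic. Since the \<open>q a\<close> do not depend on \<open>C\<close>,
  this identifies all sixteen marked curves.
\<close>

definition marked :: "('k^3^(5 option)) set \<Rightarrow> (5 \<Rightarrow> ('k^3^(5 option)) set) \<Rightarrow> bool" where
  "marked C \<mu> \<longleftrightarrow> meeting_curves p C = range \<mu> \<and>
    (\<exists>\<psi> g. curve_param C \<psi> g \<and> (\<forall>a. \<forall>s\<in>P1. \<psi> s \<in> \<mu> a \<longleftrightarrow> bracket s (q a) = 0))"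

lemma markedI:
  assumes c: "curve_param C \<psi> g" and \<mu>: "\<And>a. \<mu> a \<in> minus_one_curves p"
    and meet: "\<And>a s. s \<in> P1 \<Longrightarrow> \<psi> s \<in> \<mu> a \<longleftrightarrow> bracket s (q a) = 0"
    and only: "\<And>D s. D \<in> minus_one_curves p \<Longrightarrow> D \<noteq> C \<Longrightarrow> s \<in> P1 \<Longrightarrow> \<psi> s \<in> D \<Longrightarrow> D \<in> range \<mu>"
  shows "marked C \<mu>"
proof -
  have "meeting_curves p C = range \<mu>"
  proof (intro equalityI subsetI)
    fix D assume "D \<in> meeting_curves p C"
    then obtain z where D: "D \<in> minus_one_curves p" "D \<noteq> C" "z \<in> C" "z \<in> D"
      unfolding meeting_curves_def by blast
    obtain s where s: "s \<in> P1" "mproj_eq z (\<psi> s)" using curve_paramD(1)[OF c] D(3) by blast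
    obtain \<psi>' g' where "curve_param D \<psi>' g'" using curves_param[OF D(1)] by blast
    then have "\<psi> s \<in> D" using curve_paramD(6) D(4) mproj_eq_sym[OF s(2)] by blast
    then show "D \<in> range \<mu>" using only D s by blast
  next
    fix D assume "D \<in> range \<mu>"
    then obtain a where a: "D = \<mu> a" by blast
    have "\<psi> (q a) \<in> C \<inter> \<mu> a" using curve_paramD(7)[OF c qP] meet[OF qP] by simp
    moreover have "\<mu> a \<noteq> C"
    proof
      assume e: "\<mu> a = C"
      have "\<psi> (q (a + 1)) \<in> C" using curve_paramD(7)[OF c qP] .
      then have "bracket (q (a + 1)) (q a) = 0" using meet[OF qP] e by blast
      then show False by (simp add: q_iff)
    qed
    ultimately show "D \<in> meeting_curves p C" using a \<mu> unfolding meeting_curves_def by blast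
  qed
  then show ?thesis unfolding marked_def using c meet by blast
qed

lemma same_point: "s \<in> P1 \<Longrightarrow> t \<in> P1 \<Longrightarrow> r \<in> P1 \<Longrightarrow> bracket s t = 0 \<Longrightarrow> bracket t r = 0 \<Longrightarrow> bracket s r = 0"
  using P1_eq_iff_bracket mproj_eq_trans by blast

text \<open>
  The exceptional curve over \<open>p i\<close> is the pencil of lines through \<open>p i\<close>, identified with the conic by
  projection from \<open>p i\<close>. The line to \<open>p a\<close> is the mark of the strict transform of that line, and
  the tangent, with parameter \<open>q i\<close>, is the mark of the conic.
\<close>

lemma exc_marked: "marked (Exc i) (\<lambda>a. if a = i then Conic else Lin i a)"
proof -
  obtain g where g: "curve_param (Exc i) (exc_param i) g" using exc_curve by blast
  show ?thesis
  proof (rule markedI[OF g])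
    show "(if a = i then Conic else Lin i a) \<in> minus_one_curves p" for a using curves_mem by auto
    fix s :: "'k^2^1" assume s: "s \<in> P1"
    have Conic: "exc_param i s \<in> Conic \<longleftrightarrow> bracket s (q i) = 0"
    proof
      assume "exc_param i s \<in> Conic"
      then obtain t where t: "t \<in> P1" "mproj_eq (exc_param i s) (conic_param t)" unfolding Conic_iff by blast
      then have e: "proj_eq (exc_param i s $ b) (conic_param t $ b)" for b by (simp add: mproj_eq_def)
      have "bracket (q i) t = 0" using e[of None] pt_proj_eq[OF qP t(1)] by (simp add: exc_nth conic_nth)
      then have "bracket t (q i) = 0" using bracket_swap[of t] by simp
      moreover have "bracket s t = 0" using e[of "Some i"] line_proj_eq[OF qP s t(1)] by (simp add: exc_nth conic_nth)
      ultimately show "bracket s (q i) = 0" using same_point s t(1) qP by blast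
    next
      assume "bracket s (q i) = 0"
      then have "proj_eq (line (q i) s) (line (q i) (q i))" using line_proj_eq[OF qP s qP] by simp
      then have "proj_eq (exc_param i s $ b) (conic_param (q i) $ b)" for b
        by (cases b) (auto simp: exc_param_def conic_nth)
      then show "exc_param i s \<in> Conic" unfolding Conic_iff mproj_eq_def using qP by blast
    qed
    show "exc_param i s \<in> (if a = i then Conic else Lin i a) \<longleftrightarrow> bracket s (q a) = 0" for a
    proof (cases "a = i")
      case False
      then have "exc_param i s \<in> Lin i a \<longleftrightarrow> proj_eq (line (q i) s) (line (q i) (q a))"
        using exc_del_pezzo[OF s] by (simp add: Lin_iff exc_nth dotp_line_pt line_commute)
      then show ?thesis using False line_proj_eq[OF qP s qP] by simp
    qed (use Conic in simp)
    fix D assume D: "D \<in> minus_one_curves p" "D \<noteq> Exc i" "exc_param i s \<in> D"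
    from D(1) show "D \<in> range (\<lambda>a. if a = i then Conic else Lin i a)"
    proof (cases rule: curves_cases)
      case (1 k)
      then have "bracket (q i) (q k) = 0" using D(3) pt_proj_eq[OF qP qP] by (simp add: Exc_iff exc_nth)
      then show ?thesis using 1 D(2) by (simp add: q_iff)
    next
      case (2 k l)
      then have "k = i \<or> l = i" using D(3) by (auto simp: Lin_iff exc_nth dotp_line_pt q_iff)
      then show ?thesis
      proof
        assume "k = i" then show ?thesis using 2 by (intro image_eqI[of _ _ l]) auto
      next
        assume "l = i" then show ?thesis using 2 Lin_commute by (intro image_eqI[of _ _ k]) auto
      qed
    next
      case 3
      then show ?thesis by (intro image_eqI[of _ _ i]) auto
    qed
  qed
qed

text \<open>
  The strict transforms of the lines avoid that of the conic: a common point would lie over a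
  blown-up point \<open>p k\<close>, where the tangent differs from the line.
\<close>

lemma conic_marked: "marked Conic Exc"
proof -
  obtain g where g: "curve_param Conic conic_param g" using conic_curve by blast
  show ?thesis
  proof (rule markedI[OF g])
    show "Exc a \<in> minus_one_curves p" for a by (rule curves_mem)
    fix s :: "'k^2^1" assume s: "s \<in> P1"
    show "conic_param s \<in> Exc a \<longleftrightarrow> bracket s (q a) = 0" for a
      using conic_del_pezzo[OF s] pt_proj_eq[OF s qP] by (simp add: Exc_iff conic_nth)
    fix D assume D: "D \<in> minus_one_curves p" "D \<noteq> Conic" "conic_param s \<in> D"
    from D(1) show "D \<in> range Exc"
    proof (cases rule: curves_cases)
      case (2 k l)
      then have "proj_eq (line (q k) s) (line (q k) (q l))" "proj_eq (line (q l) s) (line (q l) (q k))"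
        using D(3) by (auto simp: Lin_iff conic_nth line_commute)
      then have "bracket s (q l) = 0" "bracket s (q k) = 0" using line_proj_eq[OF qP s qP] by blast+
      then show ?thesis using q_two[OF s 2(1)] by blast
    qed (use D(2) in auto)
  qed
qed

text \<open>
  The marks on a line are its points \<open>p j\<close> and \<open>p i\<close>, with parameters \<open>q i\<close> and \<open>q j\<close>, and the
  intersections with the lines joining two of the other three points; the parameter of such an
  intersection is that of the third point, by the choice of the scalars in \<open>lin_pt\<close>.
\<close>

lemma lin_marked:
  assumes ij: "distinct [i, j, k, l, m]" "UNIV = {i, j, k, l, m}"
  shows "marked (Lin i j) (\<lambda>a. if a = i then Exc j else if a = j then Exc i
    else if a = k then Lin l m else if a = l then Lin k m else Lin k l)" (is "marked _ ?\<mu>")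
proof -
  have ne: "i \<noteq> j" using ij by simp
  have g: "curve_param (Lin i j) (lin_param i j) (lin_inv i j)"
    using lin_curve_param[OF ne] strict_transform_line[OF ne] by simp
  have third: "lin_param i j s \<in> Lin a b \<longleftrightarrow> bracket s (q c) = 0"
    if s: "s \<in> P1" and abc: "distinct [i, j, a, b, c]" "UNIV = {i, j, a, b, c}" for s a b c
  proof -
    have ab: "a \<noteq> b" using abc by simp
    have wj: "weight j {i, j} = bracket (q j) (q a) * bracket (q j) (q b) * bracket (q j) (q c)"
      and wi: "weight i {i, j} = bracket (q i) (q a) * bracket (q i) (q b) * bracket (q i) (q c)"
    proof -
      have "UNIV - {i, j} = {a, b, c}" using abc by auto
      then show "weight j {i, j} = bracket (q j) (q a) * bracket (q j) (q b) * bracket (q j) (q c)"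
        "weight i {i, j} = bracket (q i) (q a) * bracket (q i) (q b) * bracket (q i) (q c)"
        using abc(1) by (auto simp: weight_def mult.assoc)
    qed
    have "dotp (line (q a) (q b)) (lin_pt i j s) =
      bracket (q j) (q a) * bracket (q j) (q b) * bracket (q i) (q a) * bracket (q i) (q b) *
      (bracket (q j) (q c) * bracket (q i) s - bracket (q i) (q c) * bracket (q j) s)"
      unfolding dotp_line_lin_pt wi wj
      by (simp add: bracket_swap[of "q a"] bracket_swap[of "q b"] algebra_simps)
    also have "bracket (q j) (q c) * bracket (q i) s - bracket (q i) (q c) * bracket (q j) s =
       bracket (q i) (q j) * bracket s (q c)"
      by (simp add: bracket_def algebra_simps)
    finally have d: "dotp (line (q a) (q b)) (lin_pt i j s) = 0 \<longleftrightarrow> bracket s (q c) = 0"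
      using abc(1) by (auto simp: q_iff)
    have "lin_param i j s \<in> Lin a b" if z: "bracket s (q c) = 0"
    proof -
      have "\<not> proj_eq (lin_param i j s $ None) (pt (q e))" if "e \<in> {a, b}" for e
        using lin_pt_meets_pt[OF ne s] that abc(1) by (auto simp: lin_nth)
      then have "proj_eq (lin_param i j s $ Some e) (line (q a) (q b))" if "e \<in> {a, b}" for e
        using that d z by (intro line_unique[OF lin_del_pezzo[OF ne s]] line_nonzero qP)
          (auto simp: lin_nth dotp_line_pt)
      then show ?thesis using d z lin_del_pezzo[OF ne s] ab by (simp add: Lin_iff lin_nth)
    qed
    moreover have "bracket s (q c) = 0" if "lin_param i j s \<in> Lin a b"
      using that d ab by (simp add: Lin_iff lin_nth)
    ultimately show ?thesis by blast
  qed
  show ?thesis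
  proof (rule markedI[OF g])
    show "?\<mu> a \<in> minus_one_curves p" for a using curves_mem ij(1) by auto
    fix s :: "'k^2^1" assume s: "s \<in> P1"
    have exc_param: "lin_param i j s \<in> Exc a \<longleftrightarrow> a = i \<and> bracket s (q j) = 0 \<or> a = j \<and> bracket s (q i) = 0" for a
      using lin_del_pezzo[OF ne s] lin_pt_meets_pt[OF ne s, of a] bracket_swap[of s]
      by (simp add: Exc_iff lin_nth)
    show "lin_param i j s \<in> ?\<mu> a \<longleftrightarrow> bracket s (q a) = 0" for a
    proof -
      have "a \<in> {i, j, k, l, m}" using ij(2) by blast
      moreover have "lin_param i j s \<in> Lin l m \<longleftrightarrow> bracket s (q k) = 0"
        by (rule third[OF s]) (use ij in auto)
      moreover have "lin_param i j s \<in> Lin k m \<longleftrightarrow> bracket s (q l) = 0"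
        by (rule third[OF s]) (use ij in auto)
      moreover have "lin_param i j s \<in> Lin k l \<longleftrightarrow> bracket s (q m) = 0"
        by (rule third[OF s]) (use ij in auto)
      ultimately show ?thesis using exc_param ij(1) by auto
    qed
    fix D assume D: "D \<in> minus_one_curves p" "D \<noteq> Lin i j" "lin_param i j s \<in> D"
    define \<mu> where "\<mu> = ?\<mu>"
    have \<mu>: "\<mu> i = Exc j" "\<mu> j = Exc i" "\<mu> k = Lin l m" "\<mu> l = Lin k m" "\<mu> m = Lin k l"
      using ij(1) by (auto simp: \<mu>_def)
    from D(1) have "D \<in> range \<mu>"
    proof (cases rule: curves_cases)
      case (1 a)
      then have "a = i \<or> a = j" using D(3) exc_param by blast
      then show ?thesis using 1 rangeI[of \<mu> i] rangeI[of \<mu> j] \<mu>(1,2) by auto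
    next
      case (2 a b)
      have da: "proj_eq (lin_param i j s $ Some a) (line (q a) (q b))" and db: "proj_eq (lin_param i j s $ Some b) (line (q a) (q b))"
        using D(3) 2 by (auto simp: Lin_iff)
      have 3: "c = d" if "proj_eq (line (q e) (q c)) (line (q e) (q d))" for c d e
        using that line_proj_eq[OF qP qP qP] q_iff by blast
      have "a \<noteq> i \<and> a \<noteq> j \<and> b \<noteq> i \<and> b \<noteq> j"
      proof (rule ccontr)
        assume "\<not> ?thesis"
        then consider "a = i" | "a = j" | "b = i" | "b = j" by blast
        then have "D = Lin i j"
        proof cases
          case 1
          then show ?thesis using 3[of i j b] da 2 by (simp add: lin_nth)
        next
          case A: 2
          then show ?thesis using 3[of j i b] da 2 Lin_commute by (simp add: lin_nth line_commute)
        next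
          case A: 3
          then show ?thesis using 3[of i j a] db 2 Lin_commute by (simp add: lin_nth line_commute)
        next
          case 4
          then show ?thesis using 3[of j i a] db 2 by (simp add: lin_nth line_commute)
        qed
        then show False using D(2) by simp
      qed
      then have "a \<in> {k, l, m}" "b \<in> {k, l, m}" using ij(2) by blast+
      then have "D = Lin l m \<or> D = Lin k m \<or> D = Lin k l" using 2 Lin_commute by blast
      then show ?thesis using rangeI[of \<mu> k] rangeI[of \<mu> l] rangeI[of \<mu> m] \<mu>(3,4,5) by auto
    next
      case 3
      then have "lin_param i j s \<in> Conic" using D(3) by simp
      then obtain t where t: "t \<in> P1" "mproj_eq (lin_param i j s) (conic_param t)" unfolding Conic_iff by blast
      then have e: "proj_eq (lin_param i j s $ b) (conic_param t $ b)" for b by (simp add: mproj_eq_def)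
      have "bracket (q j) t = 0" using e[of "Some i"] line_proj_eq[OF qP qP t(1)] by (simp add: lin_nth conic_nth)
      moreover have "bracket (q i) t = 0"
        using e[of "Some j"] line_proj_eq[OF qP qP t(1)] by (simp add: lin_nth conic_nth line_commute[of "q i" "q j"])
      ultimately have "bracket t (q i) = 0" "bracket t (q j) = 0" using bracket_swap[of t] by simp_all
      then show ?thesis using q_two[OF t(1) ne] by blast
    qed
    then show "D \<in> range ?\<mu>" unfolding \<mu>_def .
  qed
qed

lemma all_marked: assumes "C \<in> minus_one_curves p" shows "\<exists>\<mu>. marked C \<mu>"
  using assms
proof (cases rule: curves_cases)
  case (2 i j)
  obtain k l m where "distinct [i, j, k, l, m]" "UNIV = {i, j, k, l, m}" by (rule five_elements[OF 2(1)])
  then show ?thesis using lin_marked 2(2) by blast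
qed (use exc_marked conic_marked in blast)+

lemma marked_inj: assumes "marked C \<mu>" shows "inj \<mu>"
proof (rule injI)
  fix a b assume "\<mu> a = \<mu> b"
  moreover obtain \<psi> where \<psi>: "\<And>a s. s \<in> P1 \<Longrightarrow> \<psi> s \<in> \<mu> a \<longleftrightarrow> bracket s (q a) = 0"
    using assms unfolding marked_def by blast
  ultimately have "bracket (q a) (q b) = 0" using \<psi>[OF qP] by (metis bracket_self)
  then show "a = b" by (simp add: q_iff)
qed

end

section \<open>Valuations and trees\<close>

text \<open>
  In the quartet values the summands \<open>f\<close> of the caterpillar representation cancel.
\<close>

lemma tree_of_four_point:
  fixes W :: "'l \<Rightarrow> 'l \<Rightarrow> real"
  assumes L: "card L = 5" and sym: "\<And>x y. W x y = W y x"
    and four: "\<And>x y z w. {x, y, z, w} \<subseteq> L \<Longrightarrow> distinct [x, y, z, w] \<Longrightarrow>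
      W x y + W z w \<ge> min (W x z + W y w) (W x w + W y z)"
  shows "\<exists>T :: (nat, 'l) metric_tree. is_metric_tree T \<and> leaves T = L \<and>
    (\<forall>a\<in>L. \<forall>b\<in>L. \<forall>c\<in>L. \<forall>d\<in>L. distinct [a, b, c, d] \<longrightarrow>
       quartet T a b c d = W a c + W b d - W a d - W b c)"
proof -
  obtain a b c d e P f where L': "L = {a, b, c, d, e}" "distinct [a, b, c, d, e]"
    and P: "P a = P b" "P b \<le> P c" "P c \<le> P d" "P d = (P e :: real)"
    and W: "\<forall>x\<in>L. \<forall>y\<in>L. x \<noteq> y \<longrightarrow> W x y = f x + f y - \<bar>P x - P y\<bar> / 2"
    using four_point_caterpillar[where W = W, OF L sym four] by metis
  obtain T :: "(nat, 'l) metric_tree" where T: "is_metric_tree T" "leaves T = {a, b, c, d, e}"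
    "\<forall>x\<in>leaves T. \<forall>y\<in>leaves T. leaf_dist T x y = \<bar>P x - P y\<bar>"
    using caterpillar_exists[OF L'(2) P] by blast
  have TL: "leaves T = L" using T(2) L'(1) by simp
  have "quartet T x y z w = W x z + W y w - W x w - W y z"
    if "x \<in> L" "y \<in> L" "z \<in> L" "w \<in> L" "distinct [x, y, z, w]" for x y z w
  proof -
    have d: "leaf_dist T u v = \<bar>P u - P v\<bar>" if "u \<in> L" "v \<in> L" for u v using T(3) that TL by blast
    have Wv: "W u v = f u + f v - \<bar>P u - P v\<bar> / 2" if "u \<in> L" "v \<in> L" "u \<noteq> v" for u v
      using W that by blast
    show ?thesis using that by (simp add: quartet_def d Wv field_simps)
  qed
  then show ?thesis using T(1) TL by blast
qed

context
  fixes val :: "'k::field \<Rightarrow> ereal" assumes val: "nonarch_valuation val"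
begin

lemma val_infinite: "val x = \<infinity> \<longleftrightarrow> x = 0" and val_mult: "val (x * y) = val x + val y"
  and val_add: "val (x + y) \<ge> min (val x) (val y)" and val_not_minf: "val x \<noteq> -\<infinity>"
  using val unfolding nonarch_valuation_def by blast+

text \<open>
  At \<open>0\<close>, where the valuation is infinite, this is a default value.
\<close>

definition rval :: "'k \<Rightarrow> real" where "rval x = real_of_ereal (val x)"

lemma val_rval: "x \<noteq> 0 \<Longrightarrow> val x = ereal (rval x)"
  unfolding rval_def using val_infinite[of x] val_not_minf[of x] by (cases "val x") auto

lemma rval_mult: "x \<noteq> 0 \<Longrightarrow> y \<noteq> 0 \<Longrightarrow> rval (x * y) = rval x + rval y"
  unfolding rval_def[of "x * y"] val_mult by (simp add: val_rval)

lemma rval_one: "rval 1 = 0" using rval_mult[of 1 1] by simp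

lemma rval_uminus: "rval (- x) = rval x"
proof (cases "x = 0")
  case False
  have "rval (-1) + rval (-1) = 0" using rval_mult[of "-1" "-1"] rval_one by simp
  then show ?thesis using rval_mult[of "-1" x] False by simp
qed simp

lemma rval_divide: "x \<noteq> 0 \<Longrightarrow> y \<noteq> 0 \<Longrightarrow> rval (x / y) = rval x - rval y"
  using rval_mult[of "x / y" y] by simp

lemma rval_add: "x \<noteq> 0 \<Longrightarrow> y \<noteq> 0 \<Longrightarrow> x + y \<noteq> 0 \<Longrightarrow> rval (x + y) \<ge> min (rval x) (rval y)"
  using val_add[of x y] by (simp add: val_rval min_def split: if_splits)

end

section \<open>General position\<close>

text \<open>
  Express the points in the basis \<open>p i1, p i2, p i3\<close>, rescaled such that \<open>p i4\<close> is \<open>(1, 1, 1)\<close> and \<open>p i5\<close>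
  is \<open>(a, b, c)\<close>. General position says that \<open>a, b, c\<close> are nonzero and distinct. The Cremona transform
  of the line joining \<open>(1, 1, 1)\<close> and \<open>(1/a, 1/b, 1/c)\<close> is the conic
  \<open>(a (b x + y) (c x + y), b (a x + y) (c x + y), c (a x + y) (b x + y))\<close>; it takes the five points at
  \<open>(1, -a), (1, -b), (1, -c), (1, 0), (0, 1)\<close>.
\<close>

lemma conic_chart:
  fixes p :: "5 \<Rightarrow> 'k::field_char_0^3"
  assumes gp: "general_position p"
  shows "\<exists>A B q. conic_points p A B q"
proof -
  have nocol: "\<not> (\<exists>l. l \<noteq> 0 \<and> dotp l (p i) = 0 \<and> dotp l (p j) = 0 \<and> dotp l (p k) = 0)"
    if "i \<noteq> j" "i \<noteq> k" "j \<noteq> k" for i j k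
    using gp that unfolding general_position_def on_line_dotp by blast
  have "(0::5) \<noteq> 0 + 1" by simp
  from five_elements[OF this] obtain i1 i2 i3 i4 i5 :: 5 where d: "distinct [i1, i2, i3, i4, i5]" and
    U: "UNIV = {i1, i2, i3, i4, i5}" by metis
  define N :: "'k^3^3" where "N = vector [p i1, p i2, p i3]"
  have N: "(N *v l) $ 1 = dotp l (p i1)" "(N *v l) $ 2 = dotp l (p i2)" "(N *v l) $ 3 = dotp l (p i3)" for l
    by (simp_all add: N_def matrix_vector_mult_def dotp_def mult.commute)
  have "\<forall>l. N *v l = 0 \<longrightarrow> l = 0"
  proof (intro allI impI)
    fix l assume "N *v l = 0"
    then have "dotp l (p i1) = 0" "dotp l (p i2) = 0" "dotp l (p i3) = 0" using N by (metis zero_index)+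
    then show "l = 0" using nocol[of i1 i2 i3] d by auto
  qed
  then have "\<exists>N'. N' ** N = mat 1" by (simp only: matrix_left_invertible_ker)
  then obtain N' :: "'k^3^3" where N'N: "N' ** N = mat 1" by (elim exE)
  then have NN': "N ** N' = mat 1" by (simp add: matrix_left_right_inverse)
  \<comment> \<open>The line with prescribed values \<open>v\<close> at the three basis points, and the coordinates \<open>co x\<close> of a point.\<close>
  define l where "l v = N' *v v" for v :: "'k^3"
  have dl: "dotp (l v) (p i1) = v $ 1" "dotp (l v) (p i2) = v $ 2" "dotp (l v) (p i3) = v $ 3" for v
    using N[of "l v"] by (simp_all add: l_def matrix_vector_mul_assoc NN')
  define co where "co x = transpose N' *v x" for x :: "'k^3"
  have dco: "dotp (l v) x = dotp v (co x)" for v x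
  proof -
    have "dotp (l v) x = dotp (v v* transpose N') x" by (metis l_def transpose_matrix_vector transpose_transpose)
    then show ?thesis by (simp only: dotp_adjoint co_def)
  qed
  have lnz: "l v \<noteq> 0" if "v \<noteq> 0" for v
  proof
    assume "l v = 0"
    then have "v $ 1 = 0" "v $ 2 = 0" "v $ 3 = 0" using dl[of v] by simp_all
    then show False using that by (simp add: vec_eq_iff forall_3)
  qed
  have Nco: "transpose N *v co x = x" for x
    unfolding co_def using N'N by (metis matrix_transpose_mul matrix_vector_mul_assoc matrix_vector_mul_lid transpose_mat)
  define u v where "u = co (p i4)" and "v = co (p i5)"
  have key1: "dotp w (co (p k)) \<noteq> 0"
    if "w \<noteq> 0" "i \<noteq> j" "i \<noteq> k" "j \<noteq> k" "dotp (l w) (p i) = 0" "dotp (l w) (p j) = 0" for w i j k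
    unfolding dco[symmetric] using nocol[OF that(2,3,4)] lnz[OF that(1)] that(5,6) by blast
  have dv: "dotp (vector [x, y, z]) w = x * w $ 1 + y * w $ 2 + z * w $ 3" for x y z and w :: "'k^3"
    by (simp add: dotp_3)
  have e: "vector [1, 0, 0] \<noteq> (0 :: 'k^3)" "vector [0, 1, 0] \<noteq> (0 :: 'k^3)" "vector [0, 0, 1] \<noteq> (0 :: 'k^3)"
    by (auto simp: vec_eq_iff forall_3)
  have u0: "u $ 1 \<noteq> 0" "u $ 2 \<noteq> 0" "u $ 3 \<noteq> 0"
    using key1[OF e(1), of i2 i3 i4] key1[OF e(2), of i1 i3 i4] key1[OF e(3), of i1 i2 i4] d
    by (simp_all add: dl dv u_def)
  have v0: "v $ 1 \<noteq> 0" "v $ 2 \<noteq> 0" "v $ 3 \<noteq> 0"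
    using key1[OF e(1), of i2 i3 i5] key1[OF e(2), of i1 i3 i5] key1[OF e(3), of i1 i2 i5] d
    by (simp_all add: dl dv v_def)
  have key2: "dotp w v \<noteq> 0" if "w \<noteq> 0" "k \<noteq> i4" "k \<noteq> i5" "dotp (l w) (p k) = 0" "dotp w u = 0" for w k
    using key1[of w k i4 i5] that d unfolding u_def v_def dco by auto
  have e: "vector [u $ 2, - u $ 1, 0] \<noteq> (0 :: 'k^3)" "vector [u $ 3, 0, - u $ 1] \<noteq> (0 :: 'k^3)"
    "vector [0, u $ 3, - u $ 2] \<noteq> (0 :: 'k^3)"
    using u0 by (auto simp: vec_eq_iff forall_3)
  have uv: "u $ 1 * v $ 2 \<noteq> u $ 2 * v $ 1" "u $ 1 * v $ 3 \<noteq> u $ 3 * v $ 1" "u $ 2 * v $ 3 \<noteq> u $ 3 * v $ 2"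
    using key2[OF e(1), of i3] key2[OF e(2), of i2] key2[OF e(3), of i1] d
    by (simp_all add: dl dv mult.commute)
  define a b c where "a = v $ 1 / u $ 1" and "b = v $ 2 / u $ 2" and "c = v $ 3 / u $ 3"
  have abc: "a \<noteq> 0" "b \<noteq> 0" "c \<noteq> 0" "a \<noteq> b" "a \<noteq> c" "b \<noteq> c"
    using u0 v0 uv by (auto simp: a_def b_def c_def field_simps)
  have vabc: "v $ 1 = a * u $ 1" "v $ 2 = b * u $ 2" "v $ 3 = c * u $ 3"
    using u0 by (simp_all add: a_def b_def c_def)
  define M :: "'k^3^3" where "M = vector [vector [u $ 1 * a * (b * c), u $ 1 * a * (b + c), u $ 1 * a],
     vector [u $ 2 * b * (a * c), u $ 2 * b * (a + c), u $ 2 * b],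
     vector [u $ 3 * c * (a * b), u $ 3 * c * (a + b), u $ 3 * c]]"
  define s :: "'k \<Rightarrow> 'k \<Rightarrow> 'k^2^1" where "s x y = (\<chi> _. vector [x, y])" for x y
  have Mv: "(M *v veronese (s x y)) $ 1 = u $ 1 * a * ((b * x + y) * (c * x + y))"
    "(M *v veronese (s x y)) $ 2 = u $ 2 * b * ((a * x + y) * (c * x + y))"
    "(M *v veronese (s x y)) $ 3 = u $ 3 * c * ((a * x + y) * (b * x + y))" for x y
    by (simp_all add: M_def s_def veronese_def matrix_vector_mult_def sum_3 power2_eq_square algebra_simps)
  have "\<forall>w. M *v w = 0 \<longrightarrow> w = 0"
  proof (intro allI impI)
    fix w assume z: "M *v w = 0"
    have rows: "(M *v w) $ 1 = u $ 1 * a * (b * c * w $ 1 + (b + c) * w $ 2 + w $ 3)"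
      "(M *v w) $ 2 = u $ 2 * b * (a * c * w $ 1 + (a + c) * w $ 2 + w $ 3)"
      "(M *v w) $ 3 = u $ 3 * c * (a * b * w $ 1 + (a + b) * w $ 2 + w $ 3)"
      by (simp_all add: M_def matrix_vector_mult_def sum_3 algebra_simps)
    have e: "b * c * w $ 1 + (b + c) * w $ 2 + w $ 3 = 0" "a * c * w $ 1 + (a + c) * w $ 2 + w $ 3 = 0"
      "a * b * w $ 1 + (a + b) * w $ 2 + w $ 3 = 0"
      using rows u0 abc unfolding z by auto
    have "(b - a) * (c * w $ 1 + w $ 2) = 0" "(c - a) * (b * w $ 1 + w $ 2) = 0"
      using e by (simp_all add: algebra_simps) algebra+
    then have f: "c * w $ 1 + w $ 2 = 0" "b * w $ 1 + w $ 2 = 0" using abc by auto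
    then have "(c - b) * w $ 1 = 0" by algebra
    then have "w $ 1 = 0" using abc by auto
    moreover from this f have "w $ 2 = 0" by simp
    moreover from calculation e have "w $ 3 = 0" by simp
    ultimately show "w = 0" by (simp add: vec_eq_iff forall_3)
  qed
  then have "\<exists>M'. M' ** M = mat 1" by (simp only: matrix_left_invertible_ker)
  then obtain M' :: "'k^3^3" where M'M: "M' ** M = mat 1" by (elim exE)
  define A where "A = transpose N ** M"
  define B where "B = M' ** transpose N'"
  have "B ** A = M' ** (transpose N' ** transpose N) ** M" by (simp add: A_def B_def matrix_mul_assoc)
  also have "transpose N' ** transpose N = mat 1" using NN' by (metis matrix_transpose_mul transpose_mat)
  finally have BA: "B ** A = mat 1" using M'M by simp
  then have AB: "A ** B = mat 1" by (simp add: matrix_left_right_inverse)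
  define q where "q i = (if i = i1 then s 1 (- a) else if i = i2 then s 1 (- b) else if i = i3 then s 1 (- c)
    else if i = i4 then s 1 0 else s 0 1)" for i
  have q: "q i1 = s 1 (- a)" "q i2 = s 1 (- b)" "q i3 = s 1 (- c)" "q i4 = s 1 0" "q i5 = s 0 1"
    using d by (auto simp: q_def)
  have i: "i = i1 \<or> i = i2 \<or> i = i3 \<or> i = i4 \<or> i = i5" for i using U by blast
  have br: "bracket (q i) (q j) \<noteq> 0" if "i \<noteq> j" for i j
    using i[of i] i[of j] that abc by (elim disjE) (simp_all add: q s_def bracket_def)
  have Ntr: "transpose N *v w = w $ 1 *s p i1 + w $ 2 *s p i2 + w $ 3 *s p i3" for w
    by (simp add: N_def vector_matrix_mult_def vec_eq_iff sum_3 mult.commute)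
  have Av: "A *v veronese (s x y) = (u $ 1 * a * ((b * x + y) * (c * x + y))) *s p i1 +
      (u $ 2 * b * ((a * x + y) * (c * x + y))) *s p i2 + (u $ 3 * c * ((a * x + y) * (b * x + y))) *s p i3" for x y
    unfolding A_def matrix_vector_mul_assoc[symmetric] Ntr Mv ..
  have p4: "p i4 = u $ 1 *s p i1 + u $ 2 *s p i2 + u $ 3 *s p i3"
    using Nco[of "p i4"] unfolding Ntr u_def by simp
  have p5: "p i5 = v $ 1 *s p i1 + v $ 2 *s p i2 + v $ 3 *s p i3"
    using Nco[of "p i5"] unfolding Ntr v_def by simp
  have pe: "proj_eq (p i) (A *v veronese (q i))" for i
  proof (rule proj_eq_sym)
    have "A *v veronese (q i1) = (u $ 1 * a * ((b - a) * (c - a))) *s p i1"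
      by (simp add: q Av vec_eq_iff)
    moreover have "A *v veronese (q i2) = (u $ 2 * b * ((a - b) * (c - b))) *s p i2"
      by (simp add: q Av vec_eq_iff)
    moreover have "A *v veronese (q i3) = (u $ 3 * c * ((a - c) * (b - c))) *s p i3"
      by (simp add: q Av vec_eq_iff)
    moreover have "A *v veronese (q i4) = (a * b * c) *s p i4"
      by (simp add: q Av p4 vec_eq_iff algebra_simps)
    moreover have "A *v veronese (q i5) = 1 *s p i5"
      by (simp add: q Av p5 vabc vec_eq_iff algebra_simps)
    moreover have "u $ 1 * a * ((b - a) * (c - a)) \<noteq> 0" "u $ 2 * b * ((a - b) * (c - b)) \<noteq> 0"
      "u $ 3 * c * ((a - c) * (b - c)) \<noteq> 0" "a * b * c \<noteq> 0" using abc u0 by auto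
    ultimately show "proj_eq (A *v veronese (q i)) (p i)"
      using i[of i] unfolding proj_eq_def by (metis zero_neq_one)
  qed
  have "conic_points p A B q" using AB BA pe br by (simp add: conic_points_def)
  then show ?thesis by blast
qed

context conic_points
begin

text \<open>
  An arbitrary choice of marks, transported by \<open>g\<close>, is proportional to the parameters \<open>q a\<close>.
\<close>

lemma cross_ratio_marks:
  assumes iso: "isomorphism P1 C \<psi>'" and c: "curve_param C \<psi> g"
    and \<mu>: "\<And>a s. s \<in> P1 \<Longrightarrow> \<psi> s \<in> \<mu> a \<longleftrightarrow> bracket s (q a) = 0" "\<And>a. \<mu> a \<in> minus_one_curves p"
    and x: "\<And>a. x (\<mu> a) \<in> P1 \<and> \<psi>' (x (\<mu> a)) \<in> \<mu> a"
  shows "cross_ratio (x (\<mu> a)) (x (\<mu> b)) (x (\<mu> c)) (x (\<mu> d)) = cross_ratio (q a) (q b) (q c) (q d)"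
proof -
  have "mproj_eq (g (\<psi>' (x (\<mu> a)))) (q a)" for a
  proof -
    have C: "\<psi>' (x (\<mu> a)) \<in> C" using iso x[of a] unfolding isomorphism_def regular_map_def by blast
    note inv = curve_param_inverse[OF c C]
    obtain \<psi>0 g0 where "curve_param (\<mu> a) \<psi>0 g0" using curves_param[OF \<mu>(2)] by blast
    then have "\<psi> (g (\<psi>' (x (\<mu> a)))) \<in> \<mu> a" using curve_paramD(6) x inv(2) by blast
    then have "bracket (g (\<psi>' (x (\<mu> a)))) (q a) = 0" using \<mu>(1)[OF inv(1)] by blast
    then show ?thesis using P1_eq_iff_bracket[OF inv(1) qP] by blast
  qed
  then have "\<forall>a. \<exists>k. k \<noteq> 0 \<and> g (\<psi>' (x (\<mu> a))) = scal k (q a)" unfolding P1_eq_scal by blast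
  then obtain k where k: "\<And>a. k a \<noteq> 0" "\<And>a. g (\<psi>' (x (\<mu> a))) = scal (k a) (q a)" by metis
  have "cross_ratio (x (\<mu> a)) (x (\<mu> b)) (x (\<mu> c)) (x (\<mu> d)) =
     cross_ratio (g (\<psi>' (x (\<mu> a)))) (g (\<psi>' (x (\<mu> b)))) (g (\<psi>' (x (\<mu> c)))) (g (\<psi>' (x (\<mu> d))))"
    using isomorphism_cross_ratio[OF c iso, of "x (\<mu> a)" "x (\<mu> b)" "x (\<mu> c)" "x (\<mu> d)"] x by simp
  also have "\<dots> = (k a * k b * k c * k d * (bracket (q a) (q c) * bracket (q b) (q d))) /
      (k a * k b * k c * k d * (bracket (q a) (q d) * bracket (q b) (q c)))"
    by (simp add: k(2) cross_ratio_def mult_ac)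
  also have "\<dots> = cross_ratio (q a) (q b) (q c) (q d)"
    unfolding cross_ratio_def using k(1) by (intro mult_divide_mult_cancel_left) auto
  finally show ?thesis .
qed

lemma marked_tree:
  fixes T :: "('v, ('k^3^(5 option)) set) metric_tree"
  assumes m: "marked C \<mu>" and T: "metric_tree_of_curve val p C T" and d: "distinct [a, b, c, d]"
  shows "val (cross_ratio (q a) (q b) (q c) (q d)) = ereal (quartet T (\<mu> a) (\<mu> b) (\<mu> c) (\<mu> d))"
proof -
  have L: "leaves T = range \<mu>" using m T unfolding marked_def metric_tree_of_curve_def by simp
  obtain \<psi> g where c: "curve_param C \<psi> g" and \<mu>: "\<And>a s. s \<in> P1 \<Longrightarrow> \<psi> s \<in> \<mu> a \<longleftrightarrow> bracket s (q a) = 0"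
    using m unfolding marked_def by blast
  have mem: "\<mu> a \<in> minus_one_curves p" for a
  proof -
    have "\<mu> a \<in> meeting_curves p C" using m by (simp add: marked_def)
    then show ?thesis by (simp add: meeting_curves_def)
  qed
  have "\<exists>\<psi> x. isomorphism P1 C \<psi> \<and> (\<forall>D\<in>leaves T. x D \<in> P1 \<and> \<psi> (x D) \<in> D) \<and>
      (\<forall>a\<in>leaves T. \<forall>b\<in>leaves T. \<forall>c\<in>leaves T. \<forall>d\<in>leaves T. distinct [a, b, c, d] \<longrightarrow>
         val (cross_ratio (x a) (x b) (x c) (x d)) = ereal (quartet T a b c d))"
    using T unfolding metric_tree_of_curve_def quartet_def by (elim conjE)
  then obtain \<psi>' x where iso: "isomorphism P1 C \<psi>'" and x: "\<forall>D\<in>leaves T. x D \<in> P1 \<and> \<psi>' (x D) \<in> D"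
    and v: "\<forall>a\<in>leaves T. \<forall>b\<in>leaves T. \<forall>c\<in>leaves T. \<forall>d\<in>leaves T. distinct [a, b, c, d] \<longrightarrow>
          val (cross_ratio (x a) (x b) (x c) (x d)) = ereal (quartet T a b c d)"
    by (elim exE conjE)
  have "distinct [\<mu> a, \<mu> b, \<mu> c, \<mu> d]" using d marked_inj[OF m] by (auto simp: inj_eq)
  then have "val (cross_ratio (x (\<mu> a)) (x (\<mu> b)) (x (\<mu> c)) (x (\<mu> d))) = ereal (quartet T (\<mu> a) (\<mu> b) (\<mu> c) (\<mu> d))"
    by (intro v[rule_format]) (simp_all add: L)
  then show ?thesis using cross_ratio_marks[OF iso c \<mu> mem, of x a b c d] x L by simp
qed

text \<open>
  Matching leaves with the same label \<open>a\<close> matches all quartet values, as these are the valuations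
  of the same cross-ratios of the \<open>q a\<close>.
\<close>

lemma trees_identical:
  fixes T :: "('v, ('k^3^(5 option)) set) metric_tree" and T' :: "('w, ('k^3^(5 option)) set) metric_tree"
  assumes C: "C \<in> minus_one_curves p" "metric_tree_of_curve val p C T"
    and D: "D \<in> minus_one_curves p" "metric_tree_of_curve val p D T'"
  shows "identical_up_to_relabeling T T'"
proof -
  obtain \<mu> where \<mu>: "marked C \<mu>" using all_marked[OF C(1)] by blast
  obtain \<nu> where \<nu>: "marked D \<nu>" using all_marked[OF D(1)] by blast
  have L: "leaves T = range \<mu>" "leaves T' = range \<nu>"
    using C D \<mu> \<nu> unfolding marked_def metric_tree_of_curve_def by simp_all
  have "is_metric_tree T" "card (leaves T) = 5"
    using C(2) unfolding metric_tree_of_curve_def by - (elim conjE, assumption)+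
  then obtain pos where pos: "caterpillar T pos" using metric_tree_caterpillar by blast
  have "is_metric_tree T'" "card (leaves T') = 5"
    using D(2) unfolding metric_tree_of_curve_def by - (elim conjE, assumption)+
  then obtain pos' where pos': "caterpillar T' pos'" using metric_tree_caterpillar by blast
  define \<sigma> where "\<sigma> = \<nu> \<circ> inv \<mu>"
  have \<sigma>: "\<sigma> (\<mu> a) = \<nu> a" for a using marked_inj[OF \<mu>] by (simp add: \<sigma>_def)
  have bij: "bij_betw \<sigma> (leaves T) (leaves T')"
    unfolding bij_betw_def L
  proof
    show "inj_on \<sigma> (range \<mu>)"
    proof (rule inj_onI)
      fix x y assume "x \<in> range \<mu>" "y \<in> range \<mu>" and e: "\<sigma> x = \<sigma> y"
      then obtain a b where ab: "x = \<mu> a" "y = \<mu> b" by blast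
      then have "\<nu> a = \<nu> b" using e \<sigma> by simp
      then show "x = y" using ab injD[OF marked_inj[OF \<nu>]] by blast
    qed
    show "\<sigma> ` range \<mu> = range \<nu>" by (simp only: image_image \<sigma>)
  qed
  show ?thesis
  proof (rule caterpillars_isomorphic[OF pos pos' bij])
    fix w x y z assume m: "{w, x, y, z} \<subseteq> leaves T" and dist: "distinct [w, x, y, z]"
    then obtain a b c d where abcd: "w = \<mu> a" "x = \<mu> b" "y = \<mu> c" "z = \<mu> d" unfolding L by auto
    then have "distinct [a, b, c, d]" using dist by auto
    then have "ereal (quartet T (\<mu> a) (\<mu> b) (\<mu> c) (\<mu> d)) = ereal (quartet T' (\<nu> a) (\<nu> b) (\<nu> c) (\<nu> d))"
      using marked_tree[OF \<mu> C(2)] marked_tree[OF \<nu> D(2)] by metis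
    then show "quartet T' (\<sigma> w) (\<sigma> x) (\<sigma> y) (\<sigma> z) = quartet T w x y z" by (simp add: abcd \<sigma>)
  qed
qed

text \<open>
  The Pluecker relation between the brackets of four points gives the four-point condition for
  their valuations.
\<close>

lemma tree_exists:
  assumes val: "nonarch_valuation val" and C: "C \<in> minus_one_curves p"
  shows "\<exists>T :: (nat, ('k^3^(5 option)) set) metric_tree. metric_tree_of_curve val p C T"
proof -
  obtain \<mu> where \<mu>: "marked C \<mu>" using all_marked[OF C] by blast
  obtain \<psi> g where c: "curve_param C \<psi> g" and meet: "\<And>a s. s \<in> P1 \<Longrightarrow> \<psi> s \<in> \<mu> a \<longleftrightarrow> bracket s (q a) = 0"
    using \<mu> unfolding marked_def by blast
  define L where "L = range \<mu>"
  define m where "m D = q (inv \<mu> D)" for D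
  have m\<mu>: "m (\<mu> a) = q a" for a using marked_inj[OF \<mu>] by (simp add: m_def)
  define W where "W D D' = rval val (bracket (m D) (m D'))" for D D'
  have card: "card L = 5" unfolding L_def using card_image[OF marked_inj[OF \<mu>]] by simp
  have nz: "bracket (m D) (m D') \<noteq> 0" if "D \<in> L" "D' \<in> L" "D \<noteq> D'" for D D'
  proof -
    obtain a b where "D = \<mu> a" "D' = \<mu> b" using \<open>D \<in> L\<close> \<open>D' \<in> L\<close> unfolding L_def by blast
    then show ?thesis using q[of a b] m\<mu> \<open>D \<noteq> D'\<close> by auto
  qed
  note rv = rval_mult[OF val] rval_add[OF val]
  have sym: "W D D' = W D' D" for D D'
    using rval_uminus[OF val, of "bracket (m D) (m D')"] by (simp add: W_def bracket_swap[of "m D'"])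
  have four: "W x y + W z w \<ge> min (W x z + W y w) (W x w + W y z)"
    if "{x, y, z, w} \<subseteq> L" "distinct [x, y, z, w]" for x y z w
  proof -
    have n: "bracket (m x) (m y) \<noteq> 0" "bracket (m z) (m w) \<noteq> 0" "bracket (m x) (m z) \<noteq> 0"
      "bracket (m y) (m w) \<noteq> 0" "bracket (m x) (m w) \<noteq> 0" "bracket (m y) (m z) \<noteq> 0"
      using nz that by auto
    have e: "bracket (m x) (m y) * bracket (m z) (m w) =
       bracket (m x) (m z) * bracket (m y) (m w) + - (bracket (m x) (m w) * bracket (m y) (m z))"
      using plucker[of "m x" "m y" "m z" "m w"] by (simp add: algebra_simps)
    have "rval val (bracket (m x) (m y) * bracket (m z) (m w)) \<ge>
       min (rval val (bracket (m x) (m z) * bracket (m y) (m w))) (rval val (- (bracket (m x) (m w) * bracket (m y) (m z))))"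
      unfolding e by (rule rv(2)) (use n e in \<open>auto simp del: mult_eq_0_iff simp: e[symmetric]\<close>)
    then show ?thesis unfolding W_def using n by (simp add: rval_uminus[OF val] rv(1))
  qed
  obtain T :: "(nat, ('k^3^(5 option)) set) metric_tree" where T: "is_metric_tree T" "leaves T = L"
    "\<And>a b c d. a \<in> L \<Longrightarrow> b \<in> L \<Longrightarrow> c \<in> L \<Longrightarrow> d \<in> L \<Longrightarrow> distinct [a, b, c, d] \<Longrightarrow>
       quartet T a b c d = W a c + W b d - W a d - W b c"
    using tree_of_four_point[where W = W, OF card sym four] by blast
  have "val (cross_ratio (m a) (m b) (m c) (m d)) = ereal (quartet T a b c d)"
    if "a \<in> L" "b \<in> L" "c \<in> L" "d \<in> L" "distinct [a, b, c, d]" for a b c d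
  proof -
    have n: "bracket (m a) (m c) \<noteq> 0" "bracket (m b) (m d) \<noteq> 0" "bracket (m a) (m d) \<noteq> 0" "bracket (m b) (m c) \<noteq> 0"
      using nz that by auto
    then have "val (cross_ratio (m a) (m b) (m c) (m d)) = ereal (rval val (cross_ratio (m a) (m b) (m c) (m d)))"
      by (intro val_rval[OF val]) (simp add: cross_ratio_def)
    also have "rval val (cross_ratio (m a) (m b) (m c) (m d)) = W a c + W b d - (W a d + W b c)"
      unfolding cross_ratio_def W_def using n by (simp add: rval_divide[OF val] rv(1))
    also have "\<dots> = quartet T a b c d" using T(3)[OF that] by simp
    finally show ?thesis .
  qed
  moreover have "m D \<in> P1 \<and> \<psi> (m D) \<in> D" if "D \<in> L" for D
    using that qP meet[OF qP] unfolding L_def by (auto simp: m\<mu>)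
  ultimately have "\<exists>\<psi> x. isomorphism P1 C \<psi> \<and> (\<forall>D\<in>leaves T. x D \<in> P1 \<and> \<psi> (x D) \<in> D) \<and>
      (\<forall>a\<in>leaves T. \<forall>b\<in>leaves T. \<forall>c\<in>leaves T. \<forall>d\<in>leaves T. distinct [a, b, c, d] \<longrightarrow>
         val (cross_ratio (x a) (x b) (x c) (x d)) = ereal (quartet T a b c d))"
    using curve_param_isomorphism[OF c] unfolding T(2) by blast
  moreover have "leaves T = meeting_curves p C" using \<mu> T(2) by (simp add: marked_def L_def)
  ultimately have "metric_tree_of_curve val p C T"
    unfolding metric_tree_of_curve_def quartet_def using T(1) card T(2) by (intro conjI) simp_all
  then show ?thesis by blast
qed

end

theorem corollary1p3:
  fixes val :: "'k::field_char_0 \<Rightarrow> ereal"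
    and p :: "5 \<Rightarrow> 'k^3"
  assumes "nonarch_valuation val"
    and "general_position p"
  shows "(\<forall>C\<in>minus_one_curves p.
            \<exists>T :: (nat, ('k^3^(5 option)) set) metric_tree. metric_tree_of_curve val p C T) \<and>
         (\<forall>C\<in>minus_one_curves p. \<forall>D\<in>minus_one_curves p.
            \<forall>(T :: (nat, ('k^3^(5 option)) set) metric_tree)
              (T' :: (nat, ('k^3^(5 option)) set) metric_tree).
              metric_tree_of_curve val p C T \<and> metric_tree_of_curve val p D T' \<longrightarrow>
              identical_up_to_relabeling T T')"
proof -
  obtain A B q where "conic_points p A B q" using conic_chart[OF assms(2)] by blast
  then interpret conic_points p A B q .
  show ?thesis using tree_exists[OF assms(1)] trees_identical by blast
qed

end
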